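(* Let $p,w\in\mathcal{AP}_+(\mathbb{R},\mathbb{R})$ and $q\in\mathcal{AP}(\mathbb{R},\mathbb{R})$, write $\mathbf{v}=(\frac1p,q,w)$, and let $L_{\mathbf{v}}$ be the self-adjoint Sturm-Liouville operator on $\mathcal{L}^2(\mathbb{R},w(x)\mathrm{d}x)$ given by $L_{\mathbf{v}}f=\frac1w\big(-(pf')'+qf\big)$ on its maximal domain. Let $\mathrm{J}$ be an open interval contained in $\mathbb{R}\setminus\sigma(L_{\mathbf{v}})$. Then the rotation number $\rho(\lambda,\mathbf{v})$ is constant for $\lambda\in\mathrm{J}$, and $$2\rho(\lambda,\mathbf{v})\in\mathcal{M}_{\mathbf{v}}\qquad\text{for }\lambda\in\mathrm{J}.$$
   Context: A continuous $f:\mathbb{R}\to\mathbb{K}$ ($\mathbb{K}=\mathbb{R}$ or $\mathbb{C}$) is Bohr almost periodic if every real sequence has a subsequence $\{t_n\}$ such that the shifts $f\cdot t_n:=f(\cdot+t_n)$ converge uniformly on $\mathbb{R}$; $\mathcal{AP}(\mathbb{R},\mathbb{K})$ is the set of such functions. The hull $\mathrm{E}(f)$ is the closure of $\{f\cdot t:t\in\mathbb{R}\}$ in the uniform norm. $\mathcal{AP}_+(\mathbb{R},\mathbb{R})$ is the set of $f\in\mathcal{AP}(\mathbb{R},\mathbb{R})$ such that every $\widetilde f\in\mathrm{E}(f)$ is positive, i.e. $\widetilde f(x)>0$ for all $x\in\mathbb{R}$. For $f\in\mathcal{AP}(\mathbb{R},\mathbb{K})$ and $\lambda\in\mathbb{R}$,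 $\hat f(\lambda):=\lim_{t\to+\infty}\frac1t\int_0^t f(x)\mathrm{e}^{-\mathrm{i}\lambda x}\,\mathrm{d}x$; the frequency module $\mathcal{M}_f$ is the smallest additive subgroup of $\mathbb{R}$ containing $\{\lambda\in\mathbb{R}:\hat f(\lambda)\ne0\}$. $\mathcal{M}_{\mathbf{v}}$ is the additive subgroup of $\mathbb{R}$ generated by $\mathcal{M}_p\cup\mathcal{M}_q\cup\mathcal{M}_w$. The maximal domain is $\{f\in\mathcal{L}^2(\mathbb{R},w\,\mathrm{d}x): f,\,pf'\text{ locally absolutely continuous},\ \frac1w(-(pf')'+qf)\in\mathcal{L}^2(\mathbb{R},w\,\mathrm{d}x)\}$; the operator $L_{\mathbf{v}}$ is densely defined and self-adjoint on it. $\sigma$ denotes the spectrum. Rotation number: for $\lambda\in\mathbb{R}$ and any non-trivial real solution $\phi$ of $-(p\phi')'+q\phi=\lambda w\phi$, let $\theta_\lambda(x)$ be a continuous branch of $\arg(p(x)\phi'(x)+\mathrm{i}\phi(x))$; then $\rho(\lambda,\mathbf{v}):=\lim_{x\to+\infty}\frac{\theta_\lambda(x)-\theta_\lambda(0)}{x}$, which exists and does not depend on $\phi$. *)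

theory Defs
  imports "HOL-Analysis.Analysis" "HOL-Computational_Algebra.Group_Closure"
begin

subsection \<open>Almost periodic functions\<close>

definition almost_periodic :: "(real \<Rightarrow> 'a::real_normed_field) \<Rightarrow> bool" where
  "almost_periodic f \<longleftrightarrow> continuous_on UNIV f \<and>
     (\<forall>s :: nat \<Rightarrow> real. \<exists>r. strict_mono r \<and>
        uniformly_convergent_on UNIV (\<lambda>n x. f (x + s (r n))))"

text \<open>The uniform closure of the set of translates. The distance is written out pointwise because
  the sup norm is not available on arbitrary functions; a uniform limit of translates of a
  continuous function is automatically continuous.\<close>

definition ap_hull :: "(real \<Rightarrow> 'a::real_normed_field) \<Rightarrow> (real \<Rightarrow> 'a) set" where
  "ap_hull f = {g. \<forall>\<epsilon>>0. \<exists>t. \<forall>x. dist (f (x + t)) (g x) < \<epsilon>}"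

definition almost_periodic_pos :: "(real \<Rightarrow> real) \<Rightarrow> bool" where
  "almost_periodic_pos f \<longleftrightarrow> almost_periodic f \<and> (\<forall>g\<in>ap_hull f. \<forall>x. g x > 0)"

definition bohr_coeff :: "(real \<Rightarrow> complex) \<Rightarrow> real \<Rightarrow> complex" where
  "bohr_coeff f l =
     Lim at_top (\<lambda>t. (1 / of_real t) * integral {0..t} (\<lambda>x. f x * exp (- \<i> * of_real (l * x))))"

definition frequency_module :: "(real \<Rightarrow> complex) \<Rightarrow> real set" where
  "frequency_module f = group_closure {l. bohr_coeff f l \<noteq> 0}"

definition joint_frequency_module ::
    "(real \<Rightarrow> real) \<Rightarrow> (real \<Rightarrow> real) \<Rightarrow> (real \<Rightarrow> real) \<Rightarrow> real set" where
  "joint_frequency_module p q w = group_closure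
     (frequency_module (\<lambda>x. of_real (p x)) \<union> frequency_module (\<lambda>x. of_real (q x)) \<union>
      frequency_module (\<lambda>x. of_real (w x)))"

subsection \<open>Unbounded operators on square-integrable functions and their spectrum\<close>

text \<open>Elements of the Hilbert space are represented by functions, and equality in it is equality
  almost everywhere.\<close>

definition L2 :: "'a measure \<Rightarrow> ('a \<Rightarrow> complex) set" where
  "L2 M = {f. f \<in> borel_measurable M \<and> integrable M (\<lambda>x. (norm (f x))\<^sup>2)}"

definition L2_norm :: "'a measure \<Rightarrow> ('a \<Rightarrow> complex) \<Rightarrow> real" where
  "L2_norm M f = sqrt (integral\<^sup>L M (\<lambda>x. (norm (f x))\<^sup>2))"

text \<open>For an operator \<open>A\<close> with domain \<open>D\<close>, both contained in \<open>L2 M\<close>: \<open>z\<close> belongs to the resolvent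
  set if \<open>A - z\<close> maps \<open>D\<close> injectively and onto \<open>L2 M\<close>, with bounded inverse.\<close>

definition resolvent_set ::
    "'a measure \<Rightarrow> ('a \<Rightarrow> complex) set \<Rightarrow> (('a \<Rightarrow> complex) \<Rightarrow> 'a \<Rightarrow> complex) \<Rightarrow> complex set" where
  "resolvent_set M D A = {z.
     (\<forall>f\<in>D. \<forall>g\<in>D. (AE x in M. A f x - z * f x = A g x - z * g x) \<longrightarrow> (AE x in M. f x = g x)) \<and>
     (\<forall>g\<in>L2 M. \<exists>f\<in>D. AE x in M. A f x - z * f x = g x) \<and>
     (\<exists>C. \<forall>f\<in>D. L2_norm M f \<le> C * L2_norm M (\<lambda>x. A f x - z * f x))}"

definition operator_spectrum ::
    "'a measure \<Rightarrow> ('a \<Rightarrow> complex) set \<Rightarrow> (('a \<Rightarrow> complex) \<Rightarrow> 'a \<Rightarrow> complex) \<Rightarrow> complex set" where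
  "operator_spectrum M D A = - resolvent_set M D A"

subsection \<open>The Sturm-Liouville operator\<close>

definition abs_continuous_on_interval ::
    "real \<Rightarrow> real \<Rightarrow> (real \<Rightarrow> 'a::real_normed_vector) \<Rightarrow> bool" where
  "abs_continuous_on_interval a b f \<longleftrightarrow>
     (\<forall>\<epsilon>>0. \<exists>\<delta>>0. \<forall>(n::nat) u v.
        (\<forall>k<n. a \<le> u k \<and> u k \<le> v k \<and> v k \<le> b) \<and>
        disjoint_family_on (\<lambda>k. {u k<..<v k}) {..<n} \<and> (\<Sum>k<n. v k - u k) < \<delta>
        \<longrightarrow> (\<Sum>k<n. norm (f (v k) - f (u k))) < \<epsilon>)"

definition locally_abs_continuous :: "(real \<Rightarrow> 'a::real_normed_vector) \<Rightarrow> bool" where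
  "locally_abs_continuous f \<longleftrightarrow> (\<forall>a b. abs_continuous_on_interval a b f)"

definition weighted_measure :: "(real \<Rightarrow> real) \<Rightarrow> real measure" where
  "weighted_measure w = density lebesgue (\<lambda>x. ennreal (w x))"

definition quasi_deriv :: "(real \<Rightarrow> real) \<Rightarrow> (real \<Rightarrow> complex) \<Rightarrow> real \<Rightarrow> complex" where
  "quasi_deriv p f = (\<lambda>x. of_real (p x) * vector_derivative f (at x))"

text \<open>On the maximal domain \<open>vector_derivative (quasi_deriv p f) (at x)\<close> is meaningful for almost all
  \<open>x\<close> only, which determines \<open>SL_op p q w f\<close> as an element of the Hilbert space.\<close>

definition SL_op ::
    "(real \<Rightarrow> real) \<Rightarrow> (real \<Rightarrow> real) \<Rightarrow> (real \<Rightarrow> real) \<Rightarrow> (real \<Rightarrow> complex) \<Rightarrow> real \<Rightarrow> complex" where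
  "SL_op p q w f = (\<lambda>x. (1 / of_real (w x)) *
     (- vector_derivative (quasi_deriv p f) (at x) + of_real (q x) * f x))"

definition SL_domain ::
    "(real \<Rightarrow> real) \<Rightarrow> (real \<Rightarrow> real) \<Rightarrow> (real \<Rightarrow> real) \<Rightarrow> (real \<Rightarrow> complex) set" where
  "SL_domain p q w = {f \<in> L2 (weighted_measure w).
     locally_abs_continuous f \<and> locally_abs_continuous (quasi_deriv p f) \<and>
     SL_op p q w f \<in> L2 (weighted_measure w)}"

definition SL_spectrum ::
    "(real \<Rightarrow> real) \<Rightarrow> (real \<Rightarrow> real) \<Rightarrow> (real \<Rightarrow> real) \<Rightarrow> complex set" where
  "SL_spectrum p q w = operator_spectrum (weighted_measure w) (SL_domain p q w) (SL_op p q w)"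

subsection \<open>The rotation number\<close>

text \<open>The coefficients are continuous, so solutions are understood in the classical sense.\<close>

definition SL_solution ::
    "(real \<Rightarrow> real) \<Rightarrow> (real \<Rightarrow> real) \<Rightarrow> (real \<Rightarrow> real) \<Rightarrow> real \<Rightarrow> (real \<Rightarrow> real) \<Rightarrow> bool" where
  "SL_solution p q w l \<phi> \<longleftrightarrow>
     (\<forall>x. \<phi> differentiable at x) \<and> (\<forall>x. (\<lambda>y. p y * deriv \<phi> y) differentiable at x) \<and>
     (\<forall>x. - deriv (\<lambda>y. p y * deriv \<phi> y) x + q x * \<phi> x = l * w x * \<phi> x)"

definition phase_branch :: "(real \<Rightarrow> real) \<Rightarrow> (real \<Rightarrow> real) \<Rightarrow> (real \<Rightarrow> real) \<Rightarrow> bool" where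
  "phase_branch p \<phi> \<theta> \<longleftrightarrow> continuous_on UNIV \<theta> \<and>
     (\<forall>x. is_Arg (Complex (p x * deriv \<phi> x) (\<phi> x)) (\<theta> x))"

definition has_rotation_number ::
    "(real \<Rightarrow> real) \<Rightarrow> (real \<Rightarrow> real) \<Rightarrow> (real \<Rightarrow> real) \<Rightarrow> real \<Rightarrow> real \<Rightarrow> bool" where
  "has_rotation_number p q w l \<rho> \<longleftrightarrow>
     (\<forall>\<phi> \<theta>. SL_solution p q w l \<phi> \<and> (\<exists>x. \<phi> x \<noteq> 0) \<and> phase_branch p \<phi> \<theta>
        \<longrightarrow> ((\<lambda>x. (\<theta> x - \<theta> 0) / x) \<longlongrightarrow> \<rho>) at_top)"

definition rotation_number ::
    "(real \<Rightarrow> real) \<Rightarrow> (real \<Rightarrow> real) \<Rightarrow> (real \<Rightarrow> real) \<Rightarrow> real \<Rightarrow> real" where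
  "rotation_number p q w l = (THE \<rho>. has_rotation_number p q w l \<rho>)"

end

theory Submission
  imports Defs
begin

text \<open>Applying the bounded resolvent to cut-off solutions shows that every solution \<open>Y = (\<phi>, p\<phi>')\<close>
  satisfies \<open>\<integral>\<^sub>s\<^sup>t |Y|\<^sup>2 \<le> K (|Y(s)|\<^sup>2 + |Y(t)|\<^sup>2)\<close>, with \<open>K\<close> locally uniform in \<open>\<lambda>\<close>. As transfer
  matrices have determinant one, some solution decays at \<open>+\<infinity>\<close> and satisfies \<open>\<integral>\<^sub>s\<^sup>\<infinity> |Y|\<^sup>2 \<le> K |Y(s)|\<^sup>2\<close>.
  Integrating the derivative of the Wronskian of two such solutions, for two sets of coefficients,
  shows that the sine of their phase difference is at most a constant times the distance of the
  coefficients. So the phase \<open>\<theta>\<close> of the decaying solution, modulo \<open>\<pi>\<close>, inherits the almost periods of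
  the coefficients and depends continuously on \<open>\<lambda>\<close>. Its mean slope \<open>\<rho>\<close> is therefore locally constant
  in \<open>\<lambda>\<close>, and \<open>|sin (\<rho> s)|\<close> is small for every sufficiently good almost period \<open>s\<close> of the coefficients.

  If \<open>2\<rho>\<close> were not in the frequency module, there would be arbitrarily good almost periods \<open>s\<close> with
  \<open>cos (2\<rho>s) \<le> 1/2\<close>: pick \<open>t\<^sub>n\<close> for which \<open>e\<^sup>i\<^sup>v\<^sup>t\<close> is nearly one at the first \<open>n\<close> frequencies \<open>v\<close> while
  \<open>cos (2\<rho>t\<^sub>n) \<le> 1/2\<close>. By the uniqueness theorem for Bohr coefficients, the translates by \<open>t\<^sub>n\<close> of
  each coefficient function converge uniformly to the function itself along a subsequence.\<close>

subsection \<open>Almost periodic functions\<close>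

text \<open>The decaying solution is singled out because an arbitrary solution only shares its mean
  slope: the two phases stay at bounded distance, which says nothing about how almost periods act on
  the phase. A solution and its negative have phases that differ by \<open>pi\<close>, so phases can
  only be compared modulo \<open>pi\<close>; this is the origin of the factor 2 in the conclusion.
  The equation contains \<open>1 / p\<close> while the module is built from \<open>p\<close>; a
  positive lower bound of \<open>p\<close>, which comes from positivity on the hull, turns almost
  periods of \<open>p\<close> into almost periods of \<open>1 / p\<close>. As \<open>p\<close> is
  merely continuous, a solution times a smooth cut-off need not lie in the domain of the operator;
  the cut-off \<open>\<eta>\<close> is therefore built so that \<open>p * \<eta>'\<close> is
  continuously differentiable.\<close>

lemma sphere_convergent_subseq:
  fixes c :: "nat \<Rightarrow> 'a::euclidean_space"
  assumes "\<And>n. c n \<in> sphere a e"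
  obtains l r where "l \<in> sphere a e" "strict_mono r" "(c \<circ> r) \<longlonglongrightarrow> l"
proof -
  have *: "\<forall>c::nat \<Rightarrow> 'a. (\<forall>n. c n \<in> sphere a e) \<longrightarrow> (\<exists>l\<in>sphere a e. \<exists>r. strict_mono r \<and> (c \<circ> r) \<longlonglongrightarrow> l)"
    using compact_sphere[of a e] unfolding compact_def .
  show thesis
    using *[THEN spec, of c] assms that by auto
qed

lemma almost_periodic_continuous: "almost_periodic f \<Longrightarrow> continuous_on UNIV f"
  by (simp add: almost_periodic_def)

lemma almost_periodic_subseq:
  fixes f :: "real \<Rightarrow> 'a::real_normed_field" and s :: "nat \<Rightarrow> real"
  assumes "almost_periodic f"
  obtains r g where "strict_mono r" "uniform_limit UNIV (\<lambda>n x. f (x + s (r n))) g sequentially"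
  using assms unfolding almost_periodic_def uniformly_convergent_on_def by meson

text \<open>Total boundedness of the set of translates. Without a finite net, translates could be
  chosen one after another at distance at least \<open>e\<close> from all earlier ones, and no
  subsequence would be uniformly Cauchy. In the estimates of means and densities below, this net
  replaces relatively dense sets of almost periods.\<close>

lemma almost_periodic_finite_net:
  fixes f :: "real \<Rightarrow> 'a::real_normed_field"
  assumes f: "almost_periodic f" and e: "e > 0"
  obtains T where "finite T" "\<And>s. \<exists>t\<in>T. \<forall>x. dist (f (x + s)) (f (x + t)) < e"
proof (rule ccontr)
  assume nt: "\<not> thesis"
  define P where "P g n r \<longleftrightarrow> (\<forall>m<n. \<exists>x. dist (f (x + r)) (f (x + g m)) \<ge> e)"
    for g :: "nat \<Rightarrow> real" and n r
  have "\<exists>g. \<forall>n. P g n (g n)"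
  proof (rule dependent_wellorder_choice)
    fix n :: nat and g :: "nat \<Rightarrow> real"
    have "\<not> (\<forall>s. \<exists>t\<in>g ` {..<n}. \<forall>x. dist (f (x + s)) (f (x + t)) < e)"
      using nt that[of "g ` {..<n}"] by blast
    then obtain s where "\<forall>t\<in>g ` {..<n}. \<exists>x. \<not> dist (f (x + s)) (f (x + t)) < e"
      by blast
    then show "\<exists>r. P g n r"
      unfolding P_def not_less[symmetric] by (intro exI[of _ s]) blast
  qed (simp add: P_def)
  then obtain g :: "nat \<Rightarrow> real" where g: "\<And>n m. m < n \<Longrightarrow> \<exists>x. dist (f (x + g n)) (f (x + g m)) \<ge> e"
    unfolding P_def by blast
  obtain r h where r: "strict_mono r"
    and lim: "uniform_limit UNIV (\<lambda>n x. f (x + g (r n))) h sequentially"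
    using almost_periodic_subseq[OF f, of g] by blast
  have "uniformly_Cauchy_on UNIV (\<lambda>n x. f (x + g (r n)))"
    using lim uniformly_convergent_Cauchy uniformly_convergent_on_def by blast
  then obtain M where M: "\<forall>x. \<forall>m\<ge>M. \<forall>n\<ge>M. dist (f (x + g (r m))) (f (x + g (r n))) < e"
    unfolding uniformly_Cauchy_on_def using e by blast
  have "r M < r (Suc M)"
    using r by (simp add: strict_mono_def)
  from g[OF this] obtain x where "dist (f (x + g (r (Suc M)))) (f (x + g (r M))) \<ge> e"
    by blast
  with M show False
    by (metis le_SucI linorder_not_le order_refl)
qed

text \<open>Comparing translates at the point 0 alone, \<open>f s\<close> is within 1 of
  \<open>f t\<close> for one of finitely many \<open>t\<close>.\<close>

lemma almost_periodic_bounded: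
  fixes f :: "real \<Rightarrow> 'a::real_normed_field"
  assumes f: "almost_periodic f"
  obtains B where "B > 0" "\<And>x. norm (f x) \<le> B"
proof -
  obtain T where T: "finite T" "\<And>s. \<exists>t\<in>T. \<forall>x. dist (f (x + s)) (f (x + t)) < 1"
    using almost_periodic_finite_net[OF f, of 1] by auto
  have "norm (f s) \<le> 1 + (\<Sum>t\<in>T. norm (f t))" for s
  proof -
    obtain t where t: "t \<in> T" "dist (f (0 + s)) (f (0 + t)) < 1"
      using T(2) by blast
    have "norm (f s) \<le> norm (f t) + 1"
      using t(2) norm_triangle_sub[of "f s" "f t"] by (simp add: dist_norm)
    moreover have "norm (f t) \<le> (\<Sum>t\<in>T. norm (f t))"
      using t(1) T(1) by (intro member_le_sum) auto
    ultimately show ?thesis by simp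
  qed
  moreover have "0 < 1 + (\<Sum>t\<in>T. norm (f t))"
    by (simp add: add_pos_nonneg sum_nonneg)
  ultimately show ?thesis using that by blast
qed

text \<open>Up to \<open>e/3\<close>, \<open>f\<close> behaves near any point as it does near one of
  the finitely many \<open>t\<close> of a net, so continuity at these \<open>t\<close>
  suffices.\<close>

lemma almost_periodic_uniformly_continuous:
  fixes f :: "real \<Rightarrow> 'a::real_normed_field"
  assumes f: "almost_periodic f" and e: "e > 0"
  obtains d where "d > 0" "\<And>x y. \<bar>x - y\<bar> < d \<Longrightarrow> dist (f x) (f y) < e"
proof -
  obtain T where T: "finite T" "\<And>s. \<exists>t\<in>T. \<forall>x. dist (f (x + s)) (f (x + t)) < e/3"
    using almost_periodic_finite_net[OF f, of "e/3"] e by auto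
  have "\<forall>t. \<exists>d>0. \<forall>h. \<bar>h\<bar> < d \<longrightarrow> dist (f (h + t)) (f t) < e/3"
  proof
    fix t
    have "isCont f t"
      using almost_periodic_continuous[OF f] by (simp add: continuous_on_eq_continuous_at)
    then obtain d where "d > 0" "\<And>y. dist y t < d \<Longrightarrow> dist (f y) (f t) < e/3"
      using e by (metis continuous_at_eps_delta divide_pos_pos zero_less_numeral)
    then show "\<exists>d>0. \<forall>h. \<bar>h\<bar> < d \<longrightarrow> dist (f (h + t)) (f t) < e/3"
      by (intro exI[of _ d]) (auto simp: dist_real_def)
  qed
  then obtain D where D: "\<And>t. D t > 0" "\<And>t h. \<bar>h\<bar> < D t \<Longrightarrow> dist (f (h + t)) (f t) < e/3"
    by metis
  define d where "d = Min (insert 1 (D ` T))"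
  have d: "d > 0" "\<And>t. t \<in> T \<Longrightarrow> d \<le> D t"
    using T(1) D(1) by (auto simp: d_def)
  have "dist (f x) (f y) < e" if "\<bar>x - y\<bar> < d" for x y
  proof -
    obtain t where t: "t \<in> T" "\<And>x. dist (f (x + y)) (f (x + t)) < e/3"
      using T(2) by blast
    have "dist (f (x - y + t)) (f t) < e/3"
      using that d(2)[OF t(1)] by (intro D(2)) linarith
    moreover have "dist (f x) (f (x - y + t)) < e/3"
      using t(2)[of "x - y"] by simp
    moreover have "dist (f y) (f t) < e/3"
      using t(2)[of 0] by simp
    ultimately show ?thesis
      using dist_triangle3[of "f x" "f t" "f (x - y + t)"] dist_triangle2[of "f x" "f y" "f t"]
      by (simp add: dist_commute)
  qed
  with d(1) show ?thesis using that by blast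
qed

lemma strict_mono_uniform_limit:
  assumes "uniform_limit S f g sequentially" "strict_mono (r :: nat \<Rightarrow> nat)"
  shows "uniform_limit S (\<lambda>n. f (r n)) g sequentially"
  using filterlim_compose[OF assms(1) filterlim_subseq[OF assms(2)]] by (simp add: o_def)

text \<open>The translate of \<open>g\<close> by \<open>v n\<close> is within
  \<open>1 / (n + 1)\<close> of the translate of \<open>f\<close> by \<open>v n + s (m n)\<close>,
  so a subsequence that works for \<open>f\<close> and these combined shifts works for
  \<open>g\<close> and \<open>v\<close>.\<close>

lemma almost_periodic_uniform_limit:
  fixes f g :: "real \<Rightarrow> 'a::real_normed_field" and s :: "nat \<Rightarrow> real"
  assumes f: "almost_periodic f"
    and lim: "uniform_limit UNIV (\<lambda>n x. f (x + s n)) g sequentially"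
  shows "almost_periodic g"
  unfolding almost_periodic_def
proof (intro conjI allI)
  have "continuous_on UNIV (\<lambda>x. f (x + s n))" for n
    by (rule continuous_on_compose2[OF almost_periodic_continuous[OF f]])
      (auto intro: continuous_intros)
  then show "continuous_on UNIV g"
    by (intro uniform_limit_theorem[OF always_eventually lim]) auto
  fix v :: "nat \<Rightarrow> real"
  have "\<exists>n. \<forall>x. dist (f (x + s n)) (g x) < inverse (Suc k)" for k :: nat
  proof -
    have "inverse (real (Suc k)) > 0" by simp
    then obtain n where "\<forall>m\<ge>n. \<forall>x\<in>UNIV. dist (f (x + s m)) (g x) < inverse (Suc k)"
      using lim unfolding uniform_limit_sequentially_iff by blast
    then show ?thesis by blast
  qed
  then obtain m where m: "\<And>k x. dist (f (x + s (m k))) (g x) < inverse (Suc k)"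
    by metis
  obtain r h where r: "strict_mono r"
    and h: "uniform_limit UNIV (\<lambda>n x. f (x + (v (r n) + s (m (r n))))) h sequentially"
    using almost_periodic_subseq[OF f, of "\<lambda>n. v n + s (m n)"] by blast
  have "uniform_limit UNIV (\<lambda>n x. g (x + v (r n))) h sequentially"
    unfolding uniform_limit_sequentially_iff
  proof (intro allI impI)
    fix e :: real assume "e > 0"
    then obtain N where N: "\<And>n x. n \<ge> N \<Longrightarrow> dist (f (x + (v (r n) + s (m (r n))))) (h x) < e/2"
      using h unfolding uniform_limit_sequentially_iff by (metis UNIV_I half_gt_zero)
    obtain K where K: "inverse (real (Suc K)) < e/2"
      using reals_Archimedean[of "e/2"] \<open>e > 0\<close> by auto
    have "dist (g (x + v (r n))) (h x) < e" if n: "n \<ge> max N K" for n x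
    proof -
      have "r n \<ge> K" using seq_suble[OF r, of n] n by simp
      then have "inverse (real (Suc (r n))) \<le> inverse (real (Suc K))"
        by (intro le_imp_inverse_le) auto
      then have "dist (f (x + v (r n) + s (m (r n)))) (g (x + v (r n))) < e/2"
        using m[of "x + v (r n)" "r n"] K by linarith
      with N[of n x] n show ?thesis
        by (metis add.assoc dist_triangle_half_r max.boundedE)
    qed
    then show "\<exists>N. \<forall>n\<ge>N. \<forall>x\<in>UNIV. dist (g (x + v (r n))) (h x) < e" by blast
  qed
  then show "\<exists>r. strict_mono r \<and> uniformly_convergent_on UNIV (\<lambda>n x. g (x + v (r n)))"
    using r uniformly_convergent_on_def by blast
qed

lemma almost_periodic_diff:
  fixes f g :: "real \<Rightarrow> 'a::real_normed_field"
  assumes f: "almost_periodic f" and g: "almost_periodic g"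
  shows "almost_periodic (\<lambda>x. f x - g x)"
  unfolding almost_periodic_def
proof (intro conjI allI)
  show "continuous_on UNIV (\<lambda>x. f x - g x)"
    using assms by (intro continuous_intros almost_periodic_continuous)
  fix s :: "nat \<Rightarrow> real"
  obtain r1 h1 where r1: "strict_mono r1"
    and h1: "uniform_limit UNIV (\<lambda>n x. f (x + s (r1 n))) h1 sequentially"
    using almost_periodic_subseq[OF f, of s] by blast
  obtain r2 h2 where r2: "strict_mono r2"
    and h2: "uniform_limit UNIV (\<lambda>n x. g (x + s (r1 (r2 n)))) h2 sequentially"
    using almost_periodic_subseq[OF g, of "\<lambda>n. s (r1 n)"] by blast
  have "uniform_limit UNIV (\<lambda>n x. f (x + s ((r1 \<circ> r2) n)) - g (x + s ((r1 \<circ> r2) n)))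
     (\<lambda>x. h1 x - h2 x) sequentially"
    using strict_mono_uniform_limit[OF h1 r2] h2 by (intro uniform_limit_intros) (simp_all add: o_def)
  then show "\<exists>r. strict_mono r \<and>
      uniformly_convergent_on UNIV (\<lambda>n x. f (x + s (r n)) - g (x + s (r n)))"
    using strict_mono_o[OF r1 r2] uniformly_convergent_on_def by blast
qed

lemma almost_periodic_translate:
  fixes f :: "real \<Rightarrow> 'a::real_normed_field"
  assumes f: "almost_periodic f"
  shows "almost_periodic (\<lambda>x. f (x + t))"
  by (rule almost_periodic_uniform_limit[OF f, of "\<lambda>_. t"])
    (simp add: uniform_limit_sequentially_iff)

lemma almost_periodic_of_real:
  fixes f :: "real \<Rightarrow> real"
  assumes f: "almost_periodic f"
  shows "almost_periodic (\<lambda>x. complex_of_real (f x))"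
  unfolding almost_periodic_def
proof (intro conjI allI)
  show "continuous_on UNIV (\<lambda>x. complex_of_real (f x))"
    using f by (intro continuous_intros almost_periodic_continuous)
  fix s :: "nat \<Rightarrow> real"
  obtain r h where r: "strict_mono r"
    and h: "uniform_limit UNIV (\<lambda>n x. f (x + s (r n))) h sequentially"
    using almost_periodic_subseq[OF f, of s] by blast
  have "uniform_limit UNIV (\<lambda>n x. complex_of_real (f (x + s (r n)))) (\<lambda>x. of_real (h x)) sequentially"
    using h by (simp add: uniform_limit_sequentially_iff)
  then show "\<exists>r. strict_mono r \<and>
      uniformly_convergent_on UNIV (\<lambda>n x. complex_of_real (f (x + s (r n))))"
    using r uniformly_convergent_on_def by blast
qed

text \<open>Translating by \<open>s\<close> multiplies \<open>cis (l * x)\<close> by the constant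
  \<open>cis (l * s)\<close>. These constants lie on the compact unit circle, so a second extraction
  makes them converge.\<close>

lemma almost_periodic_mult_cis:
  fixes f :: "real \<Rightarrow> complex"
  assumes f: "almost_periodic f"
  shows "almost_periodic (\<lambda>x. f x * cis (l * x))"
  unfolding almost_periodic_def
proof (intro conjI allI)
  show "continuous_on UNIV (\<lambda>x. f x * cis (l * x))"
    using f by (intro continuous_intros almost_periodic_continuous)
  fix s :: "nat \<Rightarrow> real"
  obtain r1 h where r1: "strict_mono r1"
    and h: "uniform_limit UNIV (\<lambda>n x. f (x + s (r1 n))) h sequentially"
    using almost_periodic_subseq[OF f, of s] by blast
  obtain z r2 where r2: "strict_mono r2" and z: "((\<lambda>n. cis (l * s (r1 n))) \<circ> r2) \<longlonglongrightarrow> z"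
  proof -
    have "\<And>n. cis (l * s (r1 n)) \<in> sphere 0 1" by simp
    from this that show ?thesis by (rule sphere_convergent_subseq)
  qed
  obtain B where B: "\<And>x. norm (f x) \<le> B"
    using almost_periodic_bounded[OF f] by blast
  have lim: "uniform_limit UNIV (\<lambda>n x. f (x + s ((r1 \<circ> r2) n))) h sequentially"
    using strict_mono_uniform_limit[OF h r2] by (simp add: o_def)
  have bh: "bounded (range h)"
  proof -
    have "norm (h x) \<le> B" for x
      using tendsto_norm[OF tendsto_uniform_limitI[OF lim, of x]] B
      by (intro tendsto_upperbound[where f="\<lambda>n. norm (f (x + s ((r1 \<circ> r2) n)))"]) auto
    then show ?thesis by (auto simp: bounded_iff)
  qed
  have "uniform_limit UNIV (\<lambda>n x. cis (l * x) * cis (l * s ((r1 \<circ> r2) n))) (\<lambda>x. cis (l * x) * z) sequentially"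
    using z unfolding uniform_limit_sequentially_iff
    by (simp add: lim_sequentially o_def dist_norm norm_mult flip: right_diff_distrib)
  moreover have "bounded (range (\<lambda>x. cis (l * x) * z))"
    by (auto simp: bounded_iff norm_mult)
  ultimately have "uniform_limit UNIV
      (\<lambda>n x. f (x + s ((r1 \<circ> r2) n)) * (cis (l * x) * cis (l * s ((r1 \<circ> r2) n))))
      (\<lambda>x. h x * (cis (l * x) * z)) sequentially"
    by (rule uniform_lim_mult[OF lim _ bh])
  then have "uniform_limit UNIV
      (\<lambda>n x. f (x + s ((r1 \<circ> r2) n)) * cis (l * (x + s ((r1 \<circ> r2) n))))
      (\<lambda>x. h x * (cis (l * x) * z)) sequentially"
    by (simp add: cis_mult distrib_left)
  then show "\<exists>r. strict_mono r \<and>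
      uniformly_convergent_on UNIV (\<lambda>n x. f (x + s (r n)) * cis (l * (x + s (r n))))"
    using strict_mono_o[OF r1 r2] uniformly_convergent_on_def by blast
qed

subsection \<open>Mean values and Bohr coefficients\<close>

lemma integral_translate:
  fixes f :: "real \<Rightarrow> 'a::banach"
  shows "integral {a..a + T} f = integral {0..T} (\<lambda>x. f (x + a))"
  using integral_shift_Icc_real[of 0 T f a] by (simp add: o_def add.commute)

lemma norm_divide_minus:
  fixes y z :: complex
  assumes "x > 0"
  shows "norm (y / of_real x - z) = norm (y - of_real x * z) / x"
proof -
  have "y / of_real x - z = (y - of_real x * z) / of_real x"
    using assms by (simp add: field_simps)
  then show ?thesis using assms by (simp add: norm_divide)
qed

text \<open>Integrals over windows of length \<open>T\<close> differ from the one starting at 0 by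
  at most \<open>d * T + C\<close>, wherever they start: at the cost \<open>d * T\<close> a window
  is moved to one of finitely many starting points \<open>t\<close> of a net, and moving it from
  \<open>t\<close> to 0 costs at most \<open>2 * B * |t|\<close>. The window integral is thus nearly
  additive in \<open>T\<close>, which makes the means Cauchy. Uniformity in \<open>a\<close> is kept
  because the coefficients of translates are computed from it.\<close>

lemma almost_periodic_mean_exists:
  fixes f :: "real \<Rightarrow> complex"
  assumes f: "almost_periodic f"
  obtains m where "\<And>e. e > 0 \<Longrightarrow>
    \<exists>T0>0. \<forall>T\<ge>T0. \<forall>a. norm (integral {a..a + T} f - of_real T * m) \<le> e * T"
proof -
  have cont: "continuous_on S f" for S
    using almost_periodic_continuous[OF f] continuous_on_subset by blast
  have int: "f integrable_on {a..b}" for a b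
    by (intro integrable_continuous_real cont)
  obtain B where B: "B > 0" "\<And>x. norm (f x) \<le> B"
    using almost_periodic_bounded[OF f] by blast
  have bnd: "norm (integral {a..b} f) \<le> B * (b - a)" if "a \<le> b" for a b
    using that B by (intro integral_bound cont)
  define I where "I T = integral {0..T} f" for T
  have split: "integral {a..b} f + integral {b..c} f = integral {a..c} f"
    if "a \<le> b" "b \<le> c" for a b c
    using that int by (intro Henstock_Kurzweil_Integration.integral_combine)
  have close: "\<exists>C\<ge>0. \<forall>a T. T \<ge> 0 \<longrightarrow> norm (integral {a..a + T} f - I T) \<le> d * T + C"
    if d: "d > 0" for d
  proof -
    obtain N where N: "finite N" "\<And>s. \<exists>t\<in>N. \<forall>x. dist (f (x + s)) (f (x + t)) < d"
      using almost_periodic_finite_net[OF f d] by blast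
    define C where "C = (\<Sum>t\<in>N. 2 * B * \<bar>t\<bar>)"
    have "norm (integral {a..a + T} f - I T) \<le> d * T + C" if T: "T \<ge> 0" for a T
    proof -
      obtain t where t: "t \<in> N" "\<And>x. dist (f (x + a)) (f (x + t)) < d"
        using N(2) by blast
      have ci: "continuous_on {0..T} (\<lambda>x. f (x + s))" for s
        by (rule continuous_on_compose2[OF cont]) (auto intro: continuous_intros)
      have "integral {a..a + T} f - integral {t..t + T} f = integral {0..T} (\<lambda>x. f (x + a) - f (x + t))"
        unfolding integral_translate
        by (intro integral_diff[symmetric] integrable_continuous_real ci)
      also have "norm \<dots> \<le> d * (T - 0)"
        using T t(2) by (intro integral_bound continuous_intros ci) (auto simp: dist_norm less_imp_le)
      finally have 1: "norm (integral {a..a + T} f - integral {t..t + T} f) \<le> d * T" by simp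
      have "norm (integral {t..t + T} f - I T) \<le> 2 * B * \<bar>t\<bar>"
      proof (cases "t \<ge> 0")
        case True
        have "integral {t..t + T} f - I T = integral {T..t + T} f - integral {0..t} f"
          using split[of 0 t "t + T"] split[of 0 T "t + T"] True T
          by (simp add: I_def algebra_simps)
        with bnd[of T "t + T"] bnd[of 0 t] True show ?thesis
          using norm_triangle_ineq4[of "integral {T..t + T} f" "integral {0..t} f"] by simp
      next
        case False
        have "integral {t..t + T} f - I T = integral {t..0} f - integral {t + T..T} f"
          using split[of t "t + T" T] split[of t 0 T] False T
          by (simp add: I_def algebra_simps)
        with bnd[of t 0] bnd[of "t + T" T] False show ?thesis
          using norm_triangle_ineq4[of "integral {t..0} f" "integral {t + T..T} f"] by simp
      qed
      also have "2 * B * \<bar>t\<bar> \<le> C"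
        unfolding C_def using t(1) N(1) B(1) by (intro member_le_sum) auto
      finally show ?thesis
        using 1 norm_triangle_ineq[of "integral {a..a + T} f - integral {t..t + T} f"
          "integral {t..t + T} f - I T"] by simp
    qed
    moreover have "C \<ge> 0" unfolding C_def using B(1) by (intro sum_nonneg) auto
    ultimately show ?thesis by blast
  qed
  have approx: "\<exists>T0>0. \<exists>z. \<forall>T\<ge>T0. norm (I T - of_real T * z) \<le> 4 * d * T" if d: "d > 0" for d
  proof -
    obtain C where C: "C \<ge> 0" "\<And>a T. T \<ge> 0 \<Longrightarrow> norm (integral {a..a + T} f - I T) \<le> d * T + C"
      using close[OF d] by blast
    \<comment> \<open>With this block length the error \<open>C\<close> of each block is at most
      \<open>d * S\<close>, a small fraction of its length.\<close>
    define S where "S = C / d + 1"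
    have S: "S > 0" "C \<le> d * S"
      using C(1) d by (auto simp: S_def field_simps add_nonneg_pos)
    have mult: "norm (I (real n * S) - of_nat n * I S) \<le> 2 * d * (real n * S)" for n
    proof (induction n)
      case (Suc n)
      have "I (real (Suc n) * S) - of_nat (Suc n) * I S
        = (I (real n * S) - of_nat n * I S) + (integral {real n * S..real n * S + S} f - I S)"
        using split[of 0 "real n * S" "real n * S + S"] S(1) by (simp add: I_def algebra_simps)
      also have "norm \<dots> \<le> 2 * d * (real n * S) + (d * S + C)"
        using S(1) by (intro norm_triangle_mono Suc.IH C(2)) simp
      also have "\<dots> \<le> 2 * d * (real (Suc n) * S)"
        using S(2) by (simp add: algebra_simps)
      finally show ?case .
    qed (simp add: I_def)
    \<comment> \<open>Beyond \<open>B * S / d\<close>, the incomplete last block and the rounding of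
      \<open>T / S\<close> cost at most \<open>d * T\<close> each.\<close>
    have "norm (I T - of_real T * (I S / of_real S)) \<le> 4 * d * T" if T: "T \<ge> B * S / d" for T
    proof -
      have T0: "T \<ge> 0" using T B(1) S(1) d by (meson divide_nonneg_pos mult_nonneg_nonneg order_trans less_imp_le)
      define n where "n = nat \<lfloor>T / S\<rfloor>"
      have "real n \<le> T / S" "T / S < real n + 1"
        using T0 S(1) by (auto simp: n_def)
      then have n: "real n * S \<le> T" "T \<le> real n * S + S" "\<bar>real n - T / S\<bar> \<le> 1"
        using S(1) by (auto simp: field_simps)
      have "I T - of_real T * (I S / of_real S)
          = (I (real n * S) - of_nat n * I S) + (integral {real n * S..T} f + of_real (real n - T / S) * I S)"
        using split[of 0 "real n * S" T] n S(1) by (simp add: I_def algebra_simps)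
      also have "norm \<dots> \<le> 2 * d * (real n * S) + (B * S + 1 * (B * S))"
      proof (intro norm_triangle_mono mult)
        show "norm (integral {real n * S..T} f) \<le> B * S"
          using bnd[OF n(1)] n(2) B(1) by (smt (verit) mult_left_mono)
        have "norm (I S) \<le> B * S" using bnd[of 0 S] S(1) by (simp add: I_def)
        then show "norm (of_real (real n - T / S) * I S) \<le> 1 * (B * S)"
          unfolding norm_mult norm_of_real using n(3) by (intro mult_mono) auto
      qed
      also have "\<dots> \<le> 2 * d * T + 2 * (d * T)"
      proof -
        have "B * S \<le> d * T" using T d by (simp add: field_simps)
        moreover have "2 * d * (real n * S) \<le> 2 * d * T" using n(1) d by (intro mult_left_mono) auto
        ultimately show ?thesis unfolding mult.assoc by linarith
      qed
      finally show ?thesis by (simp add: algebra_simps)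
    qed
    then show ?thesis
      using B(1) S(1) d by (intro exI[of _ "B * S / d"] exI[of _ "I S / of_real S"] conjI) auto
  qed
  have "Cauchy (\<lambda>n. I (real n) / of_nat n)"
  proof (rule metric_CauchyI)
    fix e :: real assume e: "e > 0"
    obtain T0 z where T0: "T0 > 0" "\<And>T. T \<ge> T0 \<Longrightarrow> norm (I T - of_real T * z) \<le> 4 * (e / 12) * T"
      using approx[of "e / 12"] e by auto
    obtain M where M: "real M \<ge> T0" using real_arch_simple by blast
    have *: "dist (I (real n) / of_nat n) z \<le> e / 3" if "n \<ge> M" for n
    proof -
      have n: "real n \<ge> T0" "real n > 0" using that M T0(1) by linarith+
      have "norm (I (real n) / of_nat n - z) = norm (I (real n) - of_real (real n) * z) / real n"
        using norm_divide_minus[of "real n" "I (real n)" z] n(2) by simp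
      also have "\<dots> \<le> e / 3" using T0(2)[OF n(1)] n(2) by (simp add: field_simps)
      finally show ?thesis by (simp add: dist_norm)
    qed
    show "\<exists>M. \<forall>m\<ge>M. \<forall>n\<ge>M. dist (I (real m) / of_nat m) (I (real n) / of_nat n) < e"
    proof (intro exI[of _ M] allI impI)
      fix m n assume "m \<ge> M" "n \<ge> M"
      then show "dist (I (real m) / of_nat m) (I (real n) / of_nat n) < e"
        using *[of m] *[of n] dist_triangle2[of "I (real m) / of_nat m" "I (real n) / of_nat n" z] e by linarith
    qed
  qed
  then obtain m where m: "(\<lambda>n. I (real n) / of_nat n) \<longlonglongrightarrow> m"
    using Cauchy_convergent_iff convergent_def by blast
  show thesis
  proof
    fix e :: real assume e: "e > 0"
    obtain T0 z where T0: "T0 > 0" "\<And>T. T \<ge> T0 \<Longrightarrow> norm (I T - of_real T * z) \<le> 4 * (e / 10) * T"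
      using approx[of "e / 10"] e by auto
    obtain C where C: "C \<ge> 0" "\<And>a T. T \<ge> 0 \<Longrightarrow> norm (integral {a..a + T} f - I T) \<le> e / 10 * T + C"
      using close[of "e / 10"] e by auto
    have "norm (m - z) \<le> 4 * (e / 10)"
    proof (rule tendsto_upperbound)
      show "(\<lambda>n. norm (I (real n) / of_nat n - z)) \<longlonglongrightarrow> norm (m - z)"
        by (intro tendsto_intros m)
      obtain M where M: "real M \<ge> T0" using real_arch_simple by blast
      show "\<forall>\<^sub>F n in sequentially. norm (I (real n) / of_nat n - z) \<le> 4 * (e / 10)"
      proof (rule eventually_sequentiallyI[of M])
        fix n assume "n \<ge> M"
        then have n: "real n \<ge> T0" "real n > 0" using M T0(1) by linarith+
        have "norm (I (real n) / of_nat n - z) = norm (I (real n) - of_real (real n) * z) / real n"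
          using norm_divide_minus[of "real n" "I (real n)" z] n(2) by simp
        also have "\<dots> \<le> 4 * (e / 10)" using T0(2)[OF n(1)] n(2) by (simp add: field_simps)
        finally show "norm (I (real n) / of_nat n - z) \<le> 4 * (e / 10)" .
      qed
    qed simp
    have "norm (integral {a..a + T} f - of_real T * m) \<le> e * T" if T: "T \<ge> max T0 (C / (e / 10))" for a T
    proof -
      have T': "T \<ge> T0" "T > 0" "C \<le> e / 10 * T" using T T0(1) e by (auto simp: field_simps)
      have "norm (of_real T * (z - m)) \<le> 4 * (e / 10) * T"
        using \<open>norm (m - z) \<le> 4 * (e / 10)\<close> T'(2) by (simp add: norm_mult norm_minus_commute mult.commute)
      then have "norm ((integral {a..a + T} f - I T) + ((I T - of_real T * z) + of_real T * (z - m)))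
          \<le> (e / 10 * T + C) + (4 * (e / 10) * T + 4 * (e / 10) * T)"
        using T' by (intro norm_triangle_mono C(2) T0(2)) auto
      also have "\<dots> \<le> e * T" using T'(3) by (simp add: field_simps)
      finally show ?thesis by (simp add: algebra_simps)
    qed
    then show "\<exists>T0>0. \<forall>T\<ge>T0. \<forall>a. norm (integral {a..a + T} f - of_real T * m) \<le> e * T"
      using T0(1) by (intro exI[of _ "max T0 (C / (e / 10))"]) auto
  qed
qed

text \<open>\<open>bohr_coeff\<close> is defined through \<open>Lim\<close>, which is meaningful
  only once convergence is known. This criterion supplies convergence and value at once, from errors
  of the additive form \<open>e * T\<close>.\<close>

lemma bohr_coeff_eqI:
  fixes f :: "real \<Rightarrow> complex"
  assumes "\<And>e. e > 0 \<Longrightarrow> \<exists>T0>0. \<forall>T\<ge>T0.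
      norm (integral {0..T} (\<lambda>x. f x * cis (- (l * x))) - of_real T * m) \<le> e * T"
  shows "bohr_coeff f l = m"
proof -
  have "((\<lambda>t. (1 / of_real t) * integral {0..t} (\<lambda>x. f x * cis (- (l * x)))) \<longlongrightarrow> m) at_top"
  proof (rule tendstoI)
    fix e :: real assume e: "e > 0"
    obtain T0 where T0: "T0 > 0" "\<And>T. T \<ge> T0 \<Longrightarrow>
        norm (integral {0..T} (\<lambda>x. f x * cis (- (l * x))) - of_real T * m) \<le> e / 2 * T"
      using assms[of "e / 2"] e by auto
    show "\<forall>\<^sub>F t in at_top. dist ((1 / of_real t) * integral {0..t} (\<lambda>x. f x * cis (- (l * x)))) m < e"
      using eventually_ge_at_top[of T0]
    proof eventually_elim
      case (elim T)
      then have T: "T > 0" using T0(1) by simp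
      have "dist ((1 / of_real T) * integral {0..T} (\<lambda>x. f x * cis (- (l * x)))) m
          = norm (integral {0..T} (\<lambda>x. f x * cis (- (l * x))) - of_real T * m) / T"
        using norm_divide_minus[OF T, of "integral {0..T} (\<lambda>x. f x * cis (- (l * x)))" m] by (simp add: dist_norm)
      also have "\<dots> \<le> e / 2" using T0(2)[OF elim] T by (simp add: field_simps)
      finally show ?case using e by simp
    qed
  qed
  then show ?thesis
    unfolding bohr_coeff_def cis_conv_exp by (intro tendsto_Lim) (auto simp: mult_ac)
qed

lemma bohr_coeff_uniform:
  fixes f :: "real \<Rightarrow> complex"
  assumes f: "almost_periodic f" and e: "e > 0"
  obtains T0 where "T0 > 0" "\<And>T a. T \<ge> T0 \<Longrightarrow>
    norm (integral {a..a + T} (\<lambda>x. f x * cis (- (l * x))) - of_real T * bohr_coeff f l) \<le> e * T"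
proof -
  have "almost_periodic (\<lambda>x. f x * cis (- (l * x)))"
    using almost_periodic_mult_cis[OF f, of "- l"] by simp
  then obtain m where m: "\<And>e. e > 0 \<Longrightarrow> \<exists>T0>0. \<forall>T\<ge>T0. \<forall>a.
      norm (integral {a..a + T} (\<lambda>x. f x * cis (- (l * x))) - of_real T * m) \<le> e * T"
    by (rule almost_periodic_mean_exists) blast
  have "bohr_coeff f l = m"
  proof (rule bohr_coeff_eqI)
    fix e :: real assume "e > 0"
    from m[OF this] obtain T0 where "T0 > 0" "\<And>T a. T \<ge> T0 \<Longrightarrow>
      norm (integral {a..a + T} (\<lambda>x. f x * cis (- (l * x))) - of_real T * m) \<le> e * T"
      by blast
    from this(1) this(2)[where a=0] show "\<exists>T0>0. \<forall>T\<ge>T0.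
      norm (integral {0..T} (\<lambda>x. f x * cis (- (l * x))) - of_real T * m) \<le> e * T"
      by auto
  qed
  with m[OF e] that show thesis by blast
qed

text \<open>The integral of the translate by \<open>s\<close> against the character is
  \<open>cis (l * s)\<close> times a window integral of \<open>f\<close> starting at
  \<open>s\<close>, which the uniform mean evaluates irrespective of \<open>s\<close>. Where the
  characters converge along the shifts, a limit of translates thus has the coefficients of
  \<open>f\<close> up to factors of modulus one.\<close>

lemma bohr_coeff_translate_limit:
  fixes f g :: "real \<Rightarrow> complex" and t :: "nat \<Rightarrow> real"
  assumes f: "almost_periodic f"
    and lim: "uniform_limit UNIV (\<lambda>n x. f (x + t n)) g sequentially"
    and z: "(\<lambda>n. cis (l * t n)) \<longlonglongrightarrow> z"
  shows "bohr_coeff g l = z * bohr_coeff f l"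
proof (rule bohr_coeff_eqI)
  fix e :: real assume e: "e > 0"
  define m where "m = bohr_coeff f l"
  have "(\<lambda>n. cis (l * t n) * m) \<longlonglongrightarrow> z * m"
    by (intro tendsto_intros z)
  then obtain N1 where N1: "\<And>n. n \<ge> N1 \<Longrightarrow> norm (cis (l * t n) * m - z * m) < e / 3"
    using e by (metis LIMSEQ_iff divide_pos_pos zero_less_numeral)
  obtain N2 where N2: "\<And>n x. n \<ge> N2 \<Longrightarrow> norm (f (x + t n) - g x) < e / 3"
    using lim e unfolding uniform_limit_sequentially_iff dist_norm
    by (metis UNIV_I divide_pos_pos zero_less_numeral)
  define s where "s = t (max N1 N2)"
  have s1: "norm (cis (l * s) * m - z * m) < e / 3" and s2: "\<And>x. norm (f (x + s) - g x) < e / 3"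
    using N1[of "max N1 N2"] N2[of "max N1 N2"] by (auto simp: s_def)
  obtain T0 where T0: "T0 > 0" "\<And>T a. T \<ge> T0 \<Longrightarrow>
    norm (integral {a..a + T} (\<lambda>x. f x * cis (- (l * x))) - of_real T * m) \<le> e / 3 * T"
    using bohr_coeff_uniform[OF f, of "e / 3" l] e unfolding m_def by auto
  have cf: "continuous_on S f" for S
    using almost_periodic_continuous[OF f] continuous_on_subset by blast
  have cg: "continuous_on S g" for S
    using almost_periodic_continuous[OF almost_periodic_uniform_limit[OF f lim]] continuous_on_subset by blast
  have "norm (integral {0..T} (\<lambda>x. g x * cis (- (l * x))) - of_real T * (z * m)) \<le> e * T"
    if T: "T \<ge> T0" for T
  proof -
    have T': "T > 0" using T T0(1) by simp
    have cfs: "continuous_on {0..T} (\<lambda>x. f (x + s))"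
      by (rule continuous_on_compose2[OF cf]) (auto intro: continuous_intros)
    define h where "h = (\<lambda>x. f x * cis (- (l * x)))"
    have "integral {s..s + T} h = integral {0..T} (\<lambda>x. cis (- (l * s)) * (f (x + s) * cis (- (l * x))))"
      unfolding integral_translate h_def
    proof (intro integral_cong)
      fix x
      have "cis (- (l * (x + s))) = cis (- (l * s)) * cis (- (l * x))"
        by (simp add: cis_mult algebra_simps)
      then show "f (x + s) * cis (- (l * (x + s))) = cis (- (l * s)) * (f (x + s) * cis (- (l * x)))"
        by simp
    qed
    also have "\<dots> = cis (- (l * s)) * integral {0..T} (\<lambda>x. f (x + s) * cis (- (l * x)))"
      by simp
    finally have eq: "integral {s..s + T} h = cis (- (l * s)) * integral {0..T} (\<lambda>x. f (x + s) * cis (- (l * x)))" .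
    have "cis (l * s) * cis (- (l * s)) = 1" by (simp add: cis_mult)
    then have sh: "integral {0..T} (\<lambda>x. f (x + s) * cis (- (l * x))) = cis (l * s) * integral {s..s + T} h"
      unfolding eq mult.assoc[symmetric] by simp
    have "norm (integral {0..T} (\<lambda>x. g x * cis (- (l * x))) - integral {0..T} (\<lambda>x. f (x + s) * cis (- (l * x))))
        = norm (integral {0..T} (\<lambda>x. (g x - f (x + s)) * cis (- (l * x))))"
      unfolding left_diff_distrib
      by (intro arg_cong[where f=norm] integral_diff[symmetric] integrable_continuous_real continuous_intros cg cfs)
    also have "\<dots> \<le> e / 3 * (T - 0)"
    proof (intro integral_bound continuous_intros cg cfs)
      fix x
      show "norm ((g x - f (x + s)) * cis (- (l * x))) \<le> e / 3"
        using s2[of x] by (simp add: norm_mult norm_minus_commute)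
    qed (use T' in simp)
    finally have 1: "norm (integral {0..T} (\<lambda>x. g x * cis (- (l * x))) - cis (l * s) * integral {s..s + T} h) \<le> e / 3 * T"
      unfolding sh by simp
    have 2: "norm (cis (l * s) * (integral {s..s + T} h - of_real T * m)) \<le> e / 3 * T"
      using T0(2)[OF T, of s] by (simp add: norm_mult h_def)
    have 3: "norm (of_real T * (cis (l * s) * m - z * m)) \<le> e / 3 * T"
      using s1 T' by (simp add: norm_mult)
    have "norm ((integral {0..T} (\<lambda>x. g x * cis (- (l * x))) - cis (l * s) * integral {s..s + T} h)
      + (cis (l * s) * (integral {s..s + T} h - of_real T * m) + of_real T * (cis (l * s) * m - z * m)))
      \<le> e / 3 * T + (e / 3 * T + e / 3 * T)"
      by (intro norm_triangle_mono 1 2 3)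
    then show ?thesis by (simp add: algebra_simps)
  qed
  then show "\<exists>T0>0. \<forall>T\<ge>T0.
      norm (integral {0..T} (\<lambda>x. g x * cis (- (l * x))) - of_real T * (z * bohr_coeff f l)) \<le> e * T"
    using T0(1) m_def by blast
qed

lemma bohr_coeff_diff:
  fixes f g :: "real \<Rightarrow> complex"
  assumes f: "almost_periodic f" and g: "almost_periodic g"
  shows "bohr_coeff (\<lambda>x. f x - g x) l = bohr_coeff f l - bohr_coeff g l"
proof (rule bohr_coeff_eqI)
  have cf: "continuous_on S f" and cg: "continuous_on S g" for S
    using f g by (auto intro: continuous_on_subset dest: almost_periodic_continuous)
  fix e :: real assume e: "e > 0"
  obtain T1 where T1: "T1 > 0" "\<And>T a. T \<ge> T1 \<Longrightarrow>
    norm (integral {a..a + T} (\<lambda>x. f x * cis (- (l * x))) - of_real T * bohr_coeff f l) \<le> e / 2 * T"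
    using bohr_coeff_uniform[OF f, of "e / 2" l] e by auto
  obtain T2 where T2: "T2 > 0" "\<And>T a. T \<ge> T2 \<Longrightarrow>
    norm (integral {a..a + T} (\<lambda>x. g x * cis (- (l * x))) - of_real T * bohr_coeff g l) \<le> e / 2 * T"
    using bohr_coeff_uniform[OF g, of "e / 2" l] e by auto
  have "norm (integral {0..T} (\<lambda>x. (f x - g x) * cis (- (l * x)))
      - of_real T * (bohr_coeff f l - bohr_coeff g l)) \<le> e * T" if T: "T \<ge> max T1 T2" for T
  proof -
    have eq: "integral {0..T} (\<lambda>x. (f x - g x) * cis (- (l * x)))
        = integral {0..T} (\<lambda>x. f x * cis (- (l * x))) - integral {0..T} (\<lambda>x. g x * cis (- (l * x)))"
      unfolding left_diff_distrib
      by (intro integral_diff integrable_continuous_real continuous_intros cf cg)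
    have "norm (integral {0..T} (\<lambda>x. f x * cis (- (l * x))) - of_real T * bohr_coeff f l
        - (integral {0..T} (\<lambda>x. g x * cis (- (l * x))) - of_real T * bohr_coeff g l)) \<le> e / 2 * T + e / 2 * T"
      using T1(2)[of T 0] T2(2)[of T 0] T by (intro order.trans[OF norm_triangle_ineq4 add_mono]) auto
    then show ?thesis unfolding eq by (simp add: algebra_simps)
  qed
  then show "\<exists>T0>0. \<forall>T\<ge>T0. norm (integral {0..T} (\<lambda>x. (f x - g x) * cis (- (l * x)))
      - of_real T * (bohr_coeff f l - bohr_coeff g l)) \<le> e * T"
    using T1(1) by (intro exI[of _ "max T1 T2"]) auto
qed

lemma cis_mean_tendsto:
  "((\<lambda>T. integral {0..T} (\<lambda>x. cis (c * x)) / of_real T) \<longlongrightarrow> (if c = 0 then 1 else 0)) at_top"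
proof (cases "c = 0")
  case True
  have "\<forall>\<^sub>F T in at_top. integral {0..T} (\<lambda>x. cis (c * x)) / of_real T = 1"
    using eventually_gt_at_top[of 0] by eventually_elim (simp add: True scaleR_conv_of_real)
  then show ?thesis using True by (simp add: tendsto_eventually)
next
  case False
  have bd: "norm (integral {0..T} (\<lambda>x. cis (c * x)) / of_real T) \<le> 2 / \<bar>c\<bar> * inverse T" if "T > 0" for T
  proof -
    have "((\<lambda>x. cis (c * x)) has_integral (cis (c * T) / (\<i> * of_real c) - cis (c * 0) / (\<i> * of_real c))) {0..T}"
    proof (intro fundamental_theorem_of_calculus)
      fix x assume "x \<in> {0..T}"
      have "((\<lambda>z. exp (\<i> * of_real c * z)) has_field_derivative (\<i> * of_real c * exp (\<i> * of_real c * of_real x))) (at (of_real x))"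
        by (auto intro!: derivative_eq_intros)
      from has_vector_derivative_real_field[OF this]
      have "((\<lambda>x. cis (c * x)) has_vector_derivative (\<i> * of_real c * cis (c * x))) (at x within {0..T})"
        by (simp add: cis_conv_exp mult.assoc)
      then have "((\<lambda>x. cis (c * x) / (\<i> * of_real c)) has_vector_derivative (\<i> * of_real c * cis (c * x) / (\<i> * of_real c))) (at x within {0..T})"
        by (rule has_vector_derivative_divide)
      then show "((\<lambda>x. cis (c * x) / (\<i> * of_real c)) has_vector_derivative cis (c * x)) (at x within {0..T})"
        using False by simp
    qed (use that in simp)
    then have "integral {0..T} (\<lambda>x. cis (c * x)) = (cis (c * T) - 1) / (\<i> * of_real c)"
      by (simp add: integral_unique diff_divide_distrib)
    moreover have "norm (cis (c * T) - 1) \<le> 2"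
      using norm_triangle_ineq4[of "cis (c * T)" 1] by simp
    ultimately have "norm (integral {0..T} (\<lambda>x. cis (c * x))) \<le> 2 / \<bar>c\<bar>"
      by (simp add: norm_divide norm_mult divide_right_mono)
    then have "norm (integral {0..T} (\<lambda>x. cis (c * x))) / T \<le> 2 / \<bar>c\<bar> / T"
      using that by (intro divide_right_mono) auto
    then show ?thesis
      using that by (simp add: norm_divide field_simps)
  qed
  have "\<forall>\<^sub>F T in at_top. norm (integral {0..T} (\<lambda>x. cis (c * x)) / of_real T) \<le> 2 / \<bar>c\<bar> * inverse T"
    using eventually_gt_at_top[of 0] by eventually_elim (rule bd)
  moreover have "((\<lambda>T. 2 / \<bar>c\<bar> * inverse T) \<longlongrightarrow> 0) at_top"
    by (intro tendsto_mult_right_zero tendsto_inverse_0_at_top filterlim_ident)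
  ultimately have "((\<lambda>T. integral {0..T} (\<lambda>x. cis (c * x)) / of_real T) \<longlongrightarrow> 0) at_top"
    by (rule Lim_null_comparison)
  then show ?thesis using False by simp
qed

lemma bohr_coeff_tendsto:
  fixes f :: "real \<Rightarrow> complex"
  assumes f: "almost_periodic f"
  shows "((\<lambda>T. integral {0..T} (\<lambda>x. f x * cis (- (l * x))) / of_real T) \<longlongrightarrow> bohr_coeff f l) at_top"
proof (rule tendstoI)
  fix e :: real assume e: "e > 0"
  obtain T0 where T0: "T0 > 0" "\<And>T a. T \<ge> T0 \<Longrightarrow>
    norm (integral {a..a + T} (\<lambda>x. f x * cis (- (l * x))) - of_real T * bohr_coeff f l) \<le> e / 2 * T"
    using bohr_coeff_uniform[OF f, of "e / 2" l] e by auto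
  show "\<forall>\<^sub>F T in at_top. dist (integral {0..T} (\<lambda>x. f x * cis (- (l * x))) / of_real T) (bohr_coeff f l) < e"
    using eventually_ge_at_top[of T0]
  proof eventually_elim
    case (elim T)
    then have T: "T > 0" using T0(1) by simp
    have "norm (integral {0..T} (\<lambda>x. f x * cis (- (l * x))) - of_real T * bohr_coeff f l) / T \<le> e / 2"
      using T0(2)[OF elim, of 0] T by (simp add: field_simps)
    with e show ?case unfolding dist_norm norm_divide_minus[OF T] by linarith
  qed
qed

lemma Re_mult_cnj_le: "Re (2 * a * cnj b - b * cnj b) \<le> (norm a)\<^sup>2"
proof -
  have "0 \<le> (Re a - Re b)\<^sup>2 + (Im a - Im b)\<^sup>2" by simp
  then show ?thesis
    unfolding cmod_power2 by (simp add: power2_eq_square algebra_simps)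
qed

text \<open>Bessel's inequality. For the trigonometric sum \<open>g\<close> with the coefficients of
  \<open>f\<close> at the frequencies in \<open>S\<close>, the real part of
  \<open>2 * f * cnj g - g * cnj g\<close> is at most \<open>|f|\<^sup>2\<close>, hence at most
  \<open>B\<^sup>2\<close>; its mean is the sum of the squared moduli of these coefficients. So at
  most \<open>B\<^sup>2 / e\<^sup>2\<close> coefficients can have modulus \<open>e\<close> or
  more.\<close>

lemma finite_large_bohr_coeff:
  fixes f :: "real \<Rightarrow> complex"
  assumes f: "almost_periodic f" and e: "e > 0"
  shows "finite {l. e \<le> norm (bohr_coeff f l)}"
proof (rule ccontr)
  assume inf: "infinite {l. e \<le> norm (bohr_coeff f l)}"
  obtain B where B: "B > 0" "\<And>x. norm (f x) \<le> B"
    using almost_periodic_bounded[OF f] by blast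
  have cont: "continuous_on S f" for S
    using almost_periodic_continuous[OF f] continuous_on_subset by blast
  have bound: "real (card S) * e\<^sup>2 \<le> B\<^sup>2"
    if S: "finite S" "S \<subseteq> {l. e \<le> norm (bohr_coeff f l)}" for S
  proof -
    define c where "c l = bohr_coeff f l" for l
    define h where "h x = (\<Sum>l\<in>S. 2 * cnj (c l) * (f x * cis (- (l * x))))
      - (\<Sum>l\<in>S. \<Sum>k\<in>S. c k * cnj (c l) * cis ((k - l) * x))" for x
    have h_le: "Re (h x) \<le> B\<^sup>2" for x
    proof -
      define g where "g = (\<Sum>l\<in>S. c l * cis (l * x))"
      have "cnj g = (\<Sum>l\<in>S. cnj (c l) * cis (- (l * x)))"
        by (simp add: g_def cis_cnj)
      then have "2 * f x * cnj g = (\<Sum>l\<in>S. 2 * cnj (c l) * (f x * cis (- (l * x))))"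
        by (simp add: sum_distrib_left mult_ac)
      moreover have "g * cnj g = (\<Sum>l\<in>S. \<Sum>k\<in>S. c k * cnj (c l) * cis ((k - l) * x))"
      proof -
        have "cis ((k - l) * x) = cis (k * x) * cis (- (l * x))" for k l
          by (simp add: cis_mult algebra_simps)
        then show ?thesis
          unfolding \<open>cnj g = _\<close> unfolding g_def sum_product
          by (subst sum.swap) (simp add: mult_ac)
      qed
      ultimately have "h x = 2 * f x * cnj g - g * cnj g"
        by (simp add: h_def)
      then have "Re (h x) \<le> (norm (f x))\<^sup>2"
        using Re_mult_cnj_le[of "f x" g] by simp
      also have "\<dots> \<le> B\<^sup>2" using B by (intro power_mono) auto
      finally show ?thesis .
    qed
    have ch: "continuous_on X h" for X
      unfolding h_def by (intro continuous_intros cont)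
    have int_h: "integral {0..T} h = (\<Sum>l\<in>S. 2 * cnj (c l) * integral {0..T} (\<lambda>x. f x * cis (- (l * x))))
      - (\<Sum>l\<in>S. \<Sum>k\<in>S. c k * cnj (c l) * integral {0..T} (\<lambda>x. cis ((k - l) * x)))" for T
    proof -
      have "integral {0..T} h = integral {0..T} (\<lambda>x. \<Sum>l\<in>S. 2 * cnj (c l) * (f x * cis (- (l * x))))
        - integral {0..T} (\<lambda>x. \<Sum>l\<in>S. \<Sum>k\<in>S. c k * cnj (c l) * cis ((k - l) * x))"
        unfolding h_def by (intro integral_diff integrable_continuous_real continuous_intros cont)
      also have "integral {0..T} (\<lambda>x. \<Sum>l\<in>S. 2 * cnj (c l) * (f x * cis (- (l * x))))
          = (\<Sum>l\<in>S. integral {0..T} (\<lambda>x. 2 * cnj (c l) * (f x * cis (- (l * x)))))"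
        by (intro integral_sum S(1) integrable_continuous_real continuous_intros cont)
      also have "integral {0..T} (\<lambda>x. \<Sum>l\<in>S. \<Sum>k\<in>S. c k * cnj (c l) * cis ((k - l) * x))
          = (\<Sum>l\<in>S. integral {0..T} (\<lambda>x. \<Sum>k\<in>S. c k * cnj (c l) * cis ((k - l) * x)))"
        by (intro integral_sum S(1) integrable_continuous_real continuous_intros)
      also have "\<dots> = (\<Sum>l\<in>S. \<Sum>k\<in>S. integral {0..T} (\<lambda>x. c k * cnj (c l) * cis ((k - l) * x)))"
        by (intro sum.cong refl integral_sum S(1) integrable_continuous_real continuous_intros)
      finally show ?thesis by simp
    qed
    have "((\<lambda>T. integral {0..T} h / of_real T) \<longlongrightarrow>
        (\<Sum>l\<in>S. 2 * cnj (c l) * c l) - (\<Sum>l\<in>S. \<Sum>k\<in>S. c k * cnj (c l) * (if k - l = 0 then 1 else 0))) at_top"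
      unfolding int_h diff_divide_distrib sum_divide_distrib times_divide_eq_right[symmetric] c_def
      by (intro tendsto_intros bohr_coeff_tendsto[OF f] cis_mean_tendsto)
    moreover have "(\<Sum>l\<in>S. \<Sum>k\<in>S. c k * cnj (c l) * (if k - l = 0 then 1 else 0)) = (\<Sum>l\<in>S. c l * cnj (c l))"
      using S(1) by (intro sum.cong refl) (simp add: if_distrib sum.delta cong: if_cong)
    moreover have "(\<Sum>l\<in>S. 2 * cnj (c l) * c l) - (\<Sum>l\<in>S. c l * cnj (c l)) = (\<Sum>l\<in>S. c l * cnj (c l))"
      by (simp add: sum_subtractf[symmetric] algebra_simps)
    ultimately have "((\<lambda>T. integral {0..T} h / of_real T) \<longlongrightarrow> (\<Sum>l\<in>S. c l * cnj (c l))) at_top"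
      by simp
    then have lim: "((\<lambda>T. Re (integral {0..T} h / of_real T)) \<longlongrightarrow> Re (\<Sum>l\<in>S. c l * cnj (c l))) at_top"
      by (rule tendsto_Re)
    have "\<forall>\<^sub>F T in at_top. Re (integral {0..T} h / of_real T) \<le> B\<^sup>2"
      using eventually_gt_at_top[of 0]
    proof eventually_elim
      case (elim T)
      have "((\<lambda>x. Re (h x)) has_integral Re (integral {0..T} h)) {0..T}"
        using has_integral_linear[OF integrable_integral[OF integrable_continuous_real[OF ch]] bounded_linear_Re]
        by (simp add: o_def)
      then have "Re (integral {0..T} h) \<le> B\<^sup>2 * T"
        using has_integral_le[OF _ has_integral_const_real[of "B\<^sup>2" 0 T]] h_le elim by (auto simp: mult.commute)
      then show ?case using elim by (simp add: field_simps)
    qed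
    then have "Re (\<Sum>l\<in>S. c l * cnj (c l)) \<le> B\<^sup>2"
      by (intro tendsto_upperbound[OF lim]) auto
    moreover have "Re (\<Sum>l\<in>S. c l * cnj (c l)) = (\<Sum>l\<in>S. (norm (c l))\<^sup>2)"
      by (simp add: cmod_power2 flip: power2_eq_square)
    moreover have "real (card S) * e\<^sup>2 \<le> (\<Sum>l\<in>S. (norm (c l))\<^sup>2)"
      using S(2) e by (intro sum_bounded_below) (auto simp: c_def intro!: power_mono)
    ultimately show ?thesis by simp
  qed
  obtain n :: nat where n: "real n > B\<^sup>2 / e\<^sup>2"
    using reals_Archimedean2 by blast
  obtain S where "finite S" "card S = n" "S \<subseteq> {l. e \<le> norm (bohr_coeff f l)}"
    using infinite_arbitrarily_large[OF inf] by blast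
  with bound[of S] n e show False by (simp add: field_simps)
qed

subsection \<open>The uniqueness theorem\<close>

lemma norm_cis_minus_1_le: "norm (cis x - 1) \<le> \<bar>x\<bar>"
proof -
  have s: "cos x = 1 - 2 * (sin (x / 2))\<^sup>2"
    using cos_double_sin[of "x / 2"] by simp
  have "(norm (cis x - 1))\<^sup>2 = 2 - 2 * cos x"
    using sin_cos_squared_add[of x] by (simp add: cmod_power2 power2_diff)
  also have "\<dots> = (2 * sin (x / 2))\<^sup>2"
    by (simp add: s power_mult_distrib)
  also have "\<dots> \<le> \<bar>x\<bar>\<^sup>2"
    using abs_sin_x_le_abs_x[of "x / 2"] by (intro abs_le_square_iff[THEN iffD1]) (simp add: abs_mult)
  finally show ?thesis by (rule power2_le_imp_le) simp
qed

lemma integral_periodic_blocks: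
  fixes g :: "real \<Rightarrow> 'a::banach"
  assumes g: "continuous_on UNIV g" and h: "h \<ge> 0"
  shows "integral {0..real n * h} g = (\<Sum>k<n. integral {real k * h..real k * h + h} g)"
proof (induction n)
  case (Suc n)
  have "integral {0..real n * h} g + integral {real n * h..real n * h + h} g = integral {0..real n * h + h} g"
    using h g by (intro Henstock_Kurzweil_Integration.integral_combine integrable_continuous_real)
      (auto intro: continuous_on_subset)
  with Suc.IH show ?case by (simp add: algebra_simps)
qed simp

text \<open>Over a block of fixed length \<open>t\<close>, replacing the frequency \<open>l\<close>
  by a nearby \<open>l'\<close> changes the integrand only by a constant factor of modulus one and
  an error of order \<open>|l' - l| * t\<close>, so smallness on blocks persists near
  \<open>l\<close>. Covering \<open>{-L..L}\<close> by finitely many such neighbourhoods makes the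
  threshold uniform. The blocks lie anywhere on the line, which is why the mean has to be uniform in
  the starting point.\<close>

lemma bohr_mean_uniform_frequency:
  fixes f :: "real \<Rightarrow> complex"
  assumes f: "almost_periodic f" and zero: "\<And>l. bohr_coeff f l = 0" and e: "e > 0"
  obtains T0 where "T0 > 0" "\<And>T l. T \<ge> T0 \<Longrightarrow> \<bar>l\<bar> \<le> L \<Longrightarrow>
    norm (integral {0..T} (\<lambda>x. f x * cis (- (l * x)))) \<le> e * T"
proof -
  obtain B where B: "B > 0" "\<And>x. norm (f x) \<le> B"
    using almost_periodic_bounded[OF f] by blast
  have cont: "continuous_on S f" for S
    using almost_periodic_continuous[OF f] continuous_on_subset by blast
  have local: "\<exists>r>0. \<exists>T0>0. \<forall>T\<ge>T0. \<forall>l'. \<bar>l' - l\<bar> < r \<longrightarrow>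
      norm (integral {0..T} (\<lambda>x. f x * cis (- (l' * x)))) \<le> e * T" for l
  proof -
    obtain t where t: "t > 0" "\<And>T a. T \<ge> t \<Longrightarrow>
      norm (integral {a..a + T} (\<lambda>x. f x * cis (- (l * x))) - of_real T * bohr_coeff f l) \<le> e / 4 * T"
      using bohr_coeff_uniform[OF f, of "e / 4" l] e by auto
    \<comment> \<open>Makes the error of a block relative to its length, \<open>B * r * t\<close>,
      equal to \<open>e / 4\<close>.\<close>
    define r where "r = e / (4 * B * t)"
    have r: "r > 0" using e B(1) t(1) by (simp add: r_def)
    have "norm (integral {0..T} (\<lambda>x. f x * cis (- (l' * x)))) \<le> e * T"
      if l': "\<bar>l' - l\<bar> < r" and T: "T \<ge> 2 * B * t / e" for T l'
    proof -
      define g where "g = (\<lambda>x. f x * cis (- (l' * x)))"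
      have cg: "continuous_on X g" for X
        unfolding g_def by (intro continuous_intros cont)
      have block: "norm (integral {a..a + t} g) \<le> e / 2 * t" for a
      proof -
        define u where "u x = f x * cis (- (l * x))" for x
        have cu: "continuous_on X u" for X
          unfolding u_def by (intro continuous_intros cont)
        define d where "d = l' - l"
        \<comment> \<open>The phase accumulated up to \<open>a\<close> is split off as a constant,
          so that only the drift inside the block enters the error.\<close>
        have gu: "g x = cis (- (d * a)) * u x + cis (- (d * a)) * u x * (cis (- (d * (x - a))) - 1)" for x
        proof -
          have "cis (- (l' * x)) = cis (- (d * a)) * cis (- (l * x)) * cis (- (d * (x - a)))"
            by (simp add: cis_mult d_def algebra_simps)
          then show ?thesis by (simp add: g_def u_def algebra_simps)
        qed
        have "integral {a..a + t} g = integral {a..a + t} (\<lambda>x. cis (- (d * a)) * u x)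
            + integral {a..a + t} (\<lambda>x. cis (- (d * a)) * u x * (cis (- (d * (x - a))) - 1))"
          by (subst integral_add[symmetric])
            (intro integrable_continuous_real continuous_intros cu integral_cong gu)+
        also have "norm \<dots> \<le> e / 4 * t + B * (\<bar>d\<bar> * t) * (a + t - a)"
        proof (intro norm_triangle_mono integral_bound continuous_intros cu)
          show "norm (integral {a..a + t} (\<lambda>x. cis (- (d * a)) * u x)) \<le> e / 4 * t"
            using t(2)[of t a] by (simp add: norm_mult zero u_def)
          fix x assume x: "x \<in> {a..a + t}"
          have "norm (cis (- (d * (x - a))) - 1) \<le> \<bar>d\<bar> * t"
            using norm_cis_minus_1_le[of "- (d * (x - a))"] x mult_left_mono[of "x - a" t "\<bar>d\<bar>"]
            by (simp add: abs_mult)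
          moreover have "norm (cis (- (d * a)) * u x) \<le> B"
            using B(2)[of x] by (simp add: u_def norm_mult)
          ultimately show "norm (cis (- (d * a)) * u x * (cis (- (d * (x - a))) - 1)) \<le> B * (\<bar>d\<bar> * t)"
            unfolding norm_mult using B(1) by (intro mult_mono) (auto simp: norm_mult)
        qed (use t(1) in auto)
        also have "B * (\<bar>d\<bar> * t) * (a + t - a) \<le> e / 4 * t"
        proof -
          have "\<bar>d\<bar> \<le> r" using l' by (simp add: d_def)
          then have "B * (\<bar>d\<bar> * t) \<le> B * (r * t)" using B(1) t(1) by (intro mult_left_mono mult_right_mono) auto
          also have "B * (r * t) = e / 4" using B(1) t(1) by (simp add: r_def)
          finally show ?thesis using t(1) by (simp add: mult_right_mono)
        qed
        finally show ?thesis by (simp add: field_simps)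
      qed
      have T0: "T \<ge> 0" using T B(1) t(1) e by (smt (verit) divide_nonneg_pos mult_nonneg_nonneg)
      define n where "n = nat \<lfloor>T / t\<rfloor>"
      have "real n \<le> T / t" "T / t < real n + 1"
        using T0 t(1) by (auto simp: n_def)
      then have n: "real n * t \<le> T" "T \<le> real n * t + t"
        using t(1) by (auto simp: field_simps)
      have eq: "integral {0..T} g = integral {0..real n * t} g + integral {real n * t..T} g"
        using n(1) t(1)
        by (intro Henstock_Kurzweil_Integration.integral_combine[symmetric] integrable_continuous_real cg) auto
      have blocks: "integral {0..real n * t} g = (\<Sum>k<n. integral {real k * t..real k * t + t} g)"
        by (rule integral_periodic_blocks[OF cg]) (rule less_imp_le[OF t(1)])
      have "norm (\<Sum>k<n. integral {real k * t..real k * t + t} g) \<le> (\<Sum>k<n. e / 2 * t)"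
        by (rule sum_norm_le) (rule block)
      moreover have "(\<Sum>k<n. e / 2 * t) = e / 2 * (real n * t)" by simp
      moreover have "e / 2 * (real n * t) \<le> e / 2 * T"
        by (rule mult_left_mono[OF n(1)]) (use e in simp)
      ultimately have 1: "norm (integral {0..real n * t} g) \<le> e / 2 * T"
        unfolding blocks by linarith
      have "norm (integral {real n * t..T} g) \<le> B * (T - real n * t)"
      proof (rule integral_bound[OF n(1) cg])
        show "norm (g x) \<le> B" for x
          using B(2)[of x] by (simp add: g_def norm_mult)
      qed
      also have "\<dots> \<le> B * t" using n(2) B(1) by (intro mult_left_mono) auto
      also have "B * t \<le> e / 2 * T" using T e by (simp add: field_simps)
      finally have 2: "norm (integral {real n * t..T} g) \<le> e / 2 * T" .
      have "norm (integral {0..T} g) \<le> e / 2 * T + e / 2 * T"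
        unfolding eq by (rule norm_triangle_mono[OF 1 2])
      also have "\<dots> = e * T" by simp
      finally show ?thesis unfolding g_def .
    qed
    moreover have "2 * B * t / e > 0" using e B(1) t(1) by simp
    ultimately show ?thesis using r by blast
  qed
  define Q where "Q l r T0 \<longleftrightarrow> r > 0 \<and> T0 > 0 \<and> (\<forall>T\<ge>T0. \<forall>l'. \<bar>l' - l\<bar> < r \<longrightarrow>
      norm (integral {0..T} (\<lambda>x. f x * cis (- (l' * x)))) \<le> e * T)" for l r T0
  have "\<forall>l. \<exists>r T0. Q l r T0"
    using local unfolding Q_def by blast
  then obtain r \<tau> where Q: "\<And>l. Q l (r l) (\<tau> l)"
    by metis
  then have r: "\<And>l. r l > 0" and \<tau>: "\<And>l. \<tau> l > 0"
    and est: "\<And>l T l'. T \<ge> \<tau> l \<Longrightarrow> \<bar>l' - l\<bar> < r l \<Longrightarrow>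
      norm (integral {0..T} (\<lambda>x. f x * cis (- (l' * x)))) \<le> e * T"
    unfolding Q_def by blast+
  have "compact {-L..L}" by simp
  then obtain D where D: "D \<subseteq> {-L..L}" "finite D" "{-L..L} \<subseteq> (\<Union>l\<in>D. ball l (r l))"
    by (rule compactE_image[of _ "{-L..L}" "\<lambda>l. ball l (r l)"]) (use r in auto)
  define T0 where "T0 = Max (insert 1 (\<tau> ` D))"
  have "T0 \<ge> 1" "\<And>l. l \<in> D \<Longrightarrow> T0 \<ge> \<tau> l"
    using D(2) by (auto simp: T0_def)
  moreover have "norm (integral {0..T} (\<lambda>x. f x * cis (- (l * x)))) \<le> e * T"
    if "T \<ge> T0" "\<bar>l\<bar> \<le> L" for T l
  proof -
    have "l \<in> {-L..L}" using that(2) by auto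
    then obtain l0 where "l0 \<in> D" "\<bar>l - l0\<bar> < r l0"
      using D(3) by (auto simp: dist_real_def abs_minus_commute)
    then show ?thesis
      using est[of l0 T l] that(1) \<open>\<And>l. l \<in> D \<Longrightarrow> T0 \<ge> \<tau> l\<close>[of l0] by simp
  qed
  ultimately show thesis using that[of T0] by auto
qed

section \<open>Parseval's identity and autocorrelations\<close>

lemma has_integral_cis_int:
  "((\<lambda>t. cis (real_of_int n * t)) has_integral (if n = 0 then 2 * pi else 0)) {-pi..pi}"
proof (cases "n = 0")
  case True
  then show ?thesis
    using has_integral_const_real[of "1::complex" "-pi" pi] by (simp add: scaleR_conv_of_real)
next
  case False
  have "((\<lambda>x. cis (real_of_int n * x)) has_integral
      (cis (real_of_int n * pi) / (\<i> * of_int n) - cis (real_of_int n * - pi) / (\<i> * of_int n))) {-pi..pi}"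
  proof (intro fundamental_theorem_of_calculus)
    fix x :: real
    have "((\<lambda>z. exp (\<i> * of_int n * z)) has_field_derivative (\<i> * of_int n * exp (\<i> * of_int n * of_real x))) (at (of_real x))"
      by (auto intro!: derivative_eq_intros)
    from has_vector_derivative_real_field[OF this]
    have "((\<lambda>x. cis (real_of_int n * x)) has_vector_derivative (\<i> * of_int n * cis (real_of_int n * x))) (at x within {-pi..pi})"
      by (simp add: cis_conv_exp mult.assoc)
    then have "((\<lambda>x. cis (real_of_int n * x) / (\<i> * of_int n)) has_vector_derivative
        (\<i> * of_int n * cis (real_of_int n * x) / (\<i> * of_int n))) (at x within {-pi..pi})"
      by (rule has_vector_derivative_divide)
    then show "((\<lambda>x. cis (real_of_int n * x) / (\<i> * of_int n)) has_vector_derivative cis (real_of_int n * x)) (at x within {-pi..pi})"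
      using False by simp
  qed simp
  moreover have "cis (real_of_int n * pi) = cis (real_of_int n * - pi)"
  proof -
    have "cis (real_of_int n * pi) = cis (real_of_int n * - pi + 2 * pi * of_int n)"
      by (simp add: algebra_simps)
    also have "\<dots> = cis (real_of_int n * - pi)"
      unfolding cis_mult[symmetric] by (simp add: cis_multiple_2pi)
    finally show ?thesis .
  qed
  ultimately show ?thesis using False by simp
qed

lemma parseval_trig:
  fixes c :: "int \<Rightarrow> complex"
  assumes S: "finite S"
  shows "((\<lambda>t. (norm (\<Sum>k\<in>S. c k * cis (real_of_int k * t)))\<^sup>2) has_integral
    2 * pi * (\<Sum>k\<in>S. (norm (c k))\<^sup>2)) {-pi..pi}"
proof -
  define F where "F t = (\<Sum>k\<in>S. \<Sum>j\<in>S. c k * cnj (c j) * cis (real_of_int (k - j) * t))" for t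
  have "(F has_integral (\<Sum>k\<in>S. \<Sum>j\<in>S. c k * cnj (c j) * (if k - j = 0 then 2 * pi else 0))) {-pi..pi}"
    unfolding F_def by (intro has_integral_sum S has_integral_mult_right has_integral_cis_int)
  also have "(\<Sum>k\<in>S. \<Sum>j\<in>S. c k * cnj (c j) * (if k - j = 0 then 2 * pi else 0))
      = of_real (2 * pi * (\<Sum>k\<in>S. (norm (c k))\<^sup>2))"
  proof -
    have "(\<Sum>j\<in>S. c k * cnj (c j) * (if k - j = 0 then 2 * pi else 0)) = of_real (2 * pi * (norm (c k))\<^sup>2)"
      if "k \<in> S" for k
    proof -
      have "(\<Sum>j\<in>S. c k * cnj (c j) * (if k - j = 0 then 2 * pi else 0))
          = (\<Sum>j\<in>S. if k = j then c k * cnj (c j) * (2 * pi) else 0)"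
        by (intro sum.cong) auto
      also have "\<dots> = c k * cnj (c k) * (2 * pi)"
        using S that by (simp add: sum.delta')
      finally show ?thesis by (simp add: complex_norm_square[symmetric] del: of_real_power)
    qed
    then show ?thesis by (simp add: sum_distrib_left)
  qed
  finally have "((Re \<circ> F) has_integral Re (of_real (2 * pi * (\<Sum>k\<in>S. (norm (c k))\<^sup>2)))) {-pi..pi}"
    by (intro has_integral_linear bounded_linear_Re)
  moreover have "Re (F t) = (norm (\<Sum>k\<in>S. c k * cis (real_of_int k * t)))\<^sup>2" for t
  proof -
    have "cis (real_of_int (k - j) * t) = cis (real_of_int k * t) * cnj (cis (real_of_int j * t))" for k j
      by (simp add: cis_cnj cis_mult algebra_simps)
    then have "F t = (\<Sum>k\<in>S. c k * cis (real_of_int k * t)) * cnj (\<Sum>k\<in>S. c k * cis (real_of_int k * t))"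
      unfolding F_def cnj_sum sum_product by (simp add: mult_ac)
    then have "F t = of_real ((norm (\<Sum>k\<in>S. c k * cis (real_of_int k * t)))\<^sup>2)"
      unfolding complex_norm_square .
    then show ?thesis by (simp only: Re_complex_of_real)
  qed
  ultimately show ?thesis by (simp add: o_def)
qed

lemma one_minus_square_half_le_cos: "1 - y\<^sup>2 / 2 \<le> cos (y::real)"
proof -
  have "(sin (y / 2))\<^sup>2 \<le> (y / 2)\<^sup>2"
    using abs_sin_x_le_abs_x[of "y / 2"] by (rule abs_le_square_iff[THEN iffD1])
  then show ?thesis
    using cos_double_sin[of "y / 2"] by (simp add: power_divide)
qed

text \<open>Multiplying by \<open>cis (l * h / 2)\<close> centres the interval: the real part of the
  integrand becomes \<open>cos (l * (h / 2 - s))\<close>, which is bounded below by its quadratic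
  Taylor polynomial. The integral of the latter is \<open>h * (1 - (l * h)\<^sup>2 / 24)\<close>,
  and \<open>pi < 4\<close> makes this at least \<open>h / 3\<close>.\<close>

lemma norm_integral_cis_ge:
  assumes h: "h > 0" and lh: "\<bar>l * h\<bar> \<le> pi"
  shows "h / 3 \<le> norm (integral {0..h} (\<lambda>s. cis (- (l * s))))"
proof -
  define J where "J = integral {0..h} (\<lambda>s. cis (- (l * s)))"
  have "((\<lambda>s. cis (- (l * s))) has_integral J) {0..h}"
    unfolding J_def by (intro integrable_integral integrable_continuous_real continuous_intros)
  then have "((\<lambda>s. cis (l * h / 2) * cis (- (l * s))) has_integral (cis (l * h / 2) * J)) {0..h}"
    by (rule has_integral_mult_right)
  from has_integral_linear[OF this bounded_linear_Re]
  have 1: "((\<lambda>s. cos (l * (h / 2 - s))) has_integral Re (cis (l * h / 2) * J)) {0..h}"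
    by (simp add: o_def cis_mult right_diff_distrib)
  define F where "F s = s + l\<^sup>2 * (h / 2 - s) ^ 3 / 6" for s
  have 2: "((\<lambda>s. 1 - (l * (h / 2 - s))\<^sup>2 / 2) has_integral (F h - F 0)) {0..h}"
  proof (intro fundamental_theorem_of_calculus)
    fix s
    have "(F has_real_derivative (1 - (l * (h / 2 - s))\<^sup>2 / 2)) (at s within {0..h})"
      unfolding F_def by (auto intro!: derivative_eq_intros simp: power2_eq_square field_simps)
    then show "(F has_vector_derivative (1 - (l * (h / 2 - s))\<^sup>2 / 2)) (at s within {0..h})"
      by (simp add: has_real_derivative_iff_has_vector_derivative)
  qed (use h in simp)
  have "F h - F 0 \<le> Re (cis (l * h / 2) * J)"
    by (rule has_integral_le[OF 2 1]) (rule one_minus_square_half_le_cos)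
  moreover have "F h - F 0 = h * (1 - (l * h)\<^sup>2 / 24)"
    by (simp add: F_def power2_eq_square power3_eq_cube field_simps)
  moreover have "h * (1 - (l * h)\<^sup>2 / 24) \<ge> h * (1 / 3)"
  proof (intro mult_left_mono)
    have "\<bar>l * h\<bar> \<le> 4" using lh pi_less_4 by linarith
    then have "(l * h)\<^sup>2 \<le> 4\<^sup>2" by (intro abs_le_square_iff[THEN iffD1]) simp
    then show "1 / 3 \<le> 1 - (l * h)\<^sup>2 / 24" by simp
  qed (use h in simp)
  moreover have "Re (cis (l * h / 2) * J) \<le> norm J"
    using complex_Re_le_cmod[of "cis (l * h / 2) * J"] by (simp add: norm_mult)
  ultimately show ?thesis unfolding J_def by linarith
qed

text \<open>The inner sums on the left are the coefficients of nonnegative index of the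
  trigonometric polynomial \<open>|P|\<^sup>2\<close>. Parseval's identity for it and for
  \<open>P\<close>, together with \<open>|P|\<^sup>4 \<le> G\<^sup>2 * |P|\<^sup>2\<close>, gives
  the bound.\<close>

lemma parseval_autocorrelation_le:
  fixes z :: "nat \<Rightarrow> complex"
  assumes G: "\<And>t. \<bar>t\<bar> \<le> pi \<Longrightarrow> norm (\<Sum>n<N. z n * cis (real n * t)) \<le> G"
  shows "(\<Sum>x<N. (norm (\<Sum>n<N - x. z (n + x) * cnj (z n)))\<^sup>2) \<le> G\<^sup>2 * (\<Sum>n<N. (norm (z n))\<^sup>2)"
proof -
  define A where "A = {..<N} \<times> {..<N}"
  define g where "g p = int (fst p) - int (snd p)" for p :: "nat \<times> nat"
  define X where "X = {- int N..int N}"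
  define C where "C x = (\<Sum>p\<in>{p\<in>A. g p = x}. z (fst p) * cnj (z (snd p)))" for x
  define P where "P t = (\<Sum>n<N. z n * cis (real n * t))" for t
  have fA: "finite A" and fX: "finite X" and gA: "g ` A \<subseteq> X"
    by (auto simp: A_def X_def g_def)
  have I1: "((\<lambda>t. (norm (P t))\<^sup>2) has_integral 2 * pi * (\<Sum>n<N. (norm (z n))\<^sup>2)) {-pi..pi}"
    using parseval_trig[of "int ` {..<N}" "\<lambda>k. z (nat k)"]
    by (simp add: sum.reindex P_def)
  have PC: "(norm (\<Sum>x\<in>X. C x * cis (real_of_int x * t)))\<^sup>2 = ((norm (P t))\<^sup>2)\<^sup>2" for t
  proof -
    have "complex_of_real ((norm (P t))\<^sup>2) = P t * cnj (P t)"
      by (rule complex_norm_square)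
    also have "\<dots> = (\<Sum>p\<in>A. (z (fst p) * cis (real (fst p) * t)) * (cnj (z (snd p)) * cnj (cis (real (snd p) * t))))"
      unfolding P_def cnj_sum sum_product sum.cartesian_product A_def
      by (simp add: case_prod_beta)
    also have "\<dots> = (\<Sum>p\<in>A. z (fst p) * cnj (z (snd p)) * cis (real_of_int (g p) * t))"
    proof (intro sum.cong refl)
      fix p
      have "cis (real_of_int (g p) * t) = cis (real (fst p) * t) * cnj (cis (real (snd p) * t))"
        by (simp add: g_def cis_cnj cis_mult left_diff_distrib)
      then show "(z (fst p) * cis (real (fst p) * t)) * (cnj (z (snd p)) * cnj (cis (real (snd p) * t)))
          = z (fst p) * cnj (z (snd p)) * cis (real_of_int (g p) * t)"
        by simp
    qed
    also have "\<dots> = (\<Sum>x\<in>X. \<Sum>p\<in>{p\<in>A. g p = x}. z (fst p) * cnj (z (snd p)) * cis (real_of_int (g p) * t))"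
      by (rule sum.group[OF fA fX gA, symmetric])
    also have "\<dots> = (\<Sum>x\<in>X. C x * cis (real_of_int x * t))"
      unfolding C_def sum_distrib_right by (intro sum.cong refl) simp
    finally show ?thesis by (metis norm_of_real power2_abs)
  qed
  have I2: "((\<lambda>t. ((norm (P t))\<^sup>2)\<^sup>2) has_integral 2 * pi * (\<Sum>x\<in>X. (norm (C x))\<^sup>2)) {-pi..pi}"
    using parseval_trig[OF fX, of C] unfolding PC .
  have "2 * pi * (\<Sum>x\<in>X. (norm (C x))\<^sup>2) \<le> G\<^sup>2 * (2 * pi * (\<Sum>n<N. (norm (z n))\<^sup>2))"
  proof (rule has_integral_le[OF I2 has_integral_mult_right[OF I1]])
    fix t assume "t \<in> {-pi..pi}"
    then have "norm (P t) \<le> G" using G[of t] by (simp add: P_def abs_le_iff)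
    then have "(norm (P t))\<^sup>2 \<le> G\<^sup>2" by (intro power_mono) auto
    then show "((norm (P t))\<^sup>2)\<^sup>2 \<le> G\<^sup>2 * (norm (P t))\<^sup>2"
      unfolding power2_eq_square[of "(norm (P t))\<^sup>2"] by (intro mult_right_mono) auto
  qed
  then have "(\<Sum>x\<in>X. (norm (C x))\<^sup>2) \<le> G\<^sup>2 * (\<Sum>n<N. (norm (z n))\<^sup>2)"
    using pi_gt_zero by (simp add: mult.left_commute)
  \<comment> \<open>The remaining lags, the negative ones and \<open>N\<close>, contribute
    nonnegative terms, which are dropped.\<close>
  moreover have "(\<Sum>x<N. (norm (C (int x)))\<^sup>2) \<le> (\<Sum>x\<in>X. (norm (C x))\<^sup>2)"
  proof -
    have "(\<Sum>x<N. (norm (C (int x)))\<^sup>2) = (\<Sum>x\<in>int ` {..<N}. (norm (C x))\<^sup>2)"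
      by (simp add: sum.reindex)
    also have "\<dots> \<le> (\<Sum>x\<in>X. (norm (C x))\<^sup>2)"
      using fX by (intro sum_mono2) (auto simp: X_def)
    finally show ?thesis .
  qed
  moreover have "C (int x) = (\<Sum>n<N - x. z (n + x) * cnj (z n))" for x
  proof -
    have "{p\<in>A. g p = int x} = (\<lambda>n. (n + x, n)) ` {..<N - x}"
      by (force simp: A_def g_def)
    moreover have "inj_on (\<lambda>n. (n + x, n)) {..<N - x}"
      by (auto simp: inj_on_def)
    ultimately show ?thesis by (simp add: C_def sum.reindex)
  qed
  ultimately show ?thesis by simp
qed

text \<open>Pigeonhole: one \<open>t\<close> of a finite net serves at least
  \<open>N / card T\<close> of the shifts \<open>n * h\<close> with \<open>n < N\<close>, and the
  difference of two shifts served by the same \<open>t\<close> is an almost period. Subtracting the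
  least such \<open>n\<close> keeps the differences distinct and below \<open>N\<close>. That
  \<open>k\<close> depends neither on \<open>h\<close> nor on \<open>N\<close> is essential: the
  step and the number of samples are fixed only afterwards.\<close>

lemma almost_period_density:
  fixes f :: "real \<Rightarrow> 'a::real_normed_field"
  assumes f: "almost_periodic f" and e: "e > 0"
  obtains k where "k > 0"
    "\<And>h N. k * real N \<le> real (card {m\<in>{..<N}. \<forall>x. dist (f (x + real m * h)) (f x) < e})"
proof -
  obtain T where T: "finite T" "\<And>s. \<exists>t\<in>T. \<forall>x. dist (f (x + s)) (f (x + t)) < e / 2"
    using almost_periodic_finite_net[OF f, of "e / 2"] e by auto
  have "T \<noteq> {}" using T(2) by blast
  define k where "k = 1 / real (card T)"
  have k: "k > 0" using T(1) \<open>T \<noteq> {}\<close> by (simp add: k_def card_gt_0_iff)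
  have "k * real N \<le> real (card {m\<in>{..<N}. \<forall>x. dist (f (x + real m * h)) (f x) < e})" for h N
  proof (cases "N = 0")
    case False
    have "\<forall>n. \<exists>t. t \<in> T \<and> (\<forall>x. dist (f (x + real n * h)) (f (x + t)) < e / 2)"
      using T(2) by blast
    then obtain \<tau> where \<tau>: "\<And>n. \<tau> n \<in> T" "\<And>n x. dist (f (x + real n * h)) (f (x + \<tau> n)) < e / 2"
      by metis
    define A where "A t = {n\<in>{..<N}. \<tau> n = t}" for t
    have "(\<Sum>t\<in>T. real (card (A t))) = real N"
    proof -
      have "(\<Sum>t\<in>T. \<Sum>n\<in>A t. 1::nat) = (\<Sum>n<N. 1)"
        unfolding A_def by (rule sum.group) (use T(1) \<tau>(1) in auto)
      then show ?thesis by (simp flip: of_nat_sum)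
    qed
    moreover have "(\<Sum>t\<in>T. real (card (A t))) < real (card T) * (k * real N)"
      if "\<And>t. t \<in> T \<Longrightarrow> real (card (A t)) < k * real N"
      using sum_bounded_above_strict[of T "\<lambda>t. real (card (A t))" "k * real N"] that \<open>T \<noteq> {}\<close> T(1)
      by (simp add: card_gt_0_iff)
    moreover have "real (card T) * (k * real N) = real N"
      using \<open>T \<noteq> {}\<close> T(1) by (simp add: k_def)
    ultimately have "\<not> (\<forall>t\<in>T. real (card (A t)) < k * real N)"
      by auto
    then obtain t where t: "t \<in> T" "k * real N \<le> real (card (A t))"
      by (auto simp: not_less)
    have fin: "finite (A t)" by (simp add: A_def)
    have "A t \<noteq> {}" using t(2) k False by (auto simp: mult_le_0_iff)
    define n0 where "n0 = Min (A t)"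
    have n0: "n0 \<in> A t" "\<And>n. n \<in> A t \<Longrightarrow> n0 \<le> n"
      using fin \<open>A t \<noteq> {}\<close> by (auto simp: n0_def)
    have "card (A t) \<le> card {m\<in>{..<N}. \<forall>x. dist (f (x + real m * h)) (f x) < e}"
    proof (rule card_inj_on_le)
      show "inj_on (\<lambda>n. n - n0) (A t)"
        using n0(2) by (auto simp: inj_on_def) (metis le_add_diff_inverse2)
      show "(\<lambda>n. n - n0) ` A t \<subseteq> {m\<in>{..<N}. \<forall>x. dist (f (x + real m * h)) (f x) < e}"
      proof
        fix m assume "m \<in> (\<lambda>n. n - n0) ` A t"
        then obtain n where n: "n \<in> A t" "m = n - n0" by blast
        have "dist (f (x + real m * h)) (f x) < e" for x
        proof -
          define y where "y = x - real n0 * h"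
          have "x + real m * h = y + real n * h" "x = y + real n0 * h"
            using n0(2)[OF n(1)] by (simp_all add: n(2) y_def of_nat_diff algebra_simps)
          moreover have "\<tau> n = t" "\<tau> n0 = t" using n(1) n0(1) by (auto simp: A_def)
          ultimately show ?thesis
            using \<tau>(2)[of y n] \<tau>(2)[of y n0] dist_triangle_half_l by metis
        qed
        then show "m \<in> {m\<in>{..<N}. \<forall>x. dist (f (x + real m * h)) (f x) < e}"
          using n by (auto simp: A_def)
      qed
    qed simp
    with t(2) show ?thesis by linarith
  qed simp
  with k that show thesis by blast
qed

text \<open>With all coefficients zero, trigonometric sums with coefficients sampled from \<open>f\<close> are uniformly
  small, and by Parseval so is the quadratic mean of the autocorrelations of the samples. But these
  are bounded below at the almost periods of \<open>f\<close>, which have positive density.\<close>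

lemma almost_periodic_eq_0_at_0:
  fixes f :: "real \<Rightarrow> complex"
  assumes f: "almost_periodic f" and zero: "\<And>l. bohr_coeff f l = 0"
  shows "f 0 = 0"
proof (rule ccontr)
  assume f0: "f 0 \<noteq> 0"
  define v where "v = norm (f 0)"
  have v: "v > 0" using f0 by (simp add: v_def)
  obtain B where B: "B > 0" "\<And>x. norm (f x) \<le> B"
    using almost_periodic_bounded[OF f] by blast
  have cont: "continuous_on S f" for S
    using almost_periodic_continuous[OF f] continuous_on_subset by blast
  obtain k1 where k1: "k1 > 0"
    "\<And>h N. k1 * real N \<le> real (card {m\<in>{..<N}. \<forall>x. dist (f (x + real m * h)) (f x) < v / 2})"
    using almost_period_density[OF f, of "v / 2"] v by auto
  \<comment> \<open>Replacing \<open>z (n + x)\<close> by \<open>z n\<close> in an autocorrelation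
    costs at most \<open>2 * M * d * B\<close>, which is half of the lower bound
    \<open>k1 * M * v\<^sup>2 / 4\<close> for the sum of the squared samples.\<close>
  define d where "d = k1 * v\<^sup>2 / (16 * B)"
  have d: "d > 0" using k1(1) v B(1) by (simp add: d_def)
  obtain k2 where k2: "k2 > 0"
    "\<And>h N. k2 * real N \<le> real (card {m\<in>{..<N}. \<forall>x. dist (f (x + real m * h)) (f x) < d})"
    using almost_period_density[OF f d] by blast
  \<comment> \<open>Chosen so that the upper bound for the sum of squared autocorrelations is
    exactly half of the lower bound.\<close>
  define c where "c = sqrt k2 * k1 * v\<^sup>2 / (32 * B)"
  have c: "c > 0" using k1(1) k2(1) v B(1) by (simp add: c_def)
  obtain h0 where h0: "h0 > 0" "\<And>x y. \<bar>x - y\<bar> < h0 \<Longrightarrow> dist (f x) (f y) < c / 6"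
    using almost_periodic_uniformly_continuous[OF f, of "c / 6"] c by auto
  define h where "h = h0 / 2"
  have h: "h > 0" "h < h0" using h0(1) by (auto simp: h_def)
  obtain T0 where T0: "T0 > 0" "\<And>T l. T \<ge> T0 \<Longrightarrow> \<bar>l\<bar> \<le> pi / h \<Longrightarrow>
      norm (integral {0..T} (\<lambda>x. f x * cis (- (l * x)))) \<le> c / 6 * T"
    using bohr_mean_uniform_frequency[OF f zero, of "c / 6" "pi / h"] c by auto
  obtain M where M: "real M \<ge> T0 / h" using real_arch_simple by blast
  have M0: "M > 0" using M T0(1) h(1) by (metis divide_pos_pos gr0I less_le_trans of_nat_0 less_irrefl)
  \<comment> \<open>Twice \<open>M\<close>, so that a lag \<open>x < M\<close> still leaves at least
    \<open>M\<close> products in the autocorrelation.\<close>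
  define N where "N = 2 * M"
  define z where "z n = f (real n * h)" for n
  have zB: "norm (z n) \<le> B" for n by (simp add: z_def B(2))
  have P_le: "norm (\<Sum>n<N. z n * cis (real n * t)) \<le> c * real N" if t: "\<bar>t\<bar> \<le> pi" for t
  proof -
    define l where "l = - (t / h)"
    have lh: "\<bar>l * h\<bar> \<le> pi" using t h(1) by (simp add: l_def)
    have lpi: "\<bar>l\<bar> \<le> pi / h" using t h(1) by (simp add: l_def divide_right_mono)
    define P where "P = (\<Sum>n<N. z n * cis (real n * t))"
    \<comment> \<open>The integral over block number \<open>n\<close> is close to
      \<open>z n * cis (n * t) * J\<close>, so \<open>P * J\<close> is close to an integral of
      \<open>f\<close> against a character of frequency at most \<open>pi / h\<close>. The lower
      bound \<open>h / 3\<close> for \<open>norm J\<close> then permits division by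
      \<open>J\<close>.\<close>
    define J where "J = integral {0..h} (\<lambda>s. cis (- (l * s)))"
    define u where "u = (\<lambda>x. f x * cis (- (l * x)))"
    have cu: "continuous_on S u" for S
      unfolding u_def by (intro continuous_intros cont)
    have "real M * h \<ge> T0" using M h(1) by (simp add: field_simps)
    moreover have "real N * h \<ge> real M * h" using h(1) by (simp add: N_def)
    ultimately have "real N * h \<ge> T0" by linarith
    from T0(2)[OF this lpi] have 1: "norm (integral {0..real N * h} u) \<le> c / 6 * (real N * h)"
      unfolding u_def .
    have blocks: "integral {0..real N * h} u = (\<Sum>n<N. integral {real n * h..real n * h + h} u)"
      by (rule integral_periodic_blocks[OF cu]) (rule less_imp_le[OF h(1)])
    have block: "norm (integral {real n * h..real n * h + h} u - z n * cis (real n * t) * J) \<le> c / 6 * h" for n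
    proof -
      have u_eq: "u (s + real n * h) = cis (real n * t) * (f (s + real n * h) * cis (- (l * s)))" for s
      proof -
        have "- (l * (s + real n * h)) = real n * t + - (l * s)"
          using h(1) by (simp add: l_def field_simps)
        then have "cis (- (l * (s + real n * h))) = cis (real n * t) * cis (- (l * s))"
          by (simp only: cis_mult)
        then show ?thesis by (simp add: u_def)
      qed
      have ci: "continuous_on {0..h} (\<lambda>s. f (s + real n * h))"
        by (rule continuous_on_compose2[OF cont]) (auto intro: continuous_intros)
      have "integral {real n * h..real n * h + h} u = integral {0..h} (\<lambda>s. cis (real n * t) * (f (s + real n * h) * cis (- (l * s))))"
        unfolding integral_translate u_eq ..
      moreover have "z n * cis (real n * t) * J = integral {0..h} (\<lambda>s. cis (real n * t) * (z n * cis (- (l * s))))"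
        by (simp add: J_def)
      ultimately have "integral {real n * h..real n * h + h} u - z n * cis (real n * t) * J
          = integral {0..h} (\<lambda>s. cis (real n * t) * (f (s + real n * h) * cis (- (l * s)))
            - cis (real n * t) * (z n * cis (- (l * s))))"
        by (simp only:) (intro integral_diff[symmetric] integrable_continuous_real continuous_intros ci)
      also have "norm \<dots> \<le> c / 6 * (h - 0)"
      proof (rule integral_bound)
        show "continuous_on {0..h} (\<lambda>s. cis (real n * t) * (f (s + real n * h) * cis (- (l * s)))
            - cis (real n * t) * (z n * cis (- (l * s))))"
          by (intro continuous_intros ci)
        fix s assume s: "s \<in> {0..h}"
        have "cis (real n * t) * (f (s + real n * h) * cis (- (l * s))) - cis (real n * t) * (z n * cis (- (l * s)))
            = cis (real n * t) * ((f (s + real n * h) - z n) * cis (- (l * s)))"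
          by (simp add: algebra_simps)
        then have "norm (cis (real n * t) * (f (s + real n * h) * cis (- (l * s))) - cis (real n * t) * (z n * cis (- (l * s))))
            = norm (f (s + real n * h) - z n)"
          by (simp add: norm_mult)
        also have "\<dots> \<le> c / 6"
          using h0(2)[of "s + real n * h" "real n * h"] s h(2) by (simp add: z_def dist_norm)
        finally show "norm (cis (real n * t) * (f (s + real n * h) * cis (- (l * s))) - cis (real n * t) * (z n * cis (- (l * s)))) \<le> c / 6" .
      qed (use h(1) in simp)
      finally show ?thesis by simp
    qed
    have "norm (\<Sum>n<N. integral {real n * h..real n * h + h} u - z n * cis (real n * t) * J) \<le> (\<Sum>n<N. c / 6 * h)"
      by (rule sum_norm_le) (rule block)
    moreover have "(\<Sum>n<N. integral {real n * h..real n * h + h} u - z n * cis (real n * t) * J)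
        = integral {0..real N * h} u - P * J"
      by (simp add: blocks P_def sum_subtractf sum_distrib_right)
    moreover have "(\<Sum>n<N. c / 6 * h) = c / 6 * (real N * h)" by simp
    ultimately have 2: "norm (integral {0..real N * h} u - P * J) \<le> c / 6 * (real N * h)"
      by (simp only:)
    have "norm (P * J) \<le> norm (integral {0..real N * h} u) + norm (integral {0..real N * h} u - P * J)"
      using norm_triangle_ineq4[of "integral {0..real N * h} u" "integral {0..real N * h} u - P * J"] by simp
    also have "\<dots> \<le> c / 6 * (real N * h) + c / 6 * (real N * h)"
      by (rule add_mono[OF 1 2])
    also have "\<dots> = c * real N * (h / 3)" by simp
    finally have "norm P * norm J \<le> c * real N * (h / 3)" by (simp only: norm_mult)
    moreover have "norm P * (h / 3) \<le> norm P * norm J"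
      unfolding J_def by (rule mult_left_mono[OF norm_integral_cis_ge[OF h(1) lh]]) simp
    ultimately have "norm P * (h / 3) \<le> c * real N * (h / 3)" by linarith
    then show ?thesis using h(1) unfolding P_def by simp
  qed
  have upper: "(\<Sum>x<N. (norm (\<Sum>n<N - x. z (n + x) * cnj (z n)))\<^sup>2) \<le> (c * real N)\<^sup>2 * (real N * B\<^sup>2)"
  proof -
    have "(\<Sum>n<N. (norm (z n))\<^sup>2) \<le> (\<Sum>n<N. B\<^sup>2)"
      by (intro sum_mono power_mono zB) simp
    then have "(c * real N)\<^sup>2 * (\<Sum>n<N. (norm (z n))\<^sup>2) \<le> (c * real N)\<^sup>2 * (real N * B\<^sup>2)"
      by (intro mult_left_mono) auto
    with parseval_autocorrelation_le[OF P_le] show ?thesis by linarith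
  qed
  define A1 where "A1 = {m\<in>{..<M}. \<forall>x. dist (f (x + real m * h)) (f x) < v / 2}"
  define A2 where "A2 = {m\<in>{..<M}. \<forall>x. dist (f (x + real m * h)) (f x) < d}"
  have A1: "(\<Sum>n<M. (norm (z n))\<^sup>2) \<ge> k1 * real M * (v / 2)\<^sup>2"
  proof -
    have "k1 * real M * (v / 2)\<^sup>2 \<le> real (card A1) * (v / 2)\<^sup>2"
      using k1(2)[of M h] unfolding A1_def by (intro mult_right_mono) auto
    also have "\<dots> \<le> (\<Sum>n\<in>A1. (norm (z n))\<^sup>2)"
    proof (rule sum_bounded_below)
      fix n assume "n \<in> A1"
      then have "dist (f (0 + real n * h)) (f 0) < v / 2" unfolding A1_def by blast
      then have "norm (z n) \<ge> v / 2"
        using norm_triangle_sub[of "f 0" "z n"] by (simp add: v_def z_def dist_norm norm_minus_commute)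
      then show "(v / 2)\<^sup>2 \<le> (norm (z n))\<^sup>2" using v by (intro power_mono) auto
    qed
    also have "\<dots> \<le> (\<Sum>n<M. (norm (z n))\<^sup>2)"
      by (intro sum_mono2) (auto simp: A1_def)
    finally show ?thesis .
  qed
  have lower: "norm (\<Sum>n<N - x. z (n + x) * cnj (z n)) \<ge> k1 * real M * v\<^sup>2 / 8" if x: "x \<in> A2" for x
  proof -
    have dx: "\<And>y. dist (f (y + real x * h)) (f y) < d" and xM: "x < M"
      using x by (auto simp: A2_def)
    have "norm (\<Sum>n<N - x. (z (n + x) - z n) * cnj (z n)) \<le> (\<Sum>n<N - x. d * B)"
    proof (rule sum_norm_le)
      fix n
      have "norm (z (n + x) - z n) \<le> d"
        using dx[of "real n * h"] by (simp add: z_def dist_norm algebra_simps)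
      then show "norm ((z (n + x) - z n) * cnj (z n)) \<le> d * B"
        unfolding norm_mult complex_mod_cnj using zB[of n] d by (intro mult_mono) auto
    qed
    also have "\<dots> \<le> real N * (d * B)"
      using d B(1) by (simp add: mult_right_mono)
    also have "\<dots> = k1 * real M * v\<^sup>2 / 8"
      using B(1) by (simp add: d_def N_def)
    finally have 1: "norm (\<Sum>n<N - x. (z (n + x) - z n) * cnj (z n)) \<le> k1 * real M * v\<^sup>2 / 8" .
    have eq: "(\<Sum>n<N - x. z (n + x) * cnj (z n))
        = of_real (\<Sum>n<N - x. (norm (z n))\<^sup>2) + (\<Sum>n<N - x. (z (n + x) - z n) * cnj (z n))"
      unfolding of_real_sum complex_norm_square sum.distrib[symmetric] by (simp add: left_diff_distrib)
    have "k1 * real M * v\<^sup>2 / 4 \<le> (\<Sum>n<M. (norm (z n))\<^sup>2)"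
      using A1 by (simp add: power_divide)
    also have "\<dots> \<le> (\<Sum>n<N - x. (norm (z n))\<^sup>2)"
      using xM by (intro sum_mono2) (auto simp: N_def)
    also have "\<dots> = norm (complex_of_real (\<Sum>n<N - x. (norm (z n))\<^sup>2))"
      by (simp only: norm_of_real abs_of_nonneg[OF sum_nonneg[OF zero_le_power2]])
    finally show ?thesis
      using 1 unfolding eq
      using norm_diff_ineq[of "complex_of_real (\<Sum>n<N - x. (norm (z n))\<^sup>2)" "\<Sum>n<N - x. (z (n + x) - z n) * cnj (z n)"]
      by linarith
  qed
  have "k2 * real M * (k1 * real M * v\<^sup>2 / 8)\<^sup>2 \<le> real (card A2) * (k1 * real M * v\<^sup>2 / 8)\<^sup>2"
    using k2(2)[of M h] unfolding A2_def by (intro mult_right_mono) auto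
  also have "\<dots> \<le> (\<Sum>x\<in>A2. (norm (\<Sum>n<N - x. z (n + x) * cnj (z n)))\<^sup>2)"
    using k1(1) by (intro sum_bounded_below power_mono lower) auto
  also have "\<dots> \<le> (\<Sum>x<N. (norm (\<Sum>n<N - x. z (n + x) * cnj (z n)))\<^sup>2)"
    by (intro sum_mono2) (auto simp: A2_def N_def)
  also note upper
  also have "(c * real N)\<^sup>2 * (real N * B\<^sup>2) = k2 * real M * (k1 * real M * v\<^sup>2 / 8)\<^sup>2 / 2"
  proof -
    have "c\<^sup>2 * B\<^sup>2 = (sqrt k2)\<^sup>2 * (k1 * v\<^sup>2 / 32)\<^sup>2"
      using B(1) by (simp add: c_def power2_eq_square)
    also have "(sqrt k2)\<^sup>2 = k2" using k2(1) by simp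
    finally have "c\<^sup>2 * B\<^sup>2 * (8 * real M ^ 3) = k2 * (k1 * v\<^sup>2 / 32)\<^sup>2 * (8 * real M ^ 3)" by simp
    then show ?thesis by (simp add: N_def power2_eq_square power3_eq_cube algebra_simps)
  qed
  finally have "k2 * real M * (k1 * real M * v\<^sup>2 / 8)\<^sup>2 \<le> 0" by simp
  moreover have "k2 * real M * (k1 * real M * v\<^sup>2 / 8)\<^sup>2 > 0"
    using k1(1) k2(1) v M0 by simp
  ultimately show False by linarith
qed

text \<open>The vanishing result concerns the point 0 only. Translating by \<open>t\<close>
  multiplies every coefficient of the difference by \<open>cis (l * t)\<close>, so all coefficients
  remain zero and the result reaches every point.\<close>

theorem almost_periodic_eqI:
  fixes f g :: "real \<Rightarrow> complex"
  assumes f: "almost_periodic f" and g: "almost_periodic g"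
    and eq: "\<And>l. bohr_coeff f l = bohr_coeff g l"
  shows "f = g"
proof
  fix t
  define h where "h = (\<lambda>x. f x - g x)"
  have h: "almost_periodic h" unfolding h_def by (rule almost_periodic_diff[OF f g])
  have h0: "bohr_coeff h l = 0" for l
    unfolding h_def bohr_coeff_diff[OF f g] eq by simp
  have "bohr_coeff (\<lambda>x. h (x + t)) l = cis (l * t) * bohr_coeff h l" for l
    by (rule bohr_coeff_translate_limit[OF h, of "\<lambda>_. t"]) (simp_all add: uniform_limit_sequentially_iff)
  then have "h (0 + t) = 0"
    by (intro almost_periodic_eq_0_at_0[OF almost_periodic_translate[OF h]]) (simp add: h0)
  then show "f t = g t" by (simp add: h_def)
qed

subsection \<open>Approximation off a group of frequencies\<close>

text \<open>Finite sums are generated as functions instead of being recorded by their coefficients: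
  the argument only uses that their means are nonnegative and that their means against a character
  off the group vanish, and both follow by induction. Nonnegative coefficients ensure that no
  cancellation lowers the mean of a product.\<close>

inductive nonneg_trig_poly :: "real set \<Rightarrow> (real \<Rightarrow> complex) \<Rightarrow> bool" for G where
  zero: "nonneg_trig_poly G (\<lambda>t. 0)"
| add_term: "v \<in> G \<Longrightarrow> a \<ge> 0 \<Longrightarrow> nonneg_trig_poly G K \<Longrightarrow>
    nonneg_trig_poly G (\<lambda>t. of_real a * cis (v * t) + K t)"

lemma nonneg_trig_poly_term:
  assumes "v \<in> G" "a \<ge> 0"
  shows "nonneg_trig_poly G (\<lambda>t. of_real a * cis (v * t))"
  using nonneg_trig_poly.add_term[OF assms nonneg_trig_poly.zero] by simp

lemma nonneg_trig_poly_add: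
  assumes "nonneg_trig_poly G K" "nonneg_trig_poly G L"
  shows "nonneg_trig_poly G (\<lambda>t. K t + L t)"
  using assms
proof (induction rule: nonneg_trig_poly.induct)
  case (add_term v a K)
  then have "nonneg_trig_poly G (\<lambda>t. of_real a * cis (v * t) + (K t + L t))"
    by (intro nonneg_trig_poly.add_term) auto
  then show ?case by (simp add: add.assoc)
qed simp

lemma nonneg_trig_poly_term_mult:
  assumes K: "nonneg_trig_poly (group_closure S) K" and v: "v \<in> group_closure S" and a: "a \<ge> 0"
  shows "nonneg_trig_poly (group_closure S) (\<lambda>t. of_real a * cis (v * t) * K t)"
  using K
proof (induction rule: nonneg_trig_poly.induct)
  case (add_term u b K)
  have "nonneg_trig_poly (group_closure S) (\<lambda>t. of_real (a * b) * cis ((v + u) * t) + of_real a * cis (v * t) * K t)"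
    using add_term a v by (intro nonneg_trig_poly.add_term group_closure_add) auto
  moreover have "of_real (a * b) * cis ((v + u) * t) + of_real a * cis (v * t) * K t
      = of_real a * cis (v * t) * (of_real b * cis (u * t) + K t)" for t
  proof -
    have "cis ((v + u) * t) = cis (v * t) * cis (u * t)" by (simp add: cis_mult distrib_right)
    then show ?thesis by (simp add: algebra_simps)
  qed
  ultimately show ?case by (simp only:)
qed (simp add: nonneg_trig_poly.zero)

lemma nonneg_trig_poly_mult:
  assumes "nonneg_trig_poly (group_closure S) K" and L: "nonneg_trig_poly (group_closure S) L"
  shows "nonneg_trig_poly (group_closure S) (\<lambda>t. K t * L t)"
  using assms(1)
proof (induction rule: nonneg_trig_poly.induct)
  case (add_term v a K)
  have "nonneg_trig_poly (group_closure S) (\<lambda>t. of_real a * cis (v * t) * L t + K t * L t)"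
    using add_term by (intro nonneg_trig_poly_add nonneg_trig_poly_term_mult L) auto
  then show ?case by (simp add: distrib_right)
qed (simp add: nonneg_trig_poly.zero)

lemma nonneg_trig_poly_sum:
  assumes "finite I" "\<And>i. i \<in> I \<Longrightarrow> nonneg_trig_poly G (K i)"
  shows "nonneg_trig_poly G (\<lambda>t. \<Sum>i\<in>I. K i t)"
  using assms by (induction I rule: finite_induct) (simp_all add: nonneg_trig_poly.zero nonneg_trig_poly_add)

lemma nonneg_trig_poly_continuous:
  assumes "nonneg_trig_poly G K" shows "continuous_on X K"
  using assms by (induction rule: nonneg_trig_poly.induct) (auto intro!: continuous_intros)

text \<open>No frequency \<open>v\<close> of \<open>K\<close> cancels \<open>c\<close>, because
  \<open>v + c = 0\<close> would put \<open>c\<close> into the group.\<close>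

lemma nonneg_trig_poly_mean_cis:
  assumes K: "nonneg_trig_poly (group_closure S) K" and c: "c \<notin> group_closure S"
  shows "((\<lambda>T. integral {0..T} (\<lambda>t. K t * cis (c * t)) / of_real T) \<longlongrightarrow> 0) at_top"
  using K
proof (induction rule: nonneg_trig_poly.induct)
  case (add_term v a K)
  have "v + c \<noteq> 0"
    using c add_term(1) group_closure_minus_iff[of c S] by (auto simp: add_eq_0_iff2)
  have "integral {0..T} (\<lambda>t. (of_real a * cis (v * t) + K t) * cis (c * t))
      = of_real a * integral {0..T} (\<lambda>t. cis ((v + c) * t)) + integral {0..T} (\<lambda>t. K t * cis (c * t))" for T
  proof -
    have "(of_real a * cis (v * t) + K t) * cis (c * t) = of_real a * cis ((v + c) * t) + K t * cis (c * t)" for t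
    proof -
      have "cis ((v + c) * t) = cis (v * t) * cis (c * t)" by (simp add: cis_mult distrib_right)
      then show ?thesis by (simp add: algebra_simps)
    qed
    then have "integral {0..T} (\<lambda>t. (of_real a * cis (v * t) + K t) * cis (c * t))
      = integral {0..T} (\<lambda>t. of_real a * cis ((v + c) * t) + K t * cis (c * t))" by (simp only:)
    also have "\<dots> = integral {0..T} (\<lambda>t. of_real a * cis ((v + c) * t)) + integral {0..T} (\<lambda>t. K t * cis (c * t))"
      by (intro integral_add integrable_continuous_real continuous_intros nonneg_trig_poly_continuous[OF add_term(3)])
    finally show ?thesis by simp
  qed
  moreover have "((\<lambda>T. of_real a * (integral {0..T} (\<lambda>t. cis ((v + c) * t)) / of_real T)
      + integral {0..T} (\<lambda>t. K t * cis (c * t)) / of_real T) \<longlongrightarrow> of_real a * (if v + c = 0 then 1 else 0) + 0) at_top"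
    by (intro tendsto_intros cis_mean_tendsto add_term.IH)
  ultimately show ?case
    using \<open>v + c \<noteq> 0\<close> by (simp add: add_divide_distrib)
qed simp

text \<open>A term contributes its coefficient to the mean if its frequency is 0, and nothing
  otherwise.\<close>

lemma nonneg_trig_poly_mean:
  assumes K: "nonneg_trig_poly G K"
  shows "\<exists>m\<ge>0. ((\<lambda>T. integral {0..T} K / of_real T) \<longlongrightarrow> of_real m) at_top"
  using K
proof (induction rule: nonneg_trig_poly.induct)
  case (add_term v a K)
  then obtain m where m: "m \<ge> 0" "((\<lambda>T. integral {0..T} K / of_real T) \<longlongrightarrow> of_real m) at_top" by blast
  have eq: "integral {0..T} (\<lambda>t. of_real a * cis (v * t) + K t)
      = of_real a * integral {0..T} (\<lambda>t. cis (v * t)) + integral {0..T} K" for T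
  proof -
    have "integral {0..T} (\<lambda>t. of_real a * cis (v * t) + K t) = integral {0..T} (\<lambda>t. of_real a * cis (v * t)) + integral {0..T} K"
      by (intro integral_add integrable_continuous_real continuous_intros nonneg_trig_poly_continuous[OF add_term(3)])
    then show ?thesis by simp
  qed
  have lim: "((\<lambda>T. of_real a * (integral {0..T} (\<lambda>t. cis (v * t)) / of_real T)
      + integral {0..T} K / of_real T) \<longlongrightarrow> of_real a * (if v = 0 then 1 else 0) + of_real m) at_top"
    by (intro tendsto_intros cis_mean_tendsto m(2))
  have "((\<lambda>T. integral {0..T} (\<lambda>t. of_real a * cis (v * t) + K t) / of_real T)
      \<longlongrightarrow> of_real a * (if v = 0 then 1 else 0) + of_real m) at_top"
    using lim unfolding eq add_divide_distrib times_divide_eq_right .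
  moreover have "complex_of_real a * (if v = 0 then 1 else 0) + of_real m = of_real (a * (if v = 0 then 1 else 0) + m)"
    by simp
  ultimately have "((\<lambda>T. integral {0..T} (\<lambda>t. of_real a * cis (v * t) + K t) / of_real T)
      \<longlongrightarrow> of_real (a * (if v = 0 then 1 else 0) + m)) at_top"
    by (simp only:)
  then show ?case
    using add_term(2) m(1) by (intro exI[of _ "a * (if v = 0 then 1 else 0) + m"]) auto
qed (intro exI[of _ 0]; simp)

lemma group_closure_of_int_mult:
  fixes v :: real
  assumes "v \<in> group_closure S"
  shows "of_int k * v \<in> group_closure S"
proof (cases "k \<ge> 0")
  case True
  then show ?thesis
    using group_closure_scalar_mult_left[OF assms, of "nat k"] by simp
next
  case False
  then have "of_int (- k) * v \<in> group_closure S"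
    using group_closure_scalar_mult_left[OF assms, of "nat (- k)"] by simp
  then show ?thesis
    using group_closure_minus_iff[of "of_int k * v" S] by simp
qed

text \<open>The base is \<open>(cos (v * t / 2))\<^sup>2\<close>, so its n-th power is a binomial
  expansion in \<open>cis (v * t / 2)\<close> and \<open>cis (- (v * t / 2))\<close>, whose
  exponents combine to integer multiples of \<open>v\<close>. The middle term is kept apart as an
  explicit lower bound for the mean.\<close>

lemma cos_kernel_expansion:
  assumes v: "v \<in> group_closure S"
  obtains K where "nonneg_trig_poly (group_closure S) K"
    "\<And>t. of_real (((1 + cos (v * t)) / 2) ^ n) = of_real (real (2 * n choose n) / 4 ^ n) + K t"
proof -
  define a where "a k = real (2 * n choose k) / 4 ^ n" for k
  define K where "K t = (\<Sum>k\<in>{..2 * n} - {n}. of_real (a k) * cis ((of_int (int k - int n) * v) * t))" for t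
  have "nonneg_trig_poly (group_closure S) K"
    unfolding K_def
    by (intro nonneg_trig_poly_sum nonneg_trig_poly_term group_closure_of_int_mult v) (auto simp: a_def)
  moreover have "of_real (((1 + cos (v * t)) / 2) ^ n) = of_real (a n) + K t" for t
  proof -
    define x where "x = v * t / 2"
    have "complex_of_real ((1 + cos (v * t)) / 2) = (cis x + cis (- x))\<^sup>2 / 4"
    proof -
      have "cis x + cis (- x) = of_real (2 * cos x)"
        by (simp add: complex_eq_iff)
      moreover have "(1 + cos (v * t)) / 2 = (cos x)\<^sup>2"
        using cos_double_cos[of x] by (simp add: x_def)
      ultimately show ?thesis by (simp add: power2_eq_square)
    qed
    then have "complex_of_real (((1 + cos (v * t)) / 2) ^ n) = (cis x + cis (- x)) ^ (2 * n) / 4 ^ n"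
      unfolding power_mult of_real_power by (simp only: power_divide)
    also have "\<dots> = (\<Sum>k\<le>2 * n. of_nat (2 * n choose k) * cis x ^ k * cis (- x) ^ (2 * n - k)) / 4 ^ n"
      by (simp only: binomial_ring)
    also have "\<dots> = (\<Sum>k\<le>2 * n. of_real (a k) * cis ((of_int (int k - int n) * v) * t))"
      unfolding sum_divide_distrib
    proof (intro sum.cong refl)
      fix k assume k: "k \<in> {..2 * n}"
      have e: "real k * x + real (2 * n - k) * - x = (of_int (int k - int n) * v) * t"
        using k by (simp add: x_def of_nat_diff field_simps)
      have "cis x ^ k * cis (- x) ^ (2 * n - k) = cis ((of_int (int k - int n) * v) * t)"
        unfolding Complex.DeMoivre cis_mult e ..
      then show "of_nat (2 * n choose k) * cis x ^ k * cis (- x) ^ (2 * n - k) / 4 ^ n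
          = of_real (a k) * cis ((of_int (int k - int n) * v) * t)"
        by (simp add: a_def mult.assoc)
    qed
    also have "\<dots> = of_real (a n) + K t"
      unfolding K_def by (subst sum.remove[of _ n]) auto
    finally show ?thesis .
  qed
  ultimately show thesis using that unfolding a_def by blast
qed

text \<open>Linear relations between the frequencies in \<open>F\<close> can produce further
  constant terms. They end up in \<open>K\<close>, whose coefficients are nonnegative, so the
  explicit constant remains a lower bound for the mean of the product.\<close>

lemma cos_kernel_prod_expansion:
  assumes "finite F" "F \<subseteq> group_closure S"
  shows "\<exists>K. nonneg_trig_poly (group_closure S) K \<and>
    (\<forall>t. of_real (\<Prod>v\<in>F. ((1 + cos (v * t)) / 2) ^ n) = of_real ((real (2 * n choose n) / 4 ^ n) ^ card F) + K t)"
  using assms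
proof (induction F rule: finite_induct)
  case empty
  show ?case by (intro exI[of _ "\<lambda>_. 0"]) (simp add: nonneg_trig_poly.zero)
next
  case (insert v F)
  define a where "a = real (2 * n choose n) / 4 ^ n"
  have a: "a \<ge> 0" by (simp add: a_def)
  obtain K where K: "nonneg_trig_poly (group_closure S) K"
    "\<And>t. of_real (\<Prod>v\<in>F. ((1 + cos (v * t)) / 2) ^ n) = of_real (a ^ card F) + K t"
    using insert unfolding a_def by auto
  obtain L where L: "nonneg_trig_poly (group_closure S) L"
    "\<And>t. of_real (((1 + cos (v * t)) / 2) ^ n) = of_real a + L t"
    using cos_kernel_expansion[of v S n] insert.prems unfolding a_def by auto
  have const: "nonneg_trig_poly (group_closure S) (\<lambda>t. of_real b * P t)"
    if "b \<ge> 0" "nonneg_trig_poly (group_closure S) P" for b P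
    using nonneg_trig_poly_term_mult[OF that(2) zero_in_group_closure that(1)] by simp
  have "nonneg_trig_poly (group_closure S) (\<lambda>t. of_real a * K t + (of_real (a ^ card F) * L t + L t * K t))"
    using a by (intro nonneg_trig_poly_add nonneg_trig_poly_mult const K(1) L(1)) auto
  moreover have "of_real (\<Prod>v\<in>insert v F. ((1 + cos (v * t)) / 2) ^ n)
      = of_real (a ^ card (insert v F)) + (of_real a * K t + (of_real (a ^ card F) * L t + L t * K t))" for t
  proof -
    have "complex_of_real (\<Prod>v\<in>insert v F. ((1 + cos (v * t)) / 2) ^ n) = (of_real a + L t) * (of_real (a ^ card F) + K t)"
      unfolding prod.insert[OF insert.hyps] of_real_mult K(2) L(2) ..
    then show ?thesis
      unfolding card_insert_disjoint[OF insert.hyps] power_Suc of_real_mult by (simp add: algebra_simps)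
  qed
  ultimately show ?case unfolding a_def by blast
qed

lemma norm_cis_minus_1_square: "(norm (cis x - 1))\<^sup>2 = 2 - 2 * cos x"
  using sin_cos_squared_add[of x] by (simp add: cmod_power2 power2_diff)

text \<open>If the conclusion failed, then \<open>K t * cos (c * t) \<ge> K t / 2 - 3 / 2 * b ^ n\<close> for the kernel
  \<open>K t = (\<Prod>v\<in>F. ((1 + cos (v * t)) / 2) ^ n)\<close> and some \<open>b < 1\<close>. The left-hand side has mean zero as
  \<open>c\<close> is not a frequency of the kernel, whereas the mean of \<open>K\<close> decays only polynomially in \<open>n\<close>.\<close>

lemma simultaneous_approximation_off_group:
  fixes c d :: real
  assumes c: "c \<notin> group_closure S" and F: "finite F" "F \<subseteq> group_closure S" and d: "d > 0"
  shows "\<exists>t. (\<forall>v\<in>F. norm (cis (v * t) - 1) < d) \<and> cos (c * t) \<le> 1 / 2"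
proof (rule ccontr)
  assume nt: "\<not> ?thesis"
  have good: "cos (c * t) > 1 / 2" if "\<And>v. v \<in> F \<Longrightarrow> norm (cis (v * t) - 1) < d" for t
    using nt that by (auto simp: not_le)
  \<comment> \<open>The frequency 0 contributes the constant factor 1 and makes
    \<open>card H\<close> positive.\<close>
  define H where "H = insert 0 F"
  have H: "finite H" "H \<subseteq> group_closure S"
    using F by (auto simp: H_def)
  then have "card H > 0" by (auto simp: H_def card_gt_0_iff)
  \<comment> \<open>A violated condition \<open>norm (cis (v * t) - 1) < d\<close> forces
    \<open>(1 + cos (v * t)) / 2 \<le> 1 - d\<^sup>2 / 4\<close>. The maximum with
    \<open>1 / 2\<close> keeps \<open>b\<close> positive for large \<open>d\<close>.\<close>
  define b where "b = max (1 / 2) (1 - d\<^sup>2 / 4)"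
  have b: "b > 0" "b < 1" using d by (auto simp: b_def)
  have c0: "c \<noteq> 0" using c by auto
  have main: "(real (2 * n choose n) / 4 ^ n) ^ card H \<le> 3 * b ^ n" for n
  proof -
    define a where "a = (real (2 * n choose n) / 4 ^ n) ^ card H"
    define R where "R t = (\<Prod>v\<in>H. ((1 + cos (v * t)) / 2) ^ n)" for t
    obtain K where K: "nonneg_trig_poly (group_closure S) K"
      and RK: "\<And>t. complex_of_real (R t) = of_real a + K t"
      using cos_kernel_prod_expansion[OF H(1,2), of n] unfolding R_def a_def by auto
    have factor: "0 \<le> ((1 + cos y) / 2) ^ n" "((1 + cos y) / 2) ^ n \<le> 1" for y :: real
    proof -
      have "0 \<le> (1 + cos y) / 2" using add_left_mono[OF cos_ge_minus_one[of y], of 1] by simp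
      then show "0 \<le> ((1 + cos y) / 2) ^ n" "((1 + cos y) / 2) ^ n \<le> 1"
        using cos_le_one[of y] by (auto intro!: power_le_one)
    qed
    have R0: "R t \<ge> 0" for t unfolding R_def by (intro prod_nonneg) (use factor in auto)
    have pointwise: "R t * cos (c * t) \<ge> R t / 2 - 3 / 2 * b ^ n" for t
    proof (cases "\<forall>v\<in>F. norm (cis (v * t) - 1) < d")
      case True
      then have "cos (c * t) \<ge> 1 / 2" using good[of t] by auto
      then have "R t * cos (c * t) \<ge> R t * (1 / 2)" using R0 by (intro mult_left_mono) auto
      moreover have "b ^ n \<ge> 0" using b by simp
      ultimately show ?thesis by linarith
    next
      case False
      then obtain v where v: "v \<in> F" "norm (cis (v * t) - 1) \<ge> d" by (auto simp: not_less)
      have "d\<^sup>2 \<le> 2 - 2 * cos (v * t)"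
        using power_mono[OF v(2), of 2] d norm_cis_minus_1_square[of "v * t"] by simp
      then have "(1 + cos (v * t)) / 2 \<le> 1 - d\<^sup>2 / 4" by (simp add: field_simps)
      also have "1 - d\<^sup>2 / 4 \<le> b" by (simp add: b_def)
      finally have "(1 + cos (v * t)) / 2 \<le> b" .
      moreover have "0 \<le> (1 + cos (v * t)) / 2" using add_left_mono[OF cos_ge_minus_one[of "v * t"], of 1] by simp
      ultimately have "((1 + cos (v * t)) / 2) ^ n \<le> b ^ n"
        by (intro power_mono)
      moreover have "R t = ((1 + cos (v * t)) / 2) ^ n * (\<Prod>v\<in>H - {v}. ((1 + cos (v * t)) / 2) ^ n)"
        unfolding R_def using H(1) v(1) by (intro prod.remove) (auto simp: H_def)
      moreover have "(\<Prod>v\<in>H - {v}. ((1 + cos (v * t)) / 2) ^ n) \<le> 1"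
        by (intro prod_le_1) (use factor in auto)
      ultimately have "R t \<le> b ^ n"
        using mult_left_le[OF \<open>(\<Prod>v\<in>H - {v}. ((1 + cos (v * t)) / 2) ^ n) \<le> 1\<close> factor(1)[of "v * t"]] by linarith
      moreover have "R t * cos (c * t) \<ge> R t * (- 1)"
        by (intro mult_left_mono R0 cos_ge_minus_one)
      ultimately show ?thesis by linarith
    qed
    have cR: "continuous_on X R" for X
      unfolding R_def by (intro continuous_intros) auto
    have cK: "continuous_on X K" for X
      by (rule nonneg_trig_poly_continuous[OF K])
    obtain m where m: "m \<ge> 0" "((\<lambda>T. integral {0..T} K / of_real T) \<longlongrightarrow> of_real m) at_top"
      using nonneg_trig_poly_mean[OF K] by blast
    have mean_R: "((\<lambda>T. integral {0..T} R / T) \<longlongrightarrow> a + m) at_top"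
    proof -
      have "((\<lambda>T. of_real a * (integral {0..T} (\<lambda>t. cis (0 * t)) / of_real T) + integral {0..T} K / of_real T)
          \<longlongrightarrow> of_real a * (if (0::real) = 0 then 1 else 0) + of_real m) at_top"
        by (intro tendsto_intros cis_mean_tendsto m(2))
      then have "((\<lambda>T. Re (of_real a * (integral {0..T} (\<lambda>t. cis (0 * t)) / of_real T) + integral {0..T} K / of_real T))
          \<longlongrightarrow> Re (of_real a * (if (0::real) = 0 then 1 else 0) + of_real m)) at_top"
        by (rule tendsto_Re)
      moreover have "Re (of_real a * (integral {0..T} (\<lambda>t. cis (0 * t)) / of_real T) + integral {0..T} K / of_real T)
          = integral {0..T} R / T" for T
      proof -
        have "complex_of_real (integral {0..T} R) = integral {0..T} (\<lambda>t. complex_of_real (R t))"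
          using integral_linear[OF integrable_continuous_real[OF cR] bounded_linear_of_real[where ?'a=complex]]
          by (simp add: o_def)
        also have "\<dots> = integral {0..T} (\<lambda>t. of_real a * cis (0 * t) + K t)"
          by (simp only: RK) simp
        also have "\<dots> = integral {0..T} (\<lambda>t. of_real a * cis (0 * t)) + integral {0..T} K"
          by (intro integral_add integrable_continuous_real continuous_intros cK)
        also have "integral {0..T} (\<lambda>t. of_real a * cis (0 * t)) = of_real a * integral {0..T} (\<lambda>t. cis (0 * t))"
          by (rule integral_mult_right)
        finally have "of_real a * (integral {0..T} (\<lambda>t. cis (0 * t)) / of_real T) + integral {0..T} K / of_real T
            = complex_of_real (integral {0..T} R / T)"
          by (simp only: of_real_divide add_divide_distrib times_divide_eq_right)
        then show ?thesis by (simp only: Re_complex_of_real)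
      qed
      ultimately show ?thesis by simp
    qed
    have mean_Rc: "((\<lambda>T. integral {0..T} (\<lambda>t. R t * cos (c * t)) / T) \<longlongrightarrow> 0) at_top"
    proof -
      have "((\<lambda>T. of_real a * (integral {0..T} (\<lambda>t. cis (c * t)) / of_real T) + integral {0..T} (\<lambda>t. K t * cis (c * t)) / of_real T)
          \<longlongrightarrow> of_real a * (if c = 0 then 1 else 0) + 0) at_top"
        by (intro tendsto_intros cis_mean_tendsto nonneg_trig_poly_mean_cis[OF K c])
      then have "((\<lambda>T. Re (of_real a * (integral {0..T} (\<lambda>t. cis (c * t)) / of_real T) + integral {0..T} (\<lambda>t. K t * cis (c * t)) / of_real T))
          \<longlongrightarrow> Re (of_real a * (if c = 0 then 1 else 0) + 0)) at_top"
        by (rule tendsto_Re)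
      moreover have "Re (of_real a * (integral {0..T} (\<lambda>t. cis (c * t)) / of_real T) + integral {0..T} (\<lambda>t. K t * cis (c * t)) / of_real T)
          = integral {0..T} (\<lambda>t. R t * cos (c * t)) / T" for T
      proof -
        have "integral {0..T} (\<lambda>t. complex_of_real (R t) * cis (c * t))
            = integral {0..T} (\<lambda>t. of_real a * cis (c * t) + K t * cis (c * t))"
          by (simp only: RK distrib_right)
        also have "\<dots> = integral {0..T} (\<lambda>t. of_real a * cis (c * t)) + integral {0..T} (\<lambda>t. K t * cis (c * t))"
          by (intro integral_add integrable_continuous_real continuous_intros cK)
        also have "integral {0..T} (\<lambda>t. of_real a * cis (c * t)) = of_real a * integral {0..T} (\<lambda>t. cis (c * t))"
          by (rule integral_mult_right)
        finally have e: "of_real a * (integral {0..T} (\<lambda>t. cis (c * t)) / of_real T) + integral {0..T} (\<lambda>t. K t * cis (c * t)) / of_real T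
            = integral {0..T} (\<lambda>t. complex_of_real (R t) * cis (c * t)) / of_real T"
          by (simp only: add_divide_distrib times_divide_eq_right)
        have "(\<lambda>t. complex_of_real (R t) * cis (c * t)) integrable_on {0..T}"
          by (intro integrable_continuous_real continuous_intros cR)
        from integral_linear[OF this bounded_linear_Re]
        have "Re (integral {0..T} (\<lambda>t. complex_of_real (R t) * cis (c * t))) = integral {0..T} (\<lambda>t. R t * cos (c * t))"
          by (simp add: o_def)
        then show ?thesis unfolding e by simp
      qed
      ultimately show ?thesis using c0 by simp
    qed
    have lim: "((\<lambda>T. integral {0..T} R / T / 2 - 3 / 2 * b ^ n) \<longlongrightarrow> (a + m) / 2 - 3 / 2 * b ^ n) at_top"
      by (intro tendsto_intros mean_R) simp
    have "(a + m) / 2 - 3 / 2 * b ^ n \<le> 0"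
    proof (rule tendsto_le[OF _ mean_Rc lim])
      show "\<forall>\<^sub>F T in at_top. integral {0..T} R / T / 2 - 3 / 2 * b ^ n \<le> integral {0..T} (\<lambda>t. R t * cos (c * t)) / T"
        using eventually_gt_at_top[of 0]
      proof eventually_elim
        case (elim T)
        have i1: "((\<lambda>t. R t * (1 / 2) - 3 / 2 * b ^ n) has_integral (integral {0..T} R * (1 / 2) - (T - 0) *\<^sub>R (3 / 2 * b ^ n))) {0..T}"
          using has_integral_const_real[of "3 / 2 * b ^ n" 0 T] elim
          by (intro has_integral_diff has_integral_mult_left integrable_integral integrable_continuous_real cR) auto
        have i2: "((\<lambda>t. R t * cos (c * t)) has_integral (integral {0..T} (\<lambda>t. R t * cos (c * t)))) {0..T}"
          by (intro integrable_integral integrable_continuous_real continuous_intros cR)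
        have "integral {0..T} R * (1 / 2) - (T - 0) *\<^sub>R (3 / 2 * b ^ n) \<le> integral {0..T} (\<lambda>t. R t * cos (c * t))"
          by (rule has_integral_le[OF i1 i2]) (use pointwise in simp)
        then have "(integral {0..T} R * (1 / 2) - (T - 0) *\<^sub>R (3 / 2 * b ^ n)) / T \<le> integral {0..T} (\<lambda>t. R t * cos (c * t)) / T"
          using elim by (intro divide_right_mono) auto
        then show ?case using elim by (simp add: diff_divide_distrib)
      qed
    qed simp
    then have "a + m \<le> 3 * b ^ n" by (simp add: field_simps)
    with m(1) have "a \<le> 3 * b ^ n" by linarith
    then show ?thesis unfolding a_def .
  qed
  define k where "k = card H"
  \<comment> \<open>Exponents of the form \<open>n = m * k\<close> turn
    \<open>b ^ n * (2 * n) ^ k\<close> into the k-th power of \<open>2 * k * m * b ^ m\<close>,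
    which tends to 0 as \<open>m\<close> grows.\<close>
  have "(\<lambda>m. 2 * real k * (of_nat m * b ^ m)) \<longlonglongrightarrow> 2 * real k * 0"
    by (intro tendsto_intros powser_times_n_limit_0) (use b in simp)
  then have "\<forall>\<^sub>F m in sequentially. 2 * real k * (of_nat m * b ^ m) < 1 / 3"
    by (rule order_tendstoD) simp
  then obtain m where m: "m > 0" "2 * real k * (real m * b ^ m) < 1 / 3"
  proof -
    assume ev: "\<forall>\<^sub>F m in sequentially. 2 * real k * (of_nat m * b ^ m) < 1 / 3"
    then obtain M where M: "\<And>m. m \<ge> M \<Longrightarrow> 2 * real k * (of_nat m * b ^ m) < 1 / 3"
      unfolding eventually_sequentially by blast
    show ?thesis by (rule that[of "Suc M", OF zero_less_Suc M]) simp
  qed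
  define n where "n = m * k"
  have n: "n > 0" using m(1) \<open>card H > 0\<close> by (simp add: n_def k_def)
  have "1 / (2 * real n) \<le> real (2 * n choose n) / 4 ^ n"
    using central_binomial_lower_bound[OF n] n by (simp add: field_simps)
  then have "(1 / (2 * real n)) ^ k \<le> (real (2 * n choose n) / 4 ^ n) ^ k"
    by (intro power_mono) auto
  also have "\<dots> \<le> 3 * b ^ n" using main[of n] by (simp add: k_def)
  finally have "1 \<le> 3 * (b ^ n * (2 * real n) ^ k)"
    using n by (simp add: power_divide field_simps)
  also have "b ^ n * (2 * real n) ^ k = (2 * real k * (real m * b ^ m)) ^ k"
  proof -
    have "b ^ n = (b ^ m) ^ k" by (simp add: n_def power_mult)
    moreover have "2 * real k * (real m * b ^ m) = b ^ m * (2 * real n)" by (simp add: n_def)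
    ultimately show ?thesis by (simp only: power_mult_distrib)
  qed
  also have "(2 * real k * (real m * b ^ m)) ^ k \<le> (2 * real k * (real m * b ^ m)) ^ 1"
    using m b \<open>card H > 0\<close> by (intro power_decreasing) (auto simp: k_def)
  finally show False using m(2) by simp
qed

section \<open>Common almost periods of several functions\<close>

lemma almost_periodic_common_subseq:
  fixes F :: "(real \<Rightarrow> 'a::real_normed_field) set" and s :: "nat \<Rightarrow> real"
  assumes "finite F" "\<And>f. f \<in> F \<Longrightarrow> almost_periodic f"
  shows "\<exists>r. strict_mono r \<and> (\<forall>f\<in>F. \<exists>g. uniform_limit UNIV (\<lambda>n x. f (x + s (r n))) g sequentially)"
  using assms
proof (induction F rule: finite_induct)
  case empty
  show ?case by (intro exI[of _ "\<lambda>n. n"]) (simp add: strict_mono_def)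
next
  case (insert f F)
  then obtain r1 where r1: "strict_mono r1"
    and lim: "\<And>f. f \<in> F \<Longrightarrow> \<exists>g. uniform_limit UNIV (\<lambda>n x. f (x + s (r1 n))) g sequentially"
    by blast
  obtain r2 h where r2: "strict_mono r2"
    and h: "uniform_limit UNIV (\<lambda>n x. f (x + s (r1 (r2 n)))) h sequentially"
    using almost_periodic_subseq[of f "\<lambda>n. s (r1 n)"] insert.prems by blast
  have "\<exists>g. uniform_limit UNIV (\<lambda>n x. f' (x + s (r1 (r2 n)))) g sequentially" if "f' \<in> insert f F" for f'
  proof (cases "f' = f")
    case False
    with that lim obtain g where "uniform_limit UNIV (\<lambda>n x. f' (x + s (r1 n))) g sequentially" by blast
    from strict_mono_uniform_limit[OF this r2] show ?thesis by blast
  qed (use h in blast)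
  then show ?case
    using strict_mono_o[OF r1 r2] by (intro exI[of _ "r1 \<circ> r2"]) (simp add: o_def)
qed

lemma common_almost_period_off_module:
  fixes F :: "(real \<Rightarrow> complex) set" and c d :: real
  assumes F: "finite F" "\<And>f. f \<in> F \<Longrightarrow> almost_periodic f"
    and c: "c \<notin> group_closure (\<Union>f\<in>F. {l. bohr_coeff f l \<noteq> 0})" and d: "d > 0"
  obtains t where "\<And>f x. f \<in> F \<Longrightarrow> norm (f (x + t) - f x) < d" "cos (c * t) \<le> 1 / 2"
proof -
  define S where "S = (\<Union>f\<in>F. {l. bohr_coeff f l \<noteq> 0})"
  \<comment> \<open>These sets are finite by Bessel's inequality, increase with \<open>n\<close>,
    and exhaust the frequencies of all functions in \<open>F\<close>.\<close>
  define D where "D n = (\<Union>f\<in>F. {l. inverse (real (Suc n)) \<le> norm (bohr_coeff f l)})" for n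
  have D: "finite (D n)" "D n \<subseteq> group_closure S" for n
  proof -
    show "finite (D n)"
      unfolding D_def by (intro finite_UN_I F(1) finite_large_bohr_coeff F(2)) auto
    have "l \<in> group_closure S" if "l \<in> D n" for l
    proof -
      from that obtain f where f: "f \<in> F" "inverse (real (Suc n)) \<le> norm (bohr_coeff f l)"
        by (auto simp: D_def)
      moreover have "inverse (real (Suc n)) > 0" by simp
      ultimately have "bohr_coeff f l \<noteq> 0" by force
      with f(1) have "l \<in> insert 0 S" by (auto simp: S_def)
      then show ?thesis by (rule group_closure.base)
    qed
    then show "D n \<subseteq> group_closure S" by blast
  qed
  have "\<forall>n. \<exists>t. (\<forall>v\<in>D n. norm (cis (v * t) - 1) < inverse (real (Suc n))) \<and> cos (c * t) \<le> 1 / 2"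
  proof
    fix n
    have pos: "inverse (real (Suc n)) > 0" by simp
    show "\<exists>t. (\<forall>v\<in>D n. norm (cis (v * t) - 1) < inverse (real (Suc n))) \<and> cos (c * t) \<le> 1 / 2"
      by (rule simultaneous_approximation_off_group[OF c[folded S_def] D(1) D(2) pos])
  qed
  from choice[OF this] obtain t
    where t: "\<And>n v. v \<in> D n \<Longrightarrow> norm (cis (v * t n) - 1) < inverse (real (Suc n))"
    "\<And>n. cos (c * t n) \<le> 1 / 2"
    by blast
  obtain r where r: "strict_mono r"
    and lim: "\<And>f. f \<in> F \<Longrightarrow> \<exists>g. uniform_limit UNIV (\<lambda>n x. f (x + t (r n))) g sequentially"
    using almost_periodic_common_subseq[OF F, of t] by blast
  have lim_self: "uniform_limit UNIV (\<lambda>n x. f (x + t (r n))) f sequentially" if f: "f \<in> F" for f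
  proof -
    obtain g where g: "uniform_limit UNIV (\<lambda>n x. f (x + t (r n))) g sequentially"
      using lim[OF f] by blast
    have "bohr_coeff g l = bohr_coeff f l" for l
    proof (cases "bohr_coeff f l = 0")
      case True
      \<comment> \<open>At an \<open>l\<close> that is not a frequency of \<open>f\<close> nothing
        is known about the characters along \<open>t\<close>. Any limit along a further subsequence
        will do, since it is multiplied by 0.\<close>
      obtain z r2 where r2: "strict_mono r2" and z: "((\<lambda>n. cis (l * t (r n))) \<circ> r2) \<longlonglongrightarrow> z"
      proof -
        have "\<And>n. cis (l * t (r n)) \<in> sphere 0 1" by simp
        from this that show ?thesis by (rule sphere_convergent_subseq)
      qed
      have "bohr_coeff g l = z * bohr_coeff f l"
        by (rule bohr_coeff_translate_limit[OF F(2)[OF f] strict_mono_uniform_limit[OF g r2]])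
          (use z in \<open>simp add: o_def\<close>)
      then show ?thesis using True by simp
    next
      case False
      have "(\<lambda>n. cis (l * t (r n))) \<longlonglongrightarrow> 1"
      proof (rule LIMSEQ_I)
        fix e :: real assume "e > 0"
        \<comment> \<open>The minimum serves two ends: from \<open>N\<close> on, \<open>l\<close>
          belongs to \<open>D (r n)\<close>, and the accuracy guaranteed there is better than
          \<open>e\<close>.\<close>
        then have "min e (norm (bohr_coeff f l)) > 0" using False by simp
        then obtain N where N: "inverse (real (Suc N)) < min e (norm (bohr_coeff f l))"
          using reals_Archimedean by blast
        have "norm (cis (l * t (r n)) - 1) < e" if "n \<ge> N" for n
        proof -
          have "r n \<ge> N" using seq_suble[OF r, of n] that by simp
          then have le: "inverse (real (Suc (r n))) \<le> inverse (real (Suc N))"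
            by (intro le_imp_inverse_le) auto
          have "inverse (real (Suc (r n))) \<le> norm (bohr_coeff f l)" using le N by linarith
          then have "l \<in> D (r n)" using f unfolding D_def by blast
          from t(1)[OF this] show ?thesis using le N by linarith
        qed
        then show "\<exists>no. \<forall>n\<ge>no. norm (cis (l * t (r n)) - 1) < e" by blast
      qed
      then show ?thesis
        using bohr_coeff_translate_limit[OF F(2)[OF f] g] by simp
    qed
    then have "g = f"
      by (intro almost_periodic_eqI almost_periodic_uniform_limit[OF F(2)[OF f] g] F(2)[OF f])
    with g show ?thesis by simp
  qed
  have "\<forall>\<^sub>F n in sequentially. \<forall>f\<in>F. \<forall>x\<in>UNIV. dist (f (x + t (r n))) (f x) < d"
    by (intro eventually_ball_finite F(1) ballI uniform_limitD lim_self d)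
  then obtain n where "\<forall>f\<in>F. \<forall>x\<in>UNIV. dist (f (x + t (r n))) (f x) < d"
    by (auto simp: eventually_sequentially)
  with t(2)[of "r n"] that[of "t (r n)"] show thesis by (simp add: dist_norm)
qed

subsection \<open>Planar linear systems\<close>

text \<open>With \<open>u = \<phi>\<close>, \<open>v = p * \<phi>'\<close>, \<open>a = 1 / p\<close>
  and \<open>r = q - l * w\<close> this is the Sturm-Liouville equation, free of derivatives of
  \<open>p\<close>. The matrix of the system has trace zero, so Wronskians of its solutions are
  constant.\<close>

definition linear_system ::
    "(real \<Rightarrow> real) \<Rightarrow> (real \<Rightarrow> real) \<Rightarrow> (real \<Rightarrow> real) \<Rightarrow> (real \<Rightarrow> real) \<Rightarrow> bool" where
  "linear_system a r u v \<longleftrightarrow> (\<forall>x. (u has_real_derivative a x * v x) (at x)) \<and>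
     (\<forall>x. (v has_real_derivative r x * u x) (at x))"

definition energy :: "(real \<Rightarrow> real) \<Rightarrow> (real \<Rightarrow> real) \<Rightarrow> real \<Rightarrow> real" where
  "energy u v x = (u x)\<^sup>2 + (v x)\<^sup>2"

lemma energy_nonneg: "energy u v x \<ge> 0"
  by (simp add: energy_def)

lemma linear_systemD:
  assumes "linear_system a r u v"
  shows "(u has_real_derivative a x * v x) (at x within S)" "(v has_real_derivative r x * u x) (at x within S)"
  using assms by (auto simp: linear_system_def intro: has_field_derivative_at_within)

lemma linear_system_continuous:
  assumes "linear_system a r u v"
  shows "continuous_on S u" "continuous_on S v"
  by (rule DERIV_continuous_on, rule linear_systemD[OF assms])+

lemma energy_continuous:
  assumes "linear_system a r u v"
  shows "continuous_on S (energy u v)"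
  unfolding energy_def[abs_def] by (intro continuous_intros linear_system_continuous[OF assms])

lemma linear_system_combine:
  assumes "linear_system a r u1 v1" "linear_system a r u2 v2"
  shows "linear_system a r (\<lambda>x. c * u1 x + d * u2 x) (\<lambda>x. c * v1 x + d * v2 x)"
  unfolding linear_system_def
  by (auto intro!: derivative_eq_intros linear_systemD[OF assms(1)] linear_systemD[OF assms(2)]
      simp: algebra_simps)

lemma linear_system_shift:
  assumes "linear_system a r u v"
  shows "linear_system (\<lambda>x. a (x + s)) (\<lambda>x. r (x + s)) (\<lambda>x. u (x + s)) (\<lambda>x. v (x + s))"
  unfolding linear_system_def
proof (intro conjI allI)
  fix x
  show "((\<lambda>x. u (x + s)) has_real_derivative a (x + s) * v (x + s)) (at x)"
    using linear_systemD(1)[OF assms, of "x + s" UNIV] unfolding DERIV_shift .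
  show "((\<lambda>x. v (x + s)) has_real_derivative r (x + s) * u (x + s)) (at x)"
    using linear_systemD(2)[OF assms, of "x + s" UNIV] unfolding DERIV_shift .
qed

lemma energy_derivative:
  assumes "linear_system a r u v"
  shows "(energy u v has_real_derivative 2 * (a x + r x) * (u x * v x)) (at x within S)"
  unfolding energy_def[abs_def]
  by (auto intro!: derivative_eq_intros linear_systemD[OF assms] simp: algebra_simps)

text \<open>Gronwall's argument: the energy changes at a rate of at most \<open>2 * B\<close> times
  itself, so its products with \<open>exp (2 * B * x)\<close> and \<open>exp (- (2 * B) * x)\<close>
  are monotone. One serves for \<open>x\<close> to the right of \<open>y\<close>, the other for
  \<open>x\<close> to the left.\<close>

lemma energy_growth:
  assumes sys: "linear_system a r u v" and B: "\<And>x. \<bar>a x\<bar> \<le> B" "\<And>x. \<bar>r x\<bar> \<le> B"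
  shows "energy u v x \<le> energy u v y * exp (2 * B * \<bar>x - y\<bar>)"
proof -
  define e where "e = energy u v"
  have deriv: "(e has_real_derivative 2 * (a x + r x) * (u x * v x)) (at x)" for x
    unfolding e_def by (rule energy_derivative[OF sys])
  have bound: "\<bar>2 * (a x + r x) * (u x * v x)\<bar> \<le> 2 * B * e x" for x
  proof -
    have "2 * (\<bar>u x\<bar> * \<bar>v x\<bar>) \<le> e x"
      using sum_squares_bound[of "\<bar>u x\<bar>" "\<bar>v x\<bar>"] by (simp add: e_def energy_def)
    moreover have "\<bar>a x + r x\<bar> \<le> 2 * B" using B[of x] by linarith
    ultimately have "\<bar>a x + r x\<bar> * (2 * (\<bar>u x\<bar> * \<bar>v x\<bar>)) \<le> 2 * B * e x"
      by (intro mult_mono) (simp_all add: e_def energy_nonneg)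
    moreover have "\<bar>2 * (a x + r x) * (u x * v x)\<bar> = \<bar>a x + r x\<bar> * (2 * (\<bar>u x\<bar> * \<bar>v x\<bar>))"
      by (simp only: abs_mult abs_numeral mult_ac)
    ultimately show ?thesis by (simp only:)
  qed
  show ?thesis
  proof (cases "y \<le> x")
    case True
    have "e x * exp (- (2 * B) * x) \<le> e y * exp (- (2 * B) * y)"
    proof (rule DERIV_nonpos_imp_nonincreasing[OF True])
      fix t
      have "((\<lambda>t. e t * exp (- (2 * B) * t)) has_real_derivative
          (2 * (a t + r t) * (u t * v t) - 2 * B * e t) * exp (- (2 * B) * t)) (at t)"
        by (auto intro!: derivative_eq_intros deriv simp: algebra_simps)
      moreover have "(2 * (a t + r t) * (u t * v t) - 2 * B * e t) * exp (- (2 * B) * t) \<le> 0"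
        using bound[of t] by (intro mult_nonpos_nonneg) auto
      ultimately show "\<exists>d. ((\<lambda>t. e t * exp (- (2 * B) * t)) has_real_derivative d) (at t) \<and> d \<le> 0" by (intro exI conjI)
    qed
    then have "e x * exp (- (2 * B) * x) * exp (2 * B * x) \<le> e y * exp (- (2 * B) * y) * exp (2 * B * x)"
      by (rule mult_right_mono) simp
    then have le: "e x * (exp (- (2 * B) * x) * exp (2 * B * x)) \<le> e y * (exp (- (2 * B) * y) * exp (2 * B * x))"
      by (simp only: mult.assoc)
    have eq: "exp (- (2 * B) * x) * exp (2 * B * x) = 1"
      "exp (- (2 * B) * y) * exp (2 * B * x) = exp (2 * B * \<bar>x - y\<bar>)"
      unfolding exp_add[symmetric] using True by (simp_all add: algebra_simps)
    from le show ?thesis unfolding eq e_def by (simp only: mult_1_right)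
  next
    case False
    then have le: "x \<le> y" by simp
    have "e x * exp (2 * B * x) \<le> e y * exp (2 * B * y)"
    proof (rule DERIV_nonneg_imp_nondecreasing[OF le])
      fix t
      have "((\<lambda>t. e t * exp (2 * B * t)) has_real_derivative
          (2 * (a t + r t) * (u t * v t) + 2 * B * e t) * exp (2 * B * t)) (at t)"
        by (auto intro!: derivative_eq_intros deriv simp: algebra_simps)
      moreover have "(2 * (a t + r t) * (u t * v t) + 2 * B * e t) * exp (2 * B * t) \<ge> 0"
        using bound[of t] by (intro mult_nonneg_nonneg) auto
      ultimately show "\<exists>d. ((\<lambda>t. e t * exp (2 * B * t)) has_real_derivative d) (at t) \<and> 0 \<le> d" by (intro exI conjI)
    qed
    then have "e x * exp (2 * B * x) * exp (- (2 * B) * x) \<le> e y * exp (2 * B * y) * exp (- (2 * B) * x)"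
      by (rule mult_right_mono) simp
    then have le': "e x * (exp (2 * B * x) * exp (- (2 * B) * x)) \<le> e y * (exp (2 * B * y) * exp (- (2 * B) * x))"
      by (simp only: mult.assoc)
    have eq: "exp (2 * B * x) * exp (- (2 * B) * x) = 1"
      "exp (2 * B * y) * exp (- (2 * B) * x) = exp (2 * B * \<bar>x - y\<bar>)"
      unfolding exp_add[symmetric] using le by (simp_all add: algebra_simps)
    from le' show ?thesis unfolding eq e_def by (simp only: mult_1_right)
  qed
qed

lemma energy_pos:
  assumes sys: "linear_system a r u v" and B: "\<And>x. \<bar>a x\<bar> \<le> B" "\<And>x. \<bar>r x\<bar> \<le> B"
    and y: "energy u v y > 0"
  shows "energy u v x > 0"
proof (rule ccontr)
  assume "\<not> energy u v x > 0"
  then have "energy u v x = 0" using energy_nonneg[of u v x] by simp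
  with energy_growth[OF sys B, of y x] y show False by simp
qed

text \<open>This is the point at which closeness of two sets of coefficients enters: all terms but
  those carrying a difference of coefficients cancel.\<close>

lemma wronskian_derivative:
  assumes "linear_system a1 r1 u1 v1" "linear_system a2 r2 u2 v2"
  shows "((\<lambda>x. u1 x * v2 x - v1 x * u2 x) has_real_derivative
    (a1 x - a2 x) * (v1 x * v2 x) + (r2 x - r1 x) * (u1 x * u2 x)) (at x within S)"
  by (auto intro!: derivative_eq_intros linear_systemD[OF assms(1)] linear_systemD[OF assms(2)]
      simp: algebra_simps)

lemma wronskian_constant:
  assumes "linear_system a r u1 v1" "linear_system a r u2 v2"
  shows "u1 x * v2 x - v1 x * u2 x = u1 y * v2 y - v1 y * u2 y"
proof -
  have "\<forall>x. ((\<lambda>x. u1 x * v2 x - v1 x * u2 x) has_real_derivative 0) (at x)"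
    using wronskian_derivative[OF assms, of _ UNIV] by simp
  from DERIV_isconst_all[OF this, of x y] show ?thesis .
qed

section \<open>Existence of solutions by Picard iteration\<close>

lemma antiderivative_exists:
  fixes g :: "real \<Rightarrow> real"
  assumes "continuous_on UNIV g"
  shows "\<exists>G. G 0 = 0 \<and> (\<forall>x. (G has_real_derivative g x) (at x))"
proof -
  have "\<exists>F. \<forall>x. -\<infinity> < ereal x \<longrightarrow> ereal x < \<infinity> \<longrightarrow> (F has_vector_derivative g x) (at x)"
    using assms by (intro einterval_antiderivative) (auto simp: continuous_on_eq_continuous_at)
  then obtain F where F: "\<And>x. (F has_real_derivative g x) (at x)"
    by (auto simp: has_real_derivative_iff_has_vector_derivative)
  then have "((\<lambda>x. F x - F 0) has_real_derivative g x) (at x)" for x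
    by (auto intro!: derivative_eq_intros)
  then show ?thesis by (intro exI[of _ "\<lambda>x. F x - F 0"]) simp
qed

text \<open>\<open>G\<close> is compared with the antiderivative of the bound. The division by
  \<open>Suc n\<close> at every integration produces the factorials in the Picard series.\<close>

lemma antiderivative_power_bound_nonneg:
  fixes G g :: "real \<Rightarrow> real"
  assumes G: "G 0 = 0" "\<And>x. (G has_real_derivative g x) (at x)"
    and g: "\<And>x. x \<ge> 0 \<Longrightarrow> \<bar>g x\<bar> \<le> K * x ^ n" and x: "x \<ge> 0"
  shows "\<bar>G x\<bar> \<le> K * x ^ Suc n / real (Suc n)"
proof -
  define Y where "Y x = K * x ^ Suc n / real (Suc n)" for x
  have dY: "(Y has_real_derivative K * t ^ n) (at t)" for t
  proof -
    have "(Y has_real_derivative (K * (real (Suc n) * t ^ n) / real (Suc n))) (at t)"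
      unfolding Y_def[abs_def] by (intro DERIV_cdivide DERIV_cmult) (use DERIV_pow[of "Suc n" t] in simp)
    moreover have "K * (real (Suc n) * t ^ n) / real (Suc n) = K * t ^ n"
      by (simp del: of_nat_Suc)
    ultimately show ?thesis by simp
  qed
  have "Y 0 + c * G 0 \<le> Y x + c * G x" if "\<bar>c\<bar> = 1" for c
  proof (rule DERIV_nonneg_imp_nondecreasing[OF x])
    fix t assume "0 \<le> t" "t \<le> x"
    then have "\<bar>c * g t\<bar> \<le> K * t ^ n" using g[of t] that by (simp add: abs_mult)
    then have "0 \<le> K * t ^ n + c * g t" by linarith
    with DERIV_add[OF dY DERIV_cmult[OF G(2)[of t], of c]]
    show "\<exists>y. ((\<lambda>x. Y x + c * G x) has_real_derivative y) (at t) \<and> 0 \<le> y"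
      by (intro exI conjI)
  qed
  from this[of 1] this[of "- 1"] have "- G x \<le> Y x" "G x \<le> Y x"
    using G(1) by (simp_all add: Y_def)
  then show ?thesis unfolding Y_def by (simp only: abs_le_iff)
qed

lemma antiderivative_power_bound:
  fixes G g :: "real \<Rightarrow> real"
  assumes G: "G 0 = 0" "\<And>x. (G has_real_derivative g x) (at x)"
    and g: "\<And>x. \<bar>g x\<bar> \<le> K * \<bar>x\<bar> ^ n"
  shows "\<bar>G x\<bar> \<le> K * \<bar>x\<bar> ^ Suc n / real (Suc n)"
proof (cases "x \<ge> 0")
  case True
  have "\<bar>g x\<bar> \<le> K * x ^ n" if "x \<ge> 0" for x using g[of x] that by simp
  from antiderivative_power_bound_nonneg[OF G this True] True show ?thesis by simp
next
  case False
  have d: "((\<lambda>x. G (- x)) has_real_derivative - g (- x)) (at x)" for x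
  proof -
    have "((\<lambda>x. G (- x)) has_real_derivative g (- x) * - 1) (at x)"
      by (rule DERIV_chain2[OF G(2)]) (auto intro!: derivative_eq_intros)
    then show ?thesis by simp
  qed
  have b: "\<bar>- g (- x)\<bar> \<le> K * x ^ n" if "x \<ge> 0" for x using g[of "- x"] that by simp
  have "\<bar>G (- (- x))\<bar> \<le> K * (- x) ^ Suc n / real (Suc n)"
    by (rule antiderivative_power_bound_nonneg[of "\<lambda>x. G (- x)", OF _ d b]) (use G(1) False in auto)
  then show ?thesis using False by simp
qed

text \<open>\<open>\<alpha> n\<close> and \<open>\<beta> n\<close> are the n-th terms of the Picard
  series, not its partial sums: each arises from the previous term of the other component by
  integration against a coefficient. The bound \<open>C * (B * |x|) ^ n / fact n\<close> allows
  termwise differentiation on bounded intervals, and all terms with \<open>n > 0\<close> vanish at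
  0, which gives the initial values.\<close>

lemma linear_system_exists:
  fixes a r :: "real \<Rightarrow> real"
  assumes ca: "continuous_on UNIV a" and cr: "continuous_on UNIV r"
    and Ba: "\<And>x. \<bar>a x\<bar> \<le> B" and Br: "\<And>x. \<bar>r x\<bar> \<le> B"
  obtains u v where "linear_system a r u v" "u 0 = u0" "v 0 = v0"
proof -
  have B: "B \<ge> 0" using Ba[of 0] by linarith
  \<comment> \<open>Choosing an antiderivative that vanishes at 0 for every continuous function
    yields an operator \<open>I\<close>, so that the iteration becomes a function power.\<close>
  have "\<forall>g. \<exists>G. continuous_on UNIV g \<longrightarrow> G 0 = 0 \<and> (\<forall>x. (G has_real_derivative g x) (at x))"
    using antiderivative_exists by blast
  from choice[OF this] obtain I :: "(real \<Rightarrow> real) \<Rightarrow> real \<Rightarrow> real"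
    where I0: "\<forall>g. continuous_on UNIV g \<longrightarrow> I g 0 = 0 \<and> (\<forall>x. (I g has_real_derivative g x) (at x))"
    by (rule exE)
  have I: "I g 0 = 0" "(I g has_real_derivative g x) (at x)" if "continuous_on UNIV g" for g x
    using I0[THEN spec, of g] that by blast+
  define P where "P z = (I (\<lambda>x. a x * snd z x), I (\<lambda>x. r x * fst z x))" for z :: "(real \<Rightarrow> real) \<times> (real \<Rightarrow> real)"
  define s where "s n = (P ^^ n) (\<lambda>_. u0, \<lambda>_. v0)" for n
  define \<alpha> where "\<alpha> n = fst (s n)" for n
  define \<beta> where "\<beta> n = snd (s n)" for n
  have zero: "\<alpha> 0 = (\<lambda>_. u0)" "\<beta> 0 = (\<lambda>_. v0)"
    by (simp_all add: \<alpha>_def \<beta>_def s_def)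
  have step: "\<alpha> (Suc n) = I (\<lambda>x. a x * \<beta> n x)" "\<beta> (Suc n) = I (\<lambda>x. r x * \<alpha> n x)" for n
    by (simp_all add: \<alpha>_def \<beta>_def s_def P_def)
  have cont: "continuous_on UNIV (\<alpha> n) \<and> continuous_on UNIV (\<beta> n)" for n
  proof (induction n)
    case (Suc n)
    have cI: "continuous_on UNIV (I g)" if "continuous_on UNIV g" for g
      by (rule DERIV_continuous_on[OF I(2)[OF that]])
    show ?case unfolding step
      by (intro conjI cI continuous_on_mult ca cr conjunct1[OF Suc] conjunct2[OF Suc])
  qed (simp add: zero)
  have ca': "continuous_on UNIV (\<lambda>x. a x * \<beta> n x)" and cr': "continuous_on UNIV (\<lambda>x. r x * \<alpha> n x)" for n
    by (intro continuous_on_mult ca cr conjunct1[OF cont] conjunct2[OF cont])+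
  have at0: "\<alpha> (Suc n) 0 = 0" "\<beta> (Suc n) 0 = 0" for n
    unfolding step by (rule I(1)[OF ca'] I(1)[OF cr'])+
  have d\<alpha>: "(\<alpha> (Suc n) has_real_derivative a x * \<beta> n x) (at x)" for n x
    unfolding step by (rule I(2)[OF ca'])
  have d\<beta>: "(\<beta> (Suc n) has_real_derivative r x * \<alpha> n x) (at x)" for n x
    unfolding step by (rule I(2)[OF cr'])
  define C where "C = \<bar>u0\<bar> + \<bar>v0\<bar>"
  have bound: "\<bar>\<alpha> n x\<bar> \<le> C * B ^ n / fact n * \<bar>x\<bar> ^ n \<and> \<bar>\<beta> n x\<bar> \<le> C * B ^ n / fact n * \<bar>x\<bar> ^ n" for n x
  proof (induction n arbitrary: x)
    case 0
    then show ?case by (simp add: zero C_def)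
  next
    case (Suc n)
    define K where "K = C * B ^ Suc n / fact n"
    have K: "K * \<bar>x\<bar> ^ Suc n / real (Suc n) = C * B ^ Suc n / fact (Suc n) * \<bar>x\<bar> ^ Suc n"
      by (simp add: K_def field_simps)
    have le: "\<bar>c * g\<bar> \<le> K * \<bar>x\<bar> ^ n"
      if "\<bar>c\<bar> \<le> B" "\<bar>g\<bar> \<le> C * B ^ n / fact n * \<bar>x\<bar> ^ n" for c g x :: real
    proof -
      have "\<bar>c\<bar> * \<bar>g\<bar> \<le> B * (C * B ^ n / fact n * \<bar>x\<bar> ^ n)"
        by (rule mult_mono[OF that B]) simp
      also have "B * (C * B ^ n / fact n * \<bar>x\<bar> ^ n) = K * \<bar>x\<bar> ^ n"
        by (simp add: K_def)
      finally show ?thesis by (simp only: abs_mult)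
    qed
    show ?case
      unfolding K[symmetric]
    proof
      show "\<bar>\<alpha> (Suc n) x\<bar> \<le> K * \<bar>x\<bar> ^ Suc n / real (Suc n)"
        by (rule antiderivative_power_bound[OF at0(1) d\<alpha>]) (rule le[OF Ba conjunct2[OF Suc.IH]])
      show "\<bar>\<beta> (Suc n) x\<bar> \<le> K * \<bar>x\<bar> ^ Suc n / real (Suc n)"
        by (rule antiderivative_power_bound[OF at0(2) d\<beta>]) (rule le[OF Br conjunct1[OF Suc.IH]])
    qed
  qed
  have summ: "summable (\<lambda>n. C * B ^ n / fact n * X ^ n)" for X :: real
  proof -
    have "summable (\<lambda>n. C * (inverse (fact n) * (B * X) ^ n))"
      by (intro summable_mult summable_exp)
    then show ?thesis by (simp add: power_mult_distrib field_simps)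
  qed
  \<comment> \<open>Stated for abstract sequences because the two components of the system play
    symmetric roles.\<close>
  have series: "((\<lambda>x. \<Sum>n. f n x) has_real_derivative c x * (\<Sum>n. g n x)) (at x)"
    if f0: "f 0 = (\<lambda>_. k)" and fS: "\<And>n. f (Suc n) 0 = 0" "\<And>n x. (f (Suc n) has_real_derivative c x * g n x) (at x)"
      and c: "\<And>x. \<bar>c x\<bar> \<le> B" and g: "\<And>n x. \<bar>g n x\<bar> \<le> C * B ^ n / fact n * \<bar>x\<bar> ^ n"
    for f g :: "nat \<Rightarrow> real \<Rightarrow> real" and c k x
  proof -
    define f' where "f' n x = (case n of 0 \<Rightarrow> 0 | Suc m \<Rightarrow> c x * g m x)" for n x
    define R where "R = \<bar>x\<bar> + 1"
    define M where "M n = (case n of 0 \<Rightarrow> 0 | Suc m \<Rightarrow> B * (C * B ^ m / fact m * R ^ m))" for n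
    have 1: "(f n has_field_derivative f' n y) (at y within {-R..R})" for n y
      by (cases n) (auto simp: f'_def f0 intro: has_field_derivative_at_within fS(2))
    have "summable (\<lambda>n. M (Suc n))"
      unfolding M_def nat.case by (rule summable_mult[OF summ])
    then have sM: "summable M" by (rule summable_Suc_iff[THEN iffD1])
    have nb: "norm (f' n y) \<le> M n" if y: "y \<in> {-R..R}" for n y
    proof (cases n)
      case (Suc m)
      have "\<bar>y\<bar> \<le> R" using y by auto
      have "\<bar>g m y\<bar> \<le> C * B ^ m / fact m * \<bar>y\<bar> ^ m" by (rule g)
      also have "\<dots> \<le> C * B ^ m / fact m * R ^ m"
        using \<open>\<bar>y\<bar> \<le> R\<close> B by (intro mult_left_mono power_mono) (auto simp: C_def)
      finally have "\<bar>c y\<bar> * \<bar>g m y\<bar> \<le> B * (C * B ^ m / fact m * R ^ m)"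
        using c[of y] B by (intro mult_mono) auto
      then show ?thesis by (simp add: Suc f'_def M_def abs_mult)
    qed (simp add: f'_def M_def)
    have 2: "uniformly_convergent_on {-R..R} (\<lambda>n y. \<Sum>i<n. f' i y)"
      by (rule Weierstrass_m_test'[OF nb sM])
    have "summable (\<lambda>n. f (Suc n) 0)" by (simp add: fS(1))
    then have 3: "summable (\<lambda>n. f n 0)" by (rule summable_Suc_iff[THEN iffD1])
    have "((\<lambda>x. \<Sum>n. f n x) has_field_derivative (\<Sum>n. f' n x)) (at x)"
      by (rule has_field_derivative_series'(2)[OF convex_real_interval(5) 1 2 _ 3])
        (auto simp: R_def interior_atLeastAtMost_real)
    moreover have sg: "summable (\<lambda>n. g n x)"
      by (rule summable_comparison_test'[OF summ[of "\<bar>x\<bar>"], of 0]) (simp only: real_norm_def g)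
    moreover have "(\<Sum>n. f' n x) = c x * (\<Sum>n. g n x)"
    proof -
      have "summable (\<lambda>n. f' (Suc n) x)" unfolding f'_def nat.case by (rule summable_mult[OF sg])
      then have "summable (\<lambda>n. f' n x)" by (rule summable_Suc_iff[THEN iffD1])
      from suminf_split_head[OF this] have "(\<Sum>n. f' n x) = (\<Sum>n. f' (Suc n) x)"
        by (simp add: f'_def)
      also have "\<dots> = c x * (\<Sum>n. g n x)" unfolding f'_def nat.case by (rule suminf_mult[OF sg])
      finally show ?thesis .
    qed
    ultimately show ?thesis by simp
  qed
  define u where "u x = (\<Sum>n. \<alpha> n x)" for x
  define v where "v x = (\<Sum>n. \<beta> n x)" for x
  have du: "(u has_real_derivative a x * v x) (at x)" for x
    unfolding u_def[abs_def] v_def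
    by (rule series[OF zero(1) at0(1) d\<alpha> Ba conjunct2[OF bound]])
  have dv: "(v has_real_derivative r x * u x) (at x)" for x
    unfolding u_def v_def[abs_def]
    by (rule series[OF zero(2) at0(2) d\<beta> Br conjunct1[OF bound]])
  have u0: "u 0 = u0"
  proof -
    have "\<alpha> n 0 = 0" if "n \<notin> {0}" for n using that at0(1) by (cases n) auto
    then have "(\<Sum>n. \<alpha> n 0) = (\<Sum>n\<in>{0}. \<alpha> n 0)" by (intro suminf_finite) auto
    then show ?thesis by (simp add: u_def zero)
  qed
  have v0: "v 0 = v0"
  proof -
    have "\<beta> n 0 = 0" if "n \<notin> {0}" for n using that at0(2) by (cases n) auto
    then have "(\<Sum>n. \<beta> n 0) = (\<Sum>n\<in>{0}. \<beta> n 0)" by (intro suminf_finite) auto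
    then show ?thesis by (simp add: v_def zero)
  qed
  have "linear_system a r u v"
    unfolding linear_system_def using du dv by blast
  from this u0 v0 show thesis by (rule that)
qed

section \<open>Solutions decaying at plus infinity\<close>

lemma integral_energy_mono:
  assumes sys: "linear_system a r u v" and le: "s \<le> x" "x \<le> t"
  shows "integral {s..x} (energy u v) \<le> integral {s..t} (energy u v)"
  using le by (intro integral_subset_le integrable_continuous_real energy_continuous[OF sys])
    (auto simp: energy_nonneg)

text \<open>Otherwise \<open>f\<close> would stay above \<open>e\<close> from some point on and its
  integral would grow linearly.\<close>

lemma frequently_small_of_bounded_integral:
  fixes f :: "real \<Rightarrow> real"
  assumes cont: "continuous_on UNIV f" and nonneg: "\<And>x. f x \<ge> 0"
    and bound: "\<And>X. X \<ge> s \<Longrightarrow> integral {s..X} f \<le> C" and e: "e > 0"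
  obtains t where "t \<ge> X0" "t \<ge> s" "f t \<le> e"
proof (rule ccontr)
  assume nt: "\<not> thesis"
  note found = that
  define a where "a = max s X0"
  have big: "f t \<ge> e" if "t \<ge> a" for t
  proof (rule ccontr)
    assume "\<not> f t \<ge> e"
    then have "f t \<le> e" by simp
    with found[of t] that nt show False by (simp add: a_def)
  qed
  have int: "f integrable_on {x..y}" for x y
    by (intro integrable_continuous_real continuous_on_subset[OF cont]) auto
  define X where "X = a + (\<bar>C\<bar> + 1) / e"
  have aX: "a \<le> X" "s \<le> X" "s \<le> a" using e by (auto simp: X_def a_def add_increasing2)
  have "(\<bar>C\<bar> + 1) = e * (X - a)" using e by (simp add: X_def)
  also have "\<dots> = integral {a..X} (\<lambda>_. e)" using aX by simp
  also have "\<dots> \<le> integral {a..X} f"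
    by (intro integral_le int) (auto simp: big)
  also have "\<dots> \<le> integral {s..X} f"
    using aX by (intro integral_subset_le int) (auto simp: nonneg)
  also have "\<dots> \<le> C" by (rule bound[OF aX(2)])
  finally show False by linarith
qed

text \<open>\<open>(U t, V t)\<close> is the image of the unit vector at angle \<open>t\<close>, and
  \<open>(U' t, V' t)\<close> that of the unit vector orthogonal to it. At an angle where the images
  are orthogonal, the product of their squared lengths is the squared determinant, which is 1, so
  one of the lengths is at most 1. Such an angle exists because the inner product \<open>h\<close>
  changes sign under a quarter turn.\<close>

lemma unit_vector_minimizing_quadratic:
  fixes p1 q1 p2 q2 :: real
  assumes det: "p1 * q2 - q1 * p2 = 1"
  obtains c s :: real where "c\<^sup>2 + s\<^sup>2 = 1" "(c * p1 + s * p2)\<^sup>2 + (c * q1 + s * q2)\<^sup>2 \<le> 1"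
proof -
  define U where "U t = cos t * p1 + sin t * p2" for t
  define V where "V t = cos t * q1 + sin t * q2" for t
  define U' where "U' t = - sin t * p1 + cos t * p2" for t
  define V' where "V' t = - sin t * q1 + cos t * q2" for t
  define h where "h t = U t * U' t + V t * V' t" for t
  have "isCont h t" for t
    unfolding h_def U_def V_def U'_def V'_def by (intro continuous_intros)
  moreover have "h (pi / 2) = - h 0"
    by (simp add: h_def U_def V_def U'_def V'_def)
  ultimately have "\<exists>t. h t = 0"
  proof (cases "h 0 \<le> 0")
    case True
    then show ?thesis
      using IVT[of h 0 0 "pi / 2"] \<open>h (pi / 2) = - h 0\<close> \<open>\<And>t. isCont h t\<close> by auto
  next
    case False
    then show ?thesis
      using IVT2[of h "pi / 2" 0 0] \<open>h (pi / 2) = - h 0\<close> \<open>\<And>t. isCont h t\<close> by auto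
  qed
  then obtain t where t: "h t = 0" by blast
  have sc: "cos t * cos t + sin t * sin t = 1"
    using sin_cos_squared_add[of t] by (simp add: power2_eq_square algebra_simps)
  have "U t * V' t - V t * U' t = (cos t * cos t + sin t * sin t) * (p1 * q2 - q1 * p2)"
  proof -
    have "(C * p1 + S * p2) * (- S * q1 + C * q2) - (C * q1 + S * q2) * (- S * p1 + C * p2)
        = (C * C + S * S) * (p1 * q2 - q1 * p2)" for C S
      by (simp add: algebra_simps)
    then show ?thesis unfolding U_def V_def U'_def V'_def .
  qed
  then have d: "U t * V' t - V t * U' t = 1" by (simp only: sc det)
  have "((U t)\<^sup>2 + (V t)\<^sup>2) * ((U' t)\<^sup>2 + (V' t)\<^sup>2) = (h t)\<^sup>2 + (U t * V' t - V t * U' t)\<^sup>2"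
    unfolding h_def by (simp add: power2_eq_square algebra_simps)
  then have prod: "((U t)\<^sup>2 + (V t)\<^sup>2) * ((U' t)\<^sup>2 + (V' t)\<^sup>2) = 1"
    unfolding t d by simp
  show thesis
  proof (cases "(U t)\<^sup>2 + (V t)\<^sup>2 \<le> 1")
    case True
    then show thesis
      by (intro that[of "cos t" "sin t"]) (simp_all add: U_def V_def)
  next
    case False
    have "(U' t)\<^sup>2 + (V' t)\<^sup>2 \<le> 1"
    proof (rule ccontr)
      assume "\<not> (U' t)\<^sup>2 + (V' t)\<^sup>2 \<le> 1"
      then have "1 < ((U t)\<^sup>2 + (V t)\<^sup>2) * ((U' t)\<^sup>2 + (V' t)\<^sup>2)"
        using False by (intro less_1_mult) auto
      with prod show False by simp
    qed
    then show thesis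
      by (intro that[of "- sin t" "cos t"]) (simp_all add: U'_def V'_def)
  qed
qed

text \<open>The hypothesis is what remains of the boundedness of the resolvent. Solutions that have not grown
  by time \<open>n\<close> exist because the transfer matrix has determinant one; a limit of them decays.\<close>

lemma decaying_solution_exists:
  assumes ca: "continuous_on UNIV a" and cr: "continuous_on UNIV r"
    and B: "\<And>x. \<bar>a x\<bar> \<le> B" "\<And>x. \<bar>r x\<bar> \<le> B"
    and K: "\<And>u v s t. linear_system a r u v \<Longrightarrow> s \<le> t \<Longrightarrow>
      integral {s..t} (energy u v) \<le> K * (energy u v s + energy u v t)"
  obtains u v where "linear_system a r u v" "energy u v 0 = 1"
    "\<And>s X. s \<le> X \<Longrightarrow> integral {s..X} (energy u v) \<le> K * energy u v s"
proof -
  obtain u1 v1 where s1: "linear_system a r u1 v1" "u1 0 = 1" "v1 0 = 0"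
    by (rule linear_system_exists[OF ca cr B])
  obtain u2 v2 where s2: "linear_system a r u2 v2" "u2 0 = 0" "v2 0 = 1"
    by (rule linear_system_exists[OF ca cr B])
  \<comment> \<open>The complex number \<open>z\<close> encodes the initial values at 0; solutions
    of energy 1 at 0 correspond to the unit circle, which is compact.\<close>
  define U where "U z = (\<lambda>x. Re z * u1 x + Im z * u2 x)" for z
  define V where "V z = (\<lambda>x. Re z * v1 x + Im z * v2 x)" for z
  have sys: "linear_system a r (U z) (V z)" for z
    unfolding U_def V_def by (rule linear_system_combine[OF s1(1) s2(1)])
  have U0: "U z 0 = Re z" "V z 0 = Im z" for z
    using s1 s2 by (auto simp: U_def V_def)
  have e0: "energy (U z) (V z) 0 = 1" if "z \<in> sphere 0 1" for z
  proof -
    have "(Re z)\<^sup>2 + (Im z)\<^sup>2 = (cmod z)\<^sup>2" by (simp add: cmod_power2)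
    also have "\<dots> = 1" using that by simp
    finally show ?thesis by (simp add: energy_def U0)
  qed
  have "\<exists>z\<in>sphere 0 1. energy (U z) (V z) (real n) \<le> 1" for n
  proof -
    have "u1 (real n) * v2 (real n) - v1 (real n) * u2 (real n) = 1"
      using wronskian_constant[OF s1(1) s2(1), of "real n" 0] s1 s2 by simp
    from unit_vector_minimizing_quadratic[OF this] obtain c s where cs: "c\<^sup>2 + s\<^sup>2 = 1"
      "(c * u1 (real n) + s * u2 (real n))\<^sup>2 + (c * v1 (real n) + s * v2 (real n))\<^sup>2 \<le> 1"
      by blast
    show ?thesis
    proof (rule bexI)
      show "energy (U (Complex c s)) (V (Complex c s)) (real n) \<le> 1"
        using cs(2) by (simp add: energy_def U_def V_def)
      show "Complex c s \<in> sphere 0 1"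
        using cs(1) by (simp add: cmod_def)
    qed
  qed
  then have "\<forall>n. \<exists>z. z \<in> sphere 0 1 \<and> energy (U z) (V z) (real n) \<le> 1" by blast
  from choice[OF this] obtain z where z: "\<And>n. z n \<in> sphere 0 1"
    "\<And>n. energy (U (z n)) (V (z n)) (real n) \<le> 1" by blast
  obtain l k where l: "l \<in> sphere 0 1" and k: "strict_mono k" and lim: "(z \<circ> k) \<longlonglongrightarrow> l"
    by (rule sphere_convergent_subseq[OF z(1)])
  have lim': "(\<lambda>n. z (k n)) \<longlonglongrightarrow> l" using lim by (simp add: o_def)
  have Kpos: "0 \<le> K"
  proof -
    have "0 \<le> integral {0..0} (energy (U l) (V l))" by simp
    also have "\<dots> \<le> K * (energy (U l) (V l) 0 + energy (U l) (V l) 0)"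
      by (rule K[OF sys]) simp
    finally show ?thesis using e0[OF l] by simp
  qed
  have bound: "integral {0..X} (energy (U l) (V l)) \<le> 2 * K" if X: "X \<ge> 0" for X
  proof -
    define I11 where "I11 = integral {0..X} (\<lambda>x. (u1 x)\<^sup>2 + (v1 x)\<^sup>2)"
    define I12 where "I12 = integral {0..X} (\<lambda>x. u1 x * u2 x + v1 x * v2 x)"
    define I22 where "I22 = integral {0..X} (\<lambda>x. (u2 x)\<^sup>2 + (v2 x)\<^sup>2)"
    note c = linear_system_continuous[OF s1(1)] linear_system_continuous[OF s2(1)]
    \<comment> \<open>The energy over a fixed interval is a quadratic form in the initial values, so
      it passes to the limit along \<open>z (k n)\<close>.\<close>
    have E: "integral {0..X} (energy (U y) (V y)) = (Re y)\<^sup>2 * I11 + 2 * Re y * Im y * I12 + (Im y)\<^sup>2 * I22" for y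
    proof -
      have "energy (U y) (V y) = (\<lambda>x. ((Re y)\<^sup>2 * ((u1 x)\<^sup>2 + (v1 x)\<^sup>2) + 2 * Re y * Im y * (u1 x * u2 x + v1 x * v2 x))
          + (Im y)\<^sup>2 * ((u2 x)\<^sup>2 + (v2 x)\<^sup>2))"
        by (rule ext) (simp add: energy_def U_def V_def power2_eq_square algebra_simps)
      moreover have "((\<lambda>x. ((Re y)\<^sup>2 * ((u1 x)\<^sup>2 + (v1 x)\<^sup>2) + 2 * Re y * Im y * (u1 x * u2 x + v1 x * v2 x))
          + (Im y)\<^sup>2 * ((u2 x)\<^sup>2 + (v2 x)\<^sup>2)) has_integral
          ((Re y)\<^sup>2 * I11 + 2 * Re y * Im y * I12) + (Im y)\<^sup>2 * I22) {0..X}"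
        unfolding I11_def I12_def I22_def
        by (intro has_integral_add has_integral_mult_right integrable_integral
            integrable_continuous_real continuous_intros c)
      ultimately show ?thesis by (simp add: integral_unique)
    qed
    have limE: "(\<lambda>n. integral {0..X} (energy (U (z (k n))) (V (z (k n))))) \<longlonglongrightarrow> integral {0..X} (energy (U l) (V l))"
      unfolding E by (intro tendsto_intros lim')
    \<comment> \<open>As soon as \<open>X \<le> k n\<close>, the hypothesis on
      \<open>{0..k n}\<close> applies, and the energy is at most 1 at both ends of that
      interval.\<close>
    have nb: "integral {0..X} (energy (U (z (k n))) (V (z (k n)))) \<le> 2 * K" if n: "n \<ge> nat \<lceil>X\<rceil>" for n
    proof -
      have "k n \<ge> n" using seq_suble[OF k] .
      then have Xk: "X \<le> real (k n)" using n by linarith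
      have "integral {0..X} (energy (U (z (k n))) (V (z (k n)))) \<le> integral {0..real (k n)} (energy (U (z (k n))) (V (z (k n))))"
        by (rule integral_energy_mono[OF sys X Xk])
      also have "\<dots> \<le> K * (energy (U (z (k n))) (V (z (k n))) 0 + energy (U (z (k n))) (V (z (k n))) (real (k n)))"
        by (rule K[OF sys]) simp
      also have "\<dots> \<le> K * (1 + 1)"
        using e0[OF z(1)[of "k n"]] z(2)[of "k n"] Kpos by (intro mult_left_mono) auto
      finally show ?thesis by simp
    qed
    show ?thesis
      by (rule tendsto_upperbound[OF limE eventually_sequentiallyI[of "nat \<lceil>X\<rceil>", OF nb]]) simp_all
  qed
  \<comment> \<open>A finite total energy on the half-line provides late times \<open>t\<close> of
    small energy, so the contribution of the right end point can be made to disappear.\<close>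
  have final: "integral {s..X} (energy (U l) (V l)) \<le> K * energy (U l) (V l) s" if sX: "s \<le> X" for s X
  proof (rule field_le_epsilon)
    fix e :: real assume e: "e > 0"
    have e': "e / (K + 1) > 0" using e Kpos by simp
    obtain t where t: "t \<ge> X" "t \<ge> 0" "energy (U l) (V l) t \<le> e / (K + 1)"
      by (rule frequently_small_of_bounded_integral[OF energy_continuous[OF sys] energy_nonneg bound e'])
    have "integral {s..X} (energy (U l) (V l)) \<le> integral {s..t} (energy (U l) (V l))"
      by (rule integral_energy_mono[OF sys sX t(1)])
    also have "\<dots> \<le> K * (energy (U l) (V l) s + energy (U l) (V l) t)"
      using sX t(1) by (intro K[OF sys]) simp
    also have "\<dots> = K * energy (U l) (V l) s + K * energy (U l) (V l) t" by (simp only: distrib_left)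
    also have "K * energy (U l) (V l) t \<le> e"
    proof -
      have "K * energy (U l) (V l) t \<le> (K + 1) * (e / (K + 1))"
        using t(3) Kpos by (intro mult_mono) (auto simp: energy_nonneg)
      then show ?thesis using Kpos by simp
    qed
    finally show "integral {s..X} (energy (U l) (V l)) \<le> K * energy (U l) (V l) s + e" by simp
  qed
  show thesis by (rule that[OF sys e0[OF l] final])
qed

text \<open>The boundary term at a late point \<open>X\<close> disappears because the sum of the two
  energies dominates the Wronskian and has a finite integral. The square root on the right is the
  product of the amplitudes at \<open>x\<close>, the factor by which the Wronskian differs from the
  sine of the phase difference.\<close>

lemma decaying_solutions_close:
  assumes s1: "linear_system a1 r1 u1 v1" and s2: "linear_system a2 r2 u2 v2"
    and D1: "\<And>X. x \<le> X \<Longrightarrow> integral {x..X} (energy u1 v1) \<le> K1 * energy u1 v1 x"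
    and D2: "\<And>X. x \<le> X \<Longrightarrow> integral {x..X} (energy u2 v2) \<le> K2 * energy u2 v2 x"
    and da: "\<And>y. \<bar>a1 y - a2 y\<bar> \<le> d" and dr: "\<And>y. \<bar>r1 y - r2 y\<bar> \<le> d"
    and p1: "energy u1 v1 x > 0" and p2: "energy u2 v2 x > 0"
  shows "\<bar>u1 x * v2 x - v1 x * u2 x\<bar> \<le> d * (K1 + K2) / 2 * sqrt (energy u1 v1 x * energy u2 v2 x)"
proof -
  define W where "W y = u1 y * v2 y - v1 y * u2 y" for y
  define W' where "W' y = (a1 y - a2 y) * (v1 y * v2 y) + (r2 y - r1 y) * (u1 y * u2 y)" for y
  \<comment> \<open>The ratio of the amplitudes at \<open>x\<close>. Weighted by it, the inequality
    of arithmetic and geometric means lets both energies contribute the same quantity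
    \<open>sqrt (energy u1 v1 x * energy u2 v2 x)\<close>, in accordance with the freedom to rescale
    either solution.\<close>
  define k where "k = sqrt (energy u1 v1 x / energy u2 v2 x)"
  define g where "g y = d / 2 * (energy u1 v1 y / k + k * energy u2 v2 y)" for y
  have k: "k > 0" using p1 p2 by (simp add: k_def)
  have d: "d \<ge> 0" using da[of 0] by linarith
  have ek: "energy u1 v1 x / k = sqrt (energy u1 v1 x * energy u2 v2 x)"
    "k * energy u2 v2 x = sqrt (energy u1 v1 x * energy u2 v2 x)"
  proof -
    have "sqrt (energy u1 v1 x) * sqrt (energy u1 v1 x) = energy u1 v1 x"
      "sqrt (energy u2 v2 x) * sqrt (energy u2 v2 x) = energy u2 v2 x"
      using p1 p2 by simp_all
    then show "energy u1 v1 x / k = sqrt (energy u1 v1 x * energy u2 v2 x)"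
      "k * energy u2 v2 x = sqrt (energy u1 v1 x * energy u2 v2 x)"
      using p1 p2 by (simp_all add: k_def real_sqrt_divide real_sqrt_mult field_simps)
  qed
  have dW: "(W has_real_derivative W' y) (at y within S)" for y S
    unfolding W_def[abs_def] W'_def by (rule wronskian_derivative[OF s1 s2])
  have W'_le: "\<bar>W' y\<bar> \<le> g y" for y
  proof -
    have am: "\<bar>p * q\<bar> \<le> (p\<^sup>2 / k + k * q\<^sup>2) / 2" for p q :: real
    proof -
      have "0 \<le> (\<bar>p\<bar> - k * \<bar>q\<bar>)\<^sup>2 / k" using k by simp
      also have "\<dots> = p\<^sup>2 / k + k * q\<^sup>2 - 2 * (\<bar>p\<bar> * \<bar>q\<bar>)"
        using k by (simp add: power2_eq_square field_simps)
      finally show ?thesis by (simp add: abs_mult)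
    qed
    have "\<bar>W' y\<bar> \<le> \<bar>a1 y - a2 y\<bar> * \<bar>v1 y * v2 y\<bar> + \<bar>r2 y - r1 y\<bar> * \<bar>u1 y * u2 y\<bar>"
      unfolding W'_def abs_mult[symmetric] by (rule abs_triangle_ineq)
    also have "\<dots> \<le> d * (((v1 y)\<^sup>2 / k + k * (v2 y)\<^sup>2) / 2) + d * (((u1 y)\<^sup>2 / k + k * (u2 y)\<^sup>2) / 2)"
      using da[of y] dr[of y] d by (intro add_mono mult_mono am) (auto simp: abs_minus_commute)
    also have "\<dots> = g y"
      using k by (simp add: g_def energy_def field_simps)
    finally show ?thesis .
  qed
  have cW': "continuous_on S g" for S
    unfolding g_def[abs_def] using k
    by (intro continuous_intros energy_continuous[OF s1] energy_continuous[OF s2]) auto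
  have step: "\<bar>W x\<bar> \<le> \<bar>W X\<bar> + d * (K1 + K2) / 2 * sqrt (energy u1 v1 x * energy u2 v2 x)" if X: "x \<le> X" for X
  proof -
    have i1: "(W' has_integral (W X - W x)) {x..X}"
      by (rule fundamental_theorem_of_calculus[OF X])
        (simp add: dW flip: has_real_derivative_iff_has_vector_derivative)
    have i2: "(g has_integral (d / 2 * (integral {x..X} (energy u1 v1) / k + k * integral {x..X} (energy u2 v2)))) {x..X}"
      unfolding g_def[abs_def]
      by (intro has_integral_mult_right has_integral_add has_integral_divide integrable_integral
          integrable_continuous_real energy_continuous[OF s1] energy_continuous[OF s2])
    have "W X - W x \<le> d / 2 * (integral {x..X} (energy u1 v1) / k + k * integral {x..X} (energy u2 v2))"
      by (rule has_integral_le[OF i1 i2]) (use W'_le in \<open>simp add: abs_le_iff\<close>)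
    moreover have "- (W X - W x) \<le> d / 2 * (integral {x..X} (energy u1 v1) / k + k * integral {x..X} (energy u2 v2))"
      by (rule has_integral_le[OF has_integral_neg[OF i1] i2]) (use W'_le in \<open>simp add: abs_le_iff\<close>)
    moreover have "d / 2 * (integral {x..X} (energy u1 v1) / k + k * integral {x..X} (energy u2 v2))
        \<le> d / 2 * (K1 * energy u1 v1 x / k + k * (K2 * energy u2 v2 x))"
      using d k D1[OF X] D2[OF X] by (intro mult_left_mono add_mono divide_right_mono) auto
    moreover have "d / 2 * (K1 * energy u1 v1 x / k + k * (K2 * energy u2 v2 x))
        = d * (K1 + K2) / 2 * sqrt (energy u1 v1 x * energy u2 v2 x)"
    proof -
      have "d / 2 * (K1 * energy u1 v1 x / k + k * (K2 * energy u2 v2 x))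
          = d / 2 * (K1 * (energy u1 v1 x / k) + K2 * (k * energy u2 v2 x))" by simp
      also have "\<dots> = d * (K1 + K2) / 2 * sqrt (energy u1 v1 x * energy u2 v2 x)"
        unfolding ek by (simp add: algebra_simps)
      finally show ?thesis .
    qed
    ultimately show ?thesis by linarith
  qed
  show ?thesis
    unfolding W_def[symmetric]
  proof (rule field_le_epsilon)
    fix e :: real assume e: "e > 0"
    have "integral {x..X} (\<lambda>y. energy u1 v1 y + energy u2 v2 y) \<le> K1 * energy u1 v1 x + K2 * energy u2 v2 x"
      if "X \<ge> x" for X
      using D1[OF that] D2[OF that]
      by (subst integral_add) (auto intro!: integrable_continuous_real energy_continuous[OF s1] energy_continuous[OF s2])
    then obtain X where X: "X \<ge> x" "energy u1 v1 X + energy u2 v2 X \<le> e"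
      using frequently_small_of_bounded_integral[of "\<lambda>y. energy u1 v1 y + energy u2 v2 y" x
          "K1 * energy u1 v1 x + K2 * energy u2 v2 x" e x]
        continuous_on_add[OF energy_continuous[OF s1] energy_continuous[OF s2], of UNIV]
        energy_nonneg add_nonneg_nonneg e by metis
    have "\<bar>W X\<bar> \<le> energy u1 v1 X + energy u2 v2 X"
    proof -
      have am: "\<bar>p * q\<bar> \<le> p\<^sup>2 + q\<^sup>2" for p q :: real
      proof -
        have "2 * (\<bar>p\<bar> * \<bar>q\<bar>) \<le> p\<^sup>2 + q\<^sup>2"
          using sum_squares_bound[of "\<bar>p\<bar>" "\<bar>q\<bar>"] by (simp add: mult.assoc)
        moreover have "0 \<le> \<bar>p\<bar> * \<bar>q\<bar>" by simp
        ultimately show ?thesis unfolding abs_mult by linarith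
      qed
      show ?thesis
        using am[of "u1 X" "v2 X"] am[of "v1 X" "u2 X"] by (simp add: W_def energy_def)
    qed
    with X(2) step[OF X(1)]
    show "\<bar>W x\<bar> \<le> d * (K1 + K2) / 2 * sqrt (energy u1 v1 x * energy u2 v2 x) + e" by linarith
  qed
qed

subsection \<open>Consequences of a bounded resolvent\<close>

text \<open>A bridge between the norms in the definition of the spectrum, which are Lebesgue
  integrals over the line, and the integrals over intervals used for solutions.\<close>

lemma compact_support_lebesgue_integral:
  fixes G :: "real \<Rightarrow> real"
  assumes c: "continuous_on UNIV G" and supp: "\<And>x. x \<notin> {s..t} \<Longrightarrow> G x = 0"
  shows "integrable lebesgue G" "integral\<^sup>L lebesgue G = integral {s..t} G"
proof -
  have si: "set_integrable lborel {s..t} G"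
    by (rule borel_integrable_atLeastAtMost'[OF continuous_on_subset[OF c subset_UNIV]])
  have eq: "(\<lambda>x. indicator {s..t} x *\<^sub>R G x) = G"
    using supp by (auto simp: fun_eq_iff indicator_def)
  have mG: "G \<in> borel_measurable lborel"
    using borel_measurable_continuous_onI[OF c] by simp
  have "integrable lborel G" using si unfolding set_integrable_def eq .
  then show "integrable lebesgue G" using integrable_completion[OF mG] by simp
  have "integral\<^sup>L lborel G = integral {s..t} G"
    using set_borel_integral_eq_integral(2)[OF si] unfolding set_lebesgue_integral_def eq .
  then show "integral\<^sup>L lebesgue G = integral {s..t} G" using integral_completion[OF mG] by simp
qed

lemma compact_support_L2:
  fixes g w :: "real \<Rightarrow> real"
  assumes cg: "continuous_on UNIV g" and cw: "continuous_on UNIV w" and w: "\<And>x. w x > 0"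
    and supp: "\<And>x. x \<notin> {s..t} \<Longrightarrow> g x = 0"
  shows "(\<lambda>x. complex_of_real (g x)) \<in> L2 (weighted_measure w)"
    "L2_norm (weighted_measure w) (\<lambda>x. complex_of_real (g x)) = sqrt (integral {s..t} (\<lambda>x. w x * (g x)\<^sup>2))"
proof -
  have mw: "w \<in> borel_measurable lebesgue"
    using borel_measurable_continuous_onI[OF cw] by (simp add: measurable_completion)
  have mg: "(\<lambda>x. complex_of_real (g x)) \<in> borel_measurable lebesgue"
  proof -
    have "continuous_on UNIV (\<lambda>x. complex_of_real (g x))" by (intro continuous_intros cg)
    from borel_measurable_continuous_onI[OF this] show ?thesis by (simp add: measurable_completion)
  qed
  have mg2: "(\<lambda>x. (g x)\<^sup>2) \<in> borel_measurable lebesgue"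
  proof -
    have "continuous_on UNIV (\<lambda>x. (g x)\<^sup>2)" by (intro continuous_intros cg)
    from borel_measurable_continuous_onI[OF this] show ?thesis by (simp add: measurable_completion)
  qed
  have cG: "continuous_on UNIV (\<lambda>x. w x * (g x)\<^sup>2)" by (intro continuous_intros cg cw)
  have sG: "w x * (g x)\<^sup>2 = 0" if "x \<notin> {s..t}" for x using supp that by simp
  note I = compact_support_lebesgue_integral[OF cG sG]
  have AEw: "AE x in lebesgue. 0 \<le> w x" using w by (simp add: less_imp_le)
  have "integrable (weighted_measure w) (\<lambda>x. (g x)\<^sup>2)"
    unfolding weighted_measure_def integrable_density[OF mg2 mw AEw] using I(1) by simp
  then show "(\<lambda>x. complex_of_real (g x)) \<in> L2 (weighted_measure w)"
    using mg by (simp add: L2_def weighted_measure_def)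
  have "integral\<^sup>L (weighted_measure w) (\<lambda>x. (g x)\<^sup>2) = integral {s..t} (\<lambda>x. w x * (g x)\<^sup>2)"
    unfolding weighted_measure_def integral_density[OF mg2 mw AEw] using I(2) by simp
  then show "L2_norm (weighted_measure w) (\<lambda>x. complex_of_real (g x)) = sqrt (integral {s..t} (\<lambda>x. w x * (g x)\<^sup>2))"
    by (simp add: L2_norm_def)
qed

lemma locally_abs_continuous_of_C1:
  fixes f f' :: "real \<Rightarrow> real"
  assumes d: "\<And>x. (f has_real_derivative f' x) (at x)" and c: "continuous_on UNIV f'"
  shows "locally_abs_continuous (\<lambda>x. complex_of_real (f x))"
  unfolding locally_abs_continuous_def abs_continuous_on_interval_def
proof (intro allI impI)
  fix a b e :: real assume e: "e > 0"
  have "bounded (f' ` {a..b})"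
    by (intro compact_imp_bounded compact_continuous_image continuous_on_subset[OF c]) auto
  then obtain L where L: "L > 0" "\<And>x. x \<in> {a..b} \<Longrightarrow> \<bar>f' x\<bar> \<le> L"
    unfolding bounded_pos by auto
  have lip: "norm (complex_of_real (f y) - complex_of_real (f x)) \<le> L * (y - x)" if "a \<le> x" "x \<le> y" "y \<le> b" for x y
  proof -
    have "(f' has_integral (f y - f x)) {x..y}"
      by (rule fundamental_theorem_of_calculus[OF that(2)])
        (use has_field_derivative_at_within[OF d] in \<open>simp flip: has_real_derivative_iff_has_vector_derivative\<close>)
    then have "f y - f x = integral {x..y} f'" by (simp add: integral_unique)
    also have "norm \<dots> \<le> L * (y - x)"
      using L(2) that by (intro integral_bound continuous_on_subset[OF c]) auto
    finally show ?thesis using that by (simp flip: of_real_diff)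
  qed
  show "\<exists>d>0. \<forall>(n::nat) u v. (\<forall>k<n. a \<le> u k \<and> u k \<le> v k \<and> v k \<le> b) \<and>
      disjoint_family_on (\<lambda>k. {u k<..<v k}) {..<n} \<and> (\<Sum>k<n. v k - u k) < d \<longrightarrow>
      (\<Sum>k<n. norm (complex_of_real (f (v k)) - complex_of_real (f (u k)))) < e"
  proof (intro exI[of _ "e / L"] conjI allI impI)
    show "e / L > 0" using e L(1) by simp
    fix n :: nat and u v :: "nat \<Rightarrow> real"
    assume A: "(\<forall>k<n. a \<le> u k \<and> u k \<le> v k \<and> v k \<le> b) \<and>
      disjoint_family_on (\<lambda>k. {u k<..<v k}) {..<n} \<and> (\<Sum>k<n. v k - u k) < e / L"
    have "(\<Sum>k<n. norm (complex_of_real (f (v k)) - complex_of_real (f (u k)))) \<le> (\<Sum>k<n. L * (v k - u k))"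
    proof (rule sum_mono)
      fix k assume "k \<in> {..<n}"
      then have "a \<le> u k" "u k \<le> v k" "v k \<le> b" using A by auto
      then show "norm (complex_of_real (f (v k)) - complex_of_real (f (u k))) \<le> L * (v k - u k)" by (rule lip)
    qed
    also have "\<dots> = L * (\<Sum>k<n. v k - u k)" by (simp add: sum_distrib_left)
    also have "\<dots> < L * (e / L)" using A L(1) by (intro mult_strict_left_mono) auto
    also have "\<dots> = e" using L(1) by simp
    finally show "(\<Sum>k<n. norm (complex_of_real (f (v k)) - complex_of_real (f (u k)))) < e" .
  qed
qed

text \<open>Since \<open>\<eta>' = \<psi> / p\<close> with \<open>\<psi>\<close> continuously
  differentiable, the quasi-derivative of \<open>\<eta> * u\<close> is
  \<open>\<eta> * v + \<psi> * u\<close>, which is differentiable although \<open>p\<close> is only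
  continuous. The function \<open>k\<close> collects the terms in which the cut-off has been
  differentiated; it vanishes wherever \<open>\<eta>\<close> is locally constant.\<close>

lemma test_function_in_domain:
  fixes p q w u v \<eta> \<psi> \<xi> :: "real \<Rightarrow> real"
  assumes cp: "continuous_on UNIV p" and cq: "continuous_on UNIV q" and cw: "continuous_on UNIV w"
    and p: "\<And>x. p x > 0" and w: "\<And>x. w x > 0"
    and sys: "linear_system (\<lambda>x. 1 / p x) (\<lambda>x. q x - l * w x) u v"
    and d\<eta>: "\<And>x. (\<eta> has_real_derivative 1 / p x * \<psi> x) (at x)"
    and d\<psi>: "\<And>x. (\<psi> has_real_derivative \<xi> x) (at x)" and c\<xi>: "continuous_on UNIV \<xi>"
    and supp: "\<forall>x. x \<notin> {s..t} \<longrightarrow> \<eta> x = 0 \<and> \<psi> x = 0 \<and> \<xi> x = 0"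
  defines "k \<equiv> \<lambda>x. - (2 * (1 / p x) * \<psi> x * v x + \<xi> x * u x) / w x"
  shows "(\<lambda>x. complex_of_real (\<eta> x * u x)) \<in> SL_domain p q w"
    "SL_op p q w (\<lambda>x. complex_of_real (\<eta> x * u x)) = (\<lambda>x. complex_of_real (l * (\<eta> x * u x) + k x))"
    "continuous_on UNIV k" "\<And>x. x \<notin> {s..t} \<Longrightarrow> k x = 0"
    "continuous_on UNIV \<eta>"
proof -
  note cu = linear_system_continuous[OF sys]
  have c\<eta>: "continuous_on UNIV \<eta>" and c\<psi>: "continuous_on UNIV \<psi>"
    by (rule DERIV_continuous_on[OF d\<eta>], rule DERIV_continuous_on[OF d\<psi>])
  have p0: "p x \<noteq> 0" and w0: "w x \<noteq> 0" for x using p[of x] w[of x] by simp_all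
  define g where "g x = \<eta> x * v x + \<psi> x * u x" for x
  define g' where "g' x = \<eta> x * ((q x - l * w x) * u x) + (2 * (1 / p x) * \<psi> x * v x + \<xi> x * u x)" for x
  have df: "((\<lambda>x. \<eta> x * u x) has_real_derivative 1 / p x * g x) (at x)" for x
    using DERIV_mult[OF d\<eta>[of x] linear_systemD(1)[OF sys, of x UNIV]]
    by (simp add: g_def algebra_simps)
  have dg: "(g has_real_derivative g' x) (at x)" for x
  proof -
    have "(g has_real_derivative (1 / p x * \<psi> x * v x + (q x - l * w x) * u x * \<eta> x)
        + (\<xi> x * u x + 1 / p x * v x * \<psi> x)) (at x)"
      unfolding g_def[abs_def]
      by (intro DERIV_add DERIV_mult d\<eta> d\<psi> linear_systemD[OF sys])
    moreover have "(1 / p x * \<psi> x * v x + (q x - l * w x) * u x * \<eta> x)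
        + (\<xi> x * u x + 1 / p x * v x * \<psi> x) = g' x"
      by (simp add: g'_def)
    ultimately show ?thesis by (simp only:)
  qed
  have cg': "continuous_on UNIV g'" and cf': "continuous_on UNIV (\<lambda>x. 1 / p x * g x)"
    unfolding g'_def[abs_def] g_def[abs_def]
    by (intro continuous_intros cp cq cw cu c\<eta> c\<psi> c\<xi>; use p0 in simp)+
  have vd: "((\<lambda>x. complex_of_real (h x)) has_vector_derivative of_real h') (at x)"
    if "(h has_real_derivative h') (at x)" for h h' x
    by (rule has_vector_derivative_of_real) (use that in \<open>simp add: has_real_derivative_iff_has_vector_derivative\<close>)
  have qd: "quasi_deriv p (\<lambda>x. complex_of_real (\<eta> x * u x)) = (\<lambda>x. complex_of_real (g x))"
  proof
    fix x
    have "quasi_deriv p (\<lambda>x. complex_of_real (\<eta> x * u x)) x = of_real (p x) * of_real (1 / p x * g x)"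
      unfolding quasi_deriv_def vector_derivative_at[OF vd[OF df]] ..
    also have "\<dots> = complex_of_real (p x * (1 / p x * g x))" by (simp only: of_real_mult)
    also have "p x * (1 / p x * g x) = g x" using p0 by simp
    finally show "quasi_deriv p (\<lambda>x. complex_of_real (\<eta> x * u x)) x = complex_of_real (g x)" .
  qed
  show op: "SL_op p q w (\<lambda>x. complex_of_real (\<eta> x * u x)) = (\<lambda>x. complex_of_real (l * (\<eta> x * u x) + k x))"
  proof
    fix x
    have "SL_op p q w (\<lambda>x. complex_of_real (\<eta> x * u x)) x
        = (1 / of_real (w x)) * (- of_real (g' x) + of_real (q x) * complex_of_real (\<eta> x * u x))"
      unfolding SL_op_def qd vector_derivative_at[OF vd[OF dg]] ..
    also have "\<dots> = complex_of_real ((1 / w x) * (- g' x + q x * (\<eta> x * u x)))" by simp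
    also have "(1 / w x) * (- g' x + q x * (\<eta> x * u x)) = l * (\<eta> x * u x) + k x"
      using w0[of x] by (simp add: g'_def k_def field_simps)
    finally show "SL_op p q w (\<lambda>x. complex_of_real (\<eta> x * u x)) x = complex_of_real (l * (\<eta> x * u x) + k x)" .
  qed
  show ck: "continuous_on UNIV k"
    unfolding k_def by (intro continuous_intros cp cw cu c\<psi> c\<xi>; use p0 w0 in simp)
  show sk: "k x = 0" if "x \<notin> {s..t}" for x
    using supp that by (simp add: k_def)
  show "continuous_on UNIV \<eta>" by (rule c\<eta>)
  have s\<eta>: "\<eta> x * u x = 0" if "x \<notin> {s..t}" for x using supp that by simp
  have "(\<lambda>x. complex_of_real (\<eta> x * u x)) \<in> L2 (weighted_measure w)"
    by (rule compact_support_L2(1)[OF continuous_on_mult[OF c\<eta> cu(1)] cw w s\<eta>])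
  moreover have "SL_op p q w (\<lambda>x. complex_of_real (\<eta> x * u x)) \<in> L2 (weighted_measure w)"
    unfolding op
  proof (rule compact_support_L2(1)[OF _ cw w])
    show "continuous_on UNIV (\<lambda>x. l * (\<eta> x * u x) + k x)" by (intro continuous_intros c\<eta> cu ck)
    show "l * (\<eta> x * u x) + k x = 0" if "x \<notin> {s..t}" for x using s\<eta>[OF that] sk[OF that] by simp
  qed
  moreover have "locally_abs_continuous (\<lambda>x. complex_of_real (\<eta> x * u x))"
    by (rule locally_abs_continuous_of_C1[OF df cf'])
  moreover have "locally_abs_continuous (quasi_deriv p (\<lambda>x. complex_of_real (\<eta> x * u x)))"
    unfolding qd by (rule locally_abs_continuous_of_C1[OF dg cg'])
  ultimately show "(\<lambda>x. complex_of_real (\<eta> x * u x)) \<in> SL_domain p q w"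
    by (simp add: SL_domain_def)
qed

section \<open>Cut-off functions adapted to the leading coefficient\<close>

lemma has_real_derivative_square_pos_part:
  "((\<lambda>z. (max 0 z)\<^sup>2) has_real_derivative 2 * max 0 z) (at (z::real))"
proof -
  consider "z > 0" | "z < 0" | "z = 0" by linarith
  then show ?thesis
  proof cases
    case 1
    have "((\<lambda>z. z\<^sup>2) has_real_derivative 2 * max 0 z) (at z)"
      using 1 by (auto intro!: derivative_eq_intros)
    then show ?thesis
      by (rule has_field_derivative_transform_within_open[of _ _ _ "{0<..}"]) (use 1 in auto)
  next
    case 2
    have "((\<lambda>z. 0) has_real_derivative 2 * max 0 z) (at z)"
      using 2 by (auto intro!: derivative_eq_intros)
    then show ?thesis
      by (rule has_field_derivative_transform_within_open[of _ _ _ "{..<0}"]) (use 2 in auto)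
  next
    case 3
    have "((\<lambda>h. (max 0 h)\<^sup>2 / h) \<longlongrightarrow> 0) (at (0::real))"
    proof (rule Lim_null_comparison)
      show "\<forall>\<^sub>F h in at 0. norm ((max 0 h)\<^sup>2 / h) \<le> \<bar>h\<bar>"
        by (intro always_eventually allI) (auto simp: max_def power2_eq_square)
      show "((\<lambda>h. \<bar>h\<bar>) \<longlongrightarrow> 0) (at (0::real))"
        by (rule tendsto_rabs_zero[OF tendsto_ident_at])
    qed
    then show ?thesis unfolding 3 DERIV_def by simp
  qed
qed

text \<open>The bump \<open>\<psi>\<close> is prescribed and \<open>\<eta>\<close> derived from it:
  \<open>\<psi> = c * b\<close>, where \<open>b\<close> is the squared positive part of
  \<open>y - y\<^sup>2\<close> with \<open>y = x - s\<close>, and \<open>\<eta>\<close> is the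
  antiderivative of \<open>a * \<psi>\<close>, normalised by \<open>c\<close> to rise from 0 to 1.
  Since \<open>(y - y\<^sup>2)\<^sup>2\<close> has integral \<open>1 / 30\<close> over the unit
  interval, \<open>c \<le> 30 / a0\<close>; with \<open>|b'| \<le> 2\<close> this gives the constant
  60, the same for all \<open>s\<close>.\<close>

lemma cutoff_exists:
  fixes a :: "real \<Rightarrow> real"
  assumes ca: "continuous_on UNIV a" and a0: "a0 > 0" "\<And>x. a x \<ge> a0"
  shows "\<exists>\<eta> \<psi> \<xi>. (\<forall>x. (\<eta> has_real_derivative a x * \<psi> x) (at x)) \<and> (\<forall>x. (\<psi> has_real_derivative \<xi> x) (at x)) \<and>
    continuous_on UNIV \<xi> \<and> (\<forall>x\<le>s. \<eta> x = 0) \<and> (\<forall>x\<ge>s + 1. \<eta> x = 1) \<and>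
    (\<forall>x. \<bar>\<psi> x\<bar> \<le> 60 / a0 \<and> \<bar>\<xi> x\<bar> \<le> 60 / a0) \<and> (\<forall>x. x \<notin> {s..s + 1} \<longrightarrow> \<psi> x = 0 \<and> \<xi> x = 0)"
proof -
  define m where "m x = max 0 ((x - s) - (x - s)\<^sup>2)" for x
  define b where "b x = (m x)\<^sup>2" for x
  define b' where "b' x = 2 * m x * (1 - 2 * (x - s))" for x
  have m0: "m x = 0" if "x \<notin> {s<..<s + 1}" for x
  proof -
    have "(x - s) * (1 - (x - s)) \<le> 0"
      using that by (cases "x \<le> s") (auto intro: mult_nonpos_nonneg mult_nonneg_nonpos)
    then show ?thesis by (simp add: m_def power2_eq_square algebra_simps)
  qed
  have m1: "0 \<le> m x" "m x \<le> 1" for x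
  proof -
    show "0 \<le> m x" by (simp add: m_def)
    have "0 \<le> (x - s - 1 / 2)\<^sup>2" by simp
    then show "m x \<le> 1" by (simp add: m_def power2_eq_square algebra_simps)
  qed
  have mpos: "m x = (x - s) - (x - s)\<^sup>2" if "x \<in> {s..s + 1}" for x
  proof -
    have "0 \<le> (x - s) * (1 - (x - s))" using that by (intro mult_nonneg_nonneg) auto
    then show ?thesis by (simp add: m_def power2_eq_square algebra_simps)
  qed
  have db: "(b has_real_derivative b' x) (at x)" for x
  proof -
    have "((\<lambda>x. (x - s) - (x - s)\<^sup>2) has_real_derivative 1 - 2 * (x - s)) (at x)"
      by (auto intro!: derivative_eq_intros)
    from DERIV_chain2[OF has_real_derivative_square_pos_part this]
    show ?thesis unfolding b_def[abs_def] b'_def m_def .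
  qed
  have cm: "continuous_on UNIV m" unfolding m_def[abs_def] by (intro continuous_intros)
  have cb: "continuous_on UNIV b" unfolding b_def[abs_def] by (intro continuous_intros cm)
  have cb': "continuous_on UNIV b'" unfolding b'_def[abs_def] by (intro continuous_intros cm)
  have b_le: "\<bar>b x\<bar> \<le> 1" for x using m1[of x] by (simp add: b_def abs_square_le_1)
  have b'_le: "\<bar>b' x\<bar> \<le> 2" for x
  proof (cases "x \<in> {s<..<s + 1}")
    case True
    have "\<bar>1 - 2 * (x - s)\<bar> \<le> 1" using True by (auto simp: abs_le_iff)
    then have "m x * \<bar>1 - 2 * (x - s)\<bar> \<le> 1 * 1" using m1[of x] by (intro mult_mono) auto
    then show ?thesis using m1[of x] by (simp add: b'_def abs_mult)
  next
    case False
    then show ?thesis by (simp add: b'_def m0)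
  qed
  obtain G where G: "\<And>x. (G has_real_derivative a x * b x) (at x)"
    using antiderivative_exists[OF continuous_on_mult[OF ca cb]] by blast
  \<comment> \<open>On \<open>{s..s + 1}\<close> this polynomial is an antiderivative of
    \<open>a0 * b\<close>, with increment \<open>a0 / 30\<close>.\<close>
  define F where "F x = a0 * ((x - s) ^ 3 / 3 - (x - s) ^ 4 / 2 + (x - s) ^ 5 / 5)" for x
  have dF: "(F has_real_derivative a0 * ((x - s) - (x - s)\<^sup>2)\<^sup>2) (at x)" for x
  proof -
    have "(F has_real_derivative a0 * ((x - s) ^ 2 - 2 * (x - s) ^ 3 + (x - s) ^ 4)) (at x)"
      unfolding F_def[abs_def] by (auto intro!: derivative_eq_intros)
    moreover have "(x - s) ^ 2 - 2 * (x - s) ^ 3 + (x - s) ^ 4 = ((x - s) - (x - s)\<^sup>2)\<^sup>2"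
      by (simp add: power2_eq_square power3_eq_cube power4_eq_xxxx algebra_simps)
    ultimately show ?thesis by simp
  qed
  have "G s - F s \<le> G (s + 1) - F (s + 1)"
  proof (rule DERIV_nonneg_imp_nondecreasing[of s "s + 1" "\<lambda>x. G x - F x"])
    fix x assume "s \<le> x" "x \<le> s + 1"
    then have "b x = ((x - s) - (x - s)\<^sup>2)\<^sup>2" using mpos[of x] by (simp add: b_def)
    moreover have "a0 * b x \<le> a x * b x" using a0(2)[of x] by (intro mult_right_mono) (auto simp: b_def)
    ultimately have "0 \<le> a x * b x - a0 * ((x - s) - (x - s)\<^sup>2)\<^sup>2" by simp
    with DERIV_diff[OF G dF] show "\<exists>y. ((\<lambda>x. G x - F x) has_real_derivative y) (at x) \<and> 0 \<le> y"
      by (intro exI conjI)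
  qed simp
  then have Z: "a0 / 30 \<le> G (s + 1) - G s" by (simp add: F_def)
  define c where "c = 1 / (G (s + 1) - G s)"
  have cpos: "0 < c" "c \<le> 30 / a0"
  proof -
    have "0 < a0 / 30" using a0(1) by simp
    with Z have pos: "0 < G (s + 1) - G s" by linarith
    then show "0 < c" by (simp add: c_def)
    show "c \<le> 30 / a0" using le_imp_inverse_le[OF Z \<open>0 < a0 / 30\<close>] by (simp add: c_def inverse_eq_divide)
  qed
  define \<eta> where "\<eta> x = c * (G x - G s)" for x
  have Gconst: "G x = G y" if "x \<le> y" "\<And>z. x \<le> z \<Longrightarrow> z \<le> y \<Longrightarrow> b z = 0" for x y
  proof (cases "x < y")
    case True
    have "G y = G x"
    proof (rule DERIV_isconst_end[OF True])
      show "continuous_on {x..y} G" by (rule DERIV_continuous_on[OF has_field_derivative_at_within[OF G]])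
      show "(G has_real_derivative 0) (at z)" if "x < z" "z < y" for z
        using G[of z] \<open>\<And>z. x \<le> z \<Longrightarrow> z \<le> y \<Longrightarrow> b z = 0\<close>[of z] that by simp
    qed
    then show ?thesis by simp
  next
    case False
    then show ?thesis using that(1) by simp
  qed
  show ?thesis
  proof (rule exI[of _ \<eta>], rule exI[of _ "\<lambda>x. c * b x"], rule exI[of _ "\<lambda>x. c * b' x"], intro conjI allI impI)
    fix x
    have "(\<eta> has_real_derivative c * (a x * b x - 0)) (at x)"
      unfolding \<eta>_def[abs_def] by (intro DERIV_cmult DERIV_diff G DERIV_const)
    then show "(\<eta> has_real_derivative a x * (c * b x)) (at x)" by (simp add: mult.left_commute)
    show "((\<lambda>x. c * b x) has_real_derivative c * b' x) (at x)" by (intro DERIV_cmult db)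
    show "\<bar>c * b x\<bar> \<le> 60 / a0"
    proof -
      have "\<bar>c\<bar> * \<bar>b x\<bar> \<le> 30 / a0 * 1" using cpos a0(1) b_le[of x] by (intro mult_mono) auto
      also have "\<dots> \<le> 60 / a0" using a0(1) by (simp add: divide_right_mono)
      finally show ?thesis by (simp add: abs_mult)
    qed
    show "\<bar>c * b' x\<bar> \<le> 60 / a0"
    proof -
      have "\<bar>c\<bar> * \<bar>b' x\<bar> \<le> 30 / a0 * 2" using cpos a0(1) b'_le[of x] by (intro mult_mono) auto
      then show ?thesis by (simp add: abs_mult)
    qed
    show "c * b x = 0" "c * b' x = 0" if "x \<notin> {s..s + 1}"
      using that m0[of x] by (auto simp: b_def b'_def)
    show "\<eta> x = 0" if "x \<le> s"
    proof -
      have "G x = G s" using that by (intro Gconst) (auto simp: b_def m0)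
      then show ?thesis by (simp add: \<eta>_def)
    qed
    show "\<eta> x = 1" if "x \<ge> s + 1"
    proof -
      have "G (s + 1) = G x" using that by (intro Gconst) (auto simp: b_def m0)
      then show ?thesis using cpos by (simp add: \<eta>_def c_def)
    qed
  qed (intro continuous_intros cb')
qed

lemma integral_energy_le_of_growth:
  assumes sys: "linear_system a r u v" and B: "\<And>x. \<bar>a x\<bar> \<le> B" "\<And>x. \<bar>r x\<bar> \<le> B"
    and y: "s \<le> t" "\<And>x. x \<in> {s..t} \<Longrightarrow> \<bar>x - y\<bar> \<le> L"
  shows "integral {s..t} (energy u v) \<le> (t - s) * (exp (2 * B * L) * energy u v y)"
proof -
  have B0: "B \<ge> 0" using B(1)[of 0] by linarith
  have "integral {s..t} (energy u v) \<le> integral {s..t} (\<lambda>_. exp (2 * B * L) * energy u v y)"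
  proof (intro integral_le integrable_continuous_real energy_continuous[OF sys] continuous_intros)
    fix x assume x: "x \<in> {s..t}"
    have "energy u v x \<le> energy u v y * exp (2 * B * \<bar>x - y\<bar>)" by (rule energy_growth[OF sys B])
    also have "\<dots> \<le> energy u v y * exp (2 * B * L)"
      using y(2)[OF x] B0 by (intro mult_left_mono energy_nonneg) (simp add: mult_left_mono)
    finally show "energy u v x \<le> exp (2 * B * L) * energy u v y" by (simp only: mult.commute)
  qed
  also have "\<dots> = (t - s) * (exp (2 * B * L) * energy u v y)" using y(1) by simp
  finally show ?thesis .
qed

text \<open>The norm estimate for the resolvent controls \<open>u\<close> only. Integrating
  \<open>(u * v)' = a * v\<^sup>2 + r * u\<^sup>2\<close> and using \<open>a \<ge> a0\<close>
  recovers \<open>v\<close> from \<open>u\<close> and the boundary values.\<close>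

lemma integral_v_square_le:
  assumes sys: "linear_system a r u v" and B: "\<And>x. \<bar>r x\<bar> \<le> B" and ca: "continuous_on UNIV a" and cr: "continuous_on UNIV r"
    and a0: "a0 > 0" "\<And>x. a x \<ge> a0" and st: "s \<le> t"
  shows "a0 * integral {s..t} (\<lambda>x. (v x)\<^sup>2) \<le> energy u v s + energy u v t + B * integral {s..t} (\<lambda>x. (u x)\<^sup>2)"
proof -
  note c = linear_system_continuous[OF sys]
  have d: "((\<lambda>x. u x * v x) has_real_derivative (a x * (v x)\<^sup>2 + r x * (u x)\<^sup>2)) (at x within S)" for x S
    using DERIV_mult[OF linear_systemD[OF sys]] by (simp add: power2_eq_square algebra_simps)
  have I: "((\<lambda>x. a x * (v x)\<^sup>2 + r x * (u x)\<^sup>2) has_integral (u t * v t - u s * v s)) {s..t}"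
    by (rule fundamental_theorem_of_calculus[OF st]) (simp add: d flip: has_real_derivative_iff_has_vector_derivative)
  have J: "((\<lambda>x. a0 * (v x)\<^sup>2 - B * (u x)\<^sup>2) has_integral
      (a0 * integral {s..t} (\<lambda>x. (v x)\<^sup>2) - B * integral {s..t} (\<lambda>x. (u x)\<^sup>2))) {s..t}"
    by (intro has_integral_diff has_integral_mult_right integrable_integral integrable_continuous_real continuous_intros c)
  have "a0 * integral {s..t} (\<lambda>x. (v x)\<^sup>2) - B * integral {s..t} (\<lambda>x. (u x)\<^sup>2) \<le> u t * v t - u s * v s"
  proof (rule has_integral_le[OF J I])
    fix x
    have "a0 * (v x)\<^sup>2 \<le> a x * (v x)\<^sup>2" using a0(2)[of x] by (intro mult_right_mono) auto
    moreover have "- B * (u x)\<^sup>2 \<le> r x * (u x)\<^sup>2" using B[of x] by (intro mult_right_mono) (auto simp: abs_le_iff)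
    ultimately show "a0 * (v x)\<^sup>2 - B * (u x)\<^sup>2 \<le> a x * (v x)\<^sup>2 + r x * (u x)\<^sup>2" by simp
  qed
  moreover have am: "\<bar>u x * v x\<bar> \<le> energy u v x" for x
  proof -
    have "2 * (\<bar>u x\<bar> * \<bar>v x\<bar>) \<le> energy u v x"
      using sum_squares_bound[of "\<bar>u x\<bar>" "\<bar>v x\<bar>"] by (simp add: energy_def mult.assoc)
    moreover have "0 \<le> \<bar>u x\<bar> * \<bar>v x\<bar>" by simp
    ultimately show ?thesis unfolding abs_mult by linarith
  qed
  ultimately show ?thesis using am[of t] am[of s] by linarith
qed

text \<open>A solution cut off near the endpoints of an interval is mapped by \<open>L - l\<close> to a function
  supported near the endpoints, where the solution is controlled by its values there.\<close>

lemma resolvent_imp_energy_bound: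
  fixes p q w :: "real \<Rightarrow> real"
  assumes cp: "continuous_on UNIV p" and cq: "continuous_on UNIV q" and cw: "continuous_on UNIV w"
    and p: "p0 > 0" "\<And>x. p0 \<le> p x" "\<And>x. p x \<le> p1"
    and q: "\<And>x. \<bar>q x\<bar> \<le> Q"
    and w: "w0 > 0" "\<And>x. w0 \<le> w x" "\<And>x. w x \<le> w1"
    and res: "complex_of_real l0 \<notin> SL_spectrum p q w"
  shows "\<exists>e>0. \<exists>K\<ge>0. \<forall>l. \<bar>l - l0\<bar> < e \<longrightarrow> (\<forall>u v s t. linear_system (\<lambda>x. 1 / p x) (\<lambda>x. q x - l * w x) u v \<longrightarrow>
      s \<le> t \<longrightarrow> integral {s..t} (energy u v) \<le> K * (energy u v s + energy u v t))"
proof -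
  have ppos: "p x > 0" and wpos: "w x > 0" for x using p(1) p(2)[of x] w(1) w(2)[of x] by linarith+
  have pne: "p x \<noteq> 0" for x using ppos[of x] by simp
  define M where "M = weighted_measure w"
  obtain C0 where C0: "\<And>f. f \<in> SL_domain p q w \<Longrightarrow>
      L2_norm M f \<le> C0 * L2_norm M (\<lambda>x. SL_op p q w f x - of_real l0 * f x)"
    using res unfolding SL_spectrum_def operator_spectrum_def resolvent_set_def M_def by blast
  \<comment> \<open>The constant supplied by the resolvent carries no sign; the maximum allows
    division by it.\<close>
  define C where "C = max 1 C0"
  have C: "C \<ge> 1" by (simp add: C_def)
  have resC: "L2_norm M f \<le> C * L2_norm M (\<lambda>x. SL_op p q w f x - of_real l0 * f x)"
    if "f \<in> SL_domain p q w" for f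
  proof -
    have "C0 * L2_norm M (\<lambda>x. SL_op p q w f x - of_real l0 * f x) \<le> C * L2_norm M (\<lambda>x. SL_op p q w f x - of_real l0 * f x)"
      by (intro mult_right_mono) (auto simp: C_def L2_norm_def)
    with C0[OF that] show ?thesis by linarith
  qed
  \<comment> \<open>For \<open>|l - l0| < d\<close> the term \<open>(l - l0) * f\<close> contributes
    at most \<open>F / 2\<close> to the estimate of \<open>F\<close> and is absorbed. This makes one
    constant serve all \<open>l\<close> near \<open>l0\<close>.\<close>
  define d where "d = 1 / (2 * C)"
  have d: "d > 0" "d \<le> 1 / 2" using C by (auto simp: d_def field_simps)
  define a where "a = (\<lambda>x. 1 / p x)"
  define a0 where "a0 = 1 / p1"
  have p1: "p1 > 0" using ppos[of 0] p(3)[of 0] by linarith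
  have a0: "a0 > 0" "\<And>x. a0 \<le> a x"
    using p1 p(3) ppos by (auto simp: a0_def a_def intro!: divide_left_mono mult_pos_pos)
  have ca: "continuous_on UNIV a" unfolding a_def by (intro continuous_intros cp) (use pne in simp)
  define B where "B = max (1 / p0) (Q + (\<bar>l0\<bar> + 1) * w1)"
  have Ba: "\<bar>a x\<bar> \<le> B" for x
  proof -
    have "1 / p x \<le> 1 / p0" using p ppos[of x] by (intro divide_left_mono mult_pos_pos) auto
    then show ?thesis using ppos[of x] by (simp add: a_def B_def)
  qed
  have B0: "B \<ge> 0" using Ba[of 0] by linarith
  have Br: "\<bar>q x - l * w x\<bar> \<le> B" if "\<bar>l - l0\<bar> < d" for l x
  proof -
    have "\<bar>l\<bar> \<le> \<bar>l0\<bar> + 1" using that d(2) by linarith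
    then have "\<bar>l\<bar> * w x \<le> (\<bar>l0\<bar> + 1) * w1" using w(3)[of x] wpos[of x] by (intro mult_mono) auto
    moreover have "\<bar>l * w x\<bar> = \<bar>l\<bar> * w x" using wpos[of x] by (simp add: abs_mult)
    ultimately have "\<bar>q x - l * w x\<bar> \<le> Q + (\<bar>l0\<bar> + 1) * w1" using q[of x] by linarith
    then show ?thesis by (simp add: B_def)
  qed
  \<comment> \<open>\<open>D\<close> bounds \<open>\<psi>\<close> and \<open>\<xi>\<close>, each a
    difference of the data of two cut-offs, and \<open>N\<close> then bounds
    \<open>w * k\<^sup>2\<close> by a multiple of the energy. On long intervals \<open>K1\<close>
    controls the integral of \<open>u\<^sup>2\<close> and \<open>K2\<close> that of the energy; the
    last summand of \<open>K\<close> takes care of intervals of length at most 2.\<close>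
  define D where "D = 2 * (60 / a0)"
  have D: "D > 0" using a0(1) by (simp add: D_def)
  define N where "N = (8 * B\<^sup>2 * D\<^sup>2 + 2 * D\<^sup>2) / w0"
  have N: "N \<ge> 0" using w(1) by (simp add: N_def)
  define E where "E = exp (2 * B)"
  have E: "E \<ge> 1" using B0 by (simp add: E_def)
  define K1 where "K1 = 4 * C\<^sup>2 * N * E / w0 + 2 * E"
  have K1: "K1 \<ge> 0" using N E w(1) by (simp add: K1_def)
  define K2 where "K2 = K1 + (1 + B * K1) / a0"
  define K where "K = K2 + 2 * exp (2 * B * 2)"
  have K2: "K2 \<ge> 0" using K1 B0 a0(1) by (simp add: K2_def)
  have main: "integral {s..t} (energy u v) \<le> K * (energy u v s + energy u v t)"
    if l: "\<bar>l - l0\<bar> < d" and sys: "linear_system a (\<lambda>x. q x - l * w x) u v" and st: "s \<le> t" for l u v s t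
  proof (cases "t - s \<le> 2")
    case True
    \<comment> \<open>There may be no room for two separate cut-off regions; the growth bound from
      the left end point suffices.\<close>
    have "integral {s..t} (energy u v) \<le> (t - s) * (exp (2 * B * 2) * energy u v s)"
      by (rule integral_energy_le_of_growth[OF sys Ba Br[OF l] st]) (use True in auto)
    also have "\<dots> \<le> 2 * (exp (2 * B * 2) * energy u v s)"
      using True by (intro mult_right_mono) (auto simp: energy_nonneg)
    also have "\<dots> \<le> K * energy u v s"
      using K2 by (simp add: K_def distrib_right energy_nonneg)
    also have "\<dots> \<le> K * (energy u v s + energy u v t)"
      using K2 by (intro mult_left_mono) (auto simp: K_def energy_nonneg)
    finally show ?thesis .
  next
    case False
    note c = linear_system_continuous[OF sys]
    obtain \<eta>1 \<psi>1 \<xi>1 where f1: "\<And>x. (\<eta>1 has_real_derivative a x * \<psi>1 x) (at x)"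
      "\<And>x. (\<psi>1 has_real_derivative \<xi>1 x) (at x)" "continuous_on UNIV \<xi>1"
      "\<And>x. x \<le> s \<Longrightarrow> \<eta>1 x = 0" "\<And>x. x \<ge> s + 1 \<Longrightarrow> \<eta>1 x = 1"
      "\<And>x. \<bar>\<psi>1 x\<bar> \<le> 60 / a0" "\<And>x. \<bar>\<xi>1 x\<bar> \<le> 60 / a0"
      "\<And>x. x \<notin> {s..s + 1} \<Longrightarrow> \<psi>1 x = 0" "\<And>x. x \<notin> {s..s + 1} \<Longrightarrow> \<xi>1 x = 0"
      using cutoff_exists[OF ca a0, of s] by blast
    obtain \<eta>2 \<psi>2 \<xi>2 where f2: "\<And>x. (\<eta>2 has_real_derivative a x * \<psi>2 x) (at x)"
      "\<And>x. (\<psi>2 has_real_derivative \<xi>2 x) (at x)" "continuous_on UNIV \<xi>2"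
      "\<And>x. x \<le> t - 1 \<Longrightarrow> \<eta>2 x = 0" "\<And>x. x \<ge> (t - 1) + 1 \<Longrightarrow> \<eta>2 x = 1"
      "\<And>x. \<bar>\<psi>2 x\<bar> \<le> 60 / a0" "\<And>x. \<bar>\<xi>2 x\<bar> \<le> 60 / a0"
      "\<And>x. x \<notin> {t - 1..(t - 1) + 1} \<Longrightarrow> \<psi>2 x = 0" "\<And>x. x \<notin> {t - 1..(t - 1) + 1} \<Longrightarrow> \<xi>2 x = 0"
      using cutoff_exists[OF ca a0, of "t - 1"] by blast
    \<comment> \<open>Rises on \<open>{s..s + 1}\<close> and falls on
      \<open>{t - 1..t}\<close>.\<close>
    define \<eta> where "\<eta> = (\<lambda>x. \<eta>1 x - \<eta>2 x)"
    define \<psi> where "\<psi> = (\<lambda>x. \<psi>1 x - \<psi>2 x)"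
    define \<xi> where "\<xi> = (\<lambda>x. \<xi>1 x - \<xi>2 x)"
    have d\<eta>: "(\<eta> has_real_derivative 1 / p x * \<psi> x) (at x)" for x
      using DERIV_diff[OF f1(1) f2(1), of x] by (simp add: \<eta>_def \<psi>_def a_def right_diff_distrib diff_divide_distrib)
    have d\<psi>: "(\<psi> has_real_derivative \<xi> x) (at x)" for x
      unfolding \<psi>_def \<xi>_def by (rule DERIV_diff[OF f1(2) f2(2)])
    have c\<xi>: "continuous_on UNIV \<xi>" unfolding \<xi>_def by (intro continuous_intros f1(3) f2(3))
    have supp: "\<eta> x = 0 \<and> \<psi> x = 0 \<and> \<xi> x = 0" if "x \<notin> {s..t}" for x
    proof -
      have "x < s \<or> t < x" using that by auto
      then show ?thesis
        using False f1(4)[of x] f1(5)[of x] f2(4)[of x] f2(5)[of x] f1(8)[of x] f1(9)[of x] f2(8)[of x] f2(9)[of x]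
        by (auto simp: \<eta>_def \<psi>_def \<xi>_def)
    qed
    have \<psi>D: "\<bar>\<psi> x\<bar> \<le> D" and \<xi>D: "\<bar>\<xi> x\<bar> \<le> D" for x
      using f1(6)[of x] f1(7)[of x] f2(6)[of x] f2(7)[of x] by (auto simp: \<psi>_def \<xi>_def D_def)
    have inner: "\<eta> x = 1" "\<psi> x = 0" "\<xi> x = 0" if "x \<in> {s + 1<..<t - 1}" for x
      using that f1(5)[of x] f2(4)[of x] f1(8)[of x] f1(9)[of x] f2(8)[of x] f2(9)[of x]
      by (auto simp: \<eta>_def \<psi>_def \<xi>_def)
    have \<eta>1: "\<eta> x = 1" if "x \<in> {s + 1..t - 1}" for x
      using that f1(5)[of x] f2(4)[of x] by (auto simp: \<eta>_def)
    define k where "k = (\<lambda>x. - (2 * (1 / p x) * \<psi> x * v x + \<xi> x * u x) / w x)"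
    have supp': "\<forall>x. x \<notin> {s..t} \<longrightarrow> \<eta> x = 0 \<and> \<psi> x = 0 \<and> \<xi> x = 0"
      using supp by blast
    note T = test_function_in_domain[OF cp cq cw ppos wpos sys[unfolded a_def] d\<eta> d\<psi> c\<xi> supp']
    have Top: "SL_op p q w (\<lambda>x. complex_of_real (\<eta> x * u x)) = (\<lambda>x. complex_of_real (l * (\<eta> x * u x) + k x))"
      unfolding k_def by (rule T(2))
    have Tk: "continuous_on UNIV k" "\<And>x. x \<notin> {s..t} \<Longrightarrow> k x = 0"
      unfolding k_def by (rule T(3), rule T(4))
    define f where "f = (\<lambda>x. \<eta> x * u x)"
    have cf: "continuous_on UNIV f" unfolding f_def by (intro continuous_intros T(5) c)
    have sf: "f x = 0" if "x \<notin> {s..t}" for x using supp[OF that] by (simp add: f_def)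
    define F where "F = integral {s..t} (\<lambda>x. w x * (f x)\<^sup>2)"
    define R where "R = integral {s..t} (\<lambda>x. w x * (k x)\<^sup>2)"
    define g where "g = (\<lambda>x. (l - l0) * f x + k x)"
    have cg: "continuous_on UNIV g" unfolding g_def by (intro continuous_intros cf Tk(1))
    have sg: "g x = 0" if "x \<notin> {s..t}" for x using sf[OF that] Tk(2)[OF that] by (simp add: g_def)
    have "L2_norm M (\<lambda>x. complex_of_real (f x)) \<le> C * L2_norm M (\<lambda>x. complex_of_real (g x))"
    proof -
      have "(\<lambda>x. SL_op p q w (\<lambda>x. complex_of_real (f x)) x - of_real l0 * complex_of_real (f x)) = (\<lambda>x. complex_of_real (g x))"
        unfolding f_def Top g_def by (rule ext) (simp add: algebra_simps)
      with resC[of "\<lambda>x. complex_of_real (f x)"] T(1) show ?thesis unfolding f_def by simp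
    qed
    moreover have "L2_norm M (\<lambda>x. complex_of_real (f x)) = sqrt F"
      unfolding M_def F_def by (rule compact_support_L2(2)[OF cf cw wpos sf])
    moreover have "L2_norm M (\<lambda>x. complex_of_real (g x)) = sqrt (integral {s..t} (\<lambda>x. w x * (g x)\<^sup>2))"
      unfolding M_def by (rule compact_support_L2(2)[OF cg cw wpos sg])
    ultimately have n: "sqrt F \<le> C * sqrt (integral {s..t} (\<lambda>x. w x * (g x)\<^sup>2))" by (simp only:)
    have nonneg: "0 \<le> integral {s..t} (\<lambda>x. w x * (h x)\<^sup>2)" if h: "continuous_on UNIV h" for h
    proof (rule integral_nonneg)
      show "(\<lambda>x. w x * (h x)\<^sup>2) integrable_on {s..t}"
        by (intro integrable_continuous_real continuous_intros continuous_on_subset[OF cw] continuous_on_subset[OF h]) auto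
      show "0 \<le> w x * (h x)\<^sup>2" for x using wpos[of x] by simp
    qed
    have F0: "0 \<le> F" unfolding F_def by (rule nonneg[OF cf])
    have "F \<le> C\<^sup>2 * integral {s..t} (\<lambda>x. w x * (g x)\<^sup>2)"
    proof -
      have "(sqrt F)\<^sup>2 \<le> (C * sqrt (integral {s..t} (\<lambda>x. w x * (g x)\<^sup>2)))\<^sup>2"
        by (rule power_mono[OF n]) (simp add: F0)
      then show ?thesis by (simp add: power_mult_distrib F0 nonneg[OF cg])
    qed
    also have "integral {s..t} (\<lambda>x. w x * (g x)\<^sup>2) \<le> 2 * (l - l0)\<^sup>2 * F + 2 * R"
    proof -
      have i1: "((\<lambda>x. 2 * (l - l0)\<^sup>2 * (w x * (f x)\<^sup>2) + 2 * (w x * (k x)\<^sup>2)) has_integral (2 * (l - l0)\<^sup>2 * F + 2 * R)) {s..t}"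
        unfolding F_def R_def
        by (intro has_integral_add has_integral_mult_right integrable_integral integrable_continuous_real continuous_intros
            continuous_on_subset[OF cw] continuous_on_subset[OF cf] continuous_on_subset[OF Tk(1)]) auto
      have i2: "((\<lambda>x. w x * (g x)\<^sup>2) has_integral (integral {s..t} (\<lambda>x. w x * (g x)\<^sup>2))) {s..t}"
        by (intro integrable_integral integrable_continuous_real continuous_intros
            continuous_on_subset[OF cw] continuous_on_subset[OF cg]) auto
      have "w x * (g x)\<^sup>2 \<le> 2 * (l - l0)\<^sup>2 * (w x * (f x)\<^sup>2) + 2 * (w x * (k x)\<^sup>2)" for x
      proof -
        have "0 \<le> w x * ((l - l0) * f x - k x)\<^sup>2" using wpos[of x] by simp
        then show ?thesis by (simp add: g_def power2_eq_square algebra_simps)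
      qed
      then show ?thesis by (rule has_integral_le[OF i2 i1])
    qed
    finally have F_le: "F \<le> C\<^sup>2 * (2 * (l - l0)\<^sup>2 * F + 2 * R)" using C by (simp add: mult_left_mono)
    have "C\<^sup>2 * (l - l0)\<^sup>2 \<le> 1 / 4"
    proof -
      have "\<bar>C * (l - l0)\<bar> \<le> C * d" using l C by (simp add: abs_mult)
      also have "C * d = 1 / 2" using C by (simp add: d_def)
      finally have "\<bar>C * (l - l0)\<bar>\<^sup>2 \<le> (1 / 2)\<^sup>2" by (intro power_mono) auto
      then show ?thesis by (simp add: power_mult_distrib power_divide)
    qed
    then have "C\<^sup>2 * (l - l0)\<^sup>2 * F \<le> 1 / 4 * F" by (rule mult_right_mono) (rule F0)
    with F_le have F_R: "F \<le> 4 * C\<^sup>2 * R" by (simp add: algebra_simps)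
    define e where "e = energy u v"
    have ce: "continuous_on S e" for S unfolding e_def by (rule energy_continuous[OF sys])
    have e0: "e x \<ge> 0" for x by (simp add: e_def energy_nonneg)
    have ends: "integral {s..s + 1} e \<le> E * e s" "integral {t - 1..t} e \<le> E * e t"
      using integral_energy_le_of_growth[OF sys Ba Br[OF l], of s "s + 1" s 1]
        integral_energy_le_of_growth[OF sys Ba Br[OF l], of "t - 1" t t 1]
      by (auto simp: e_def E_def)
    have int: "h integrable_on {x..y}" if "continuous_on UNIV h" for h :: "real \<Rightarrow> real" and x y
      by (rule integrable_continuous_real[OF continuous_on_subset[OF that subset_UNIV]])
    have split: "integral {s..t} h = integral {s..s + 1} h + (integral {s + 1..t - 1} h + integral {t - 1..t} h)"
      if h: "continuous_on UNIV h" for h :: "real \<Rightarrow> real"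
    proof -
      have "integral {s..s + 1} h + integral {s + 1..t} h = integral {s..t} h"
        using False by (intro Henstock_Kurzweil_Integration.integral_combine int[OF h]) auto
      moreover have "integral {s + 1..t - 1} h + integral {t - 1..t} h = integral {s + 1..t} h"
        using False by (intro Henstock_Kurzweil_Integration.integral_combine int[OF h]) auto
      ultimately show ?thesis by simp
    qed
    have k_le: "w x * (k x)\<^sup>2 \<le> N * e x" for x
    proof -
      define A where "A = 2 * a x * \<psi> x * v x"
      define A' where "A' = \<xi> x * u x"
      have kx: "k x = - ((A + A') / w x)"
        unfolding k_def A_def A'_def a_def by (simp only: minus_divide_left)
      have "w x * (k x)\<^sup>2 = (A + A')\<^sup>2 / w x"
        unfolding kx using wpos[of x] by (simp add: power2_eq_square)
      also have "\<dots> \<le> (A + A')\<^sup>2 / w0"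
        using w(1) w(2)[of x] wpos[of x] by (intro divide_left_mono) auto
      also have "\<dots> \<le> (2 * A\<^sup>2 + 2 * A'\<^sup>2) / w0"
      proof -
        have "0 \<le> (A - A')\<^sup>2" by simp
        then have "(A + A')\<^sup>2 \<le> 2 * A\<^sup>2 + 2 * A'\<^sup>2" by (simp add: power2_eq_square algebra_simps)
        then show ?thesis using w(1) by (simp add: divide_right_mono)
      qed
      also have "2 * A\<^sup>2 + 2 * A'\<^sup>2 \<le> 8 * B\<^sup>2 * D\<^sup>2 * e x + 2 * D\<^sup>2 * e x"
      proof (intro add_mono)
        have "(a x)\<^sup>2 \<le> B\<^sup>2" using power_mono[OF Ba[of x], of 2] by simp
        moreover have "(\<psi> x)\<^sup>2 \<le> D\<^sup>2" using power_mono[OF \<psi>D[of x], of 2] by simp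
        moreover have "(v x)\<^sup>2 \<le> e x" by (simp add: e_def energy_def)
        ultimately have "(a x)\<^sup>2 * (\<psi> x)\<^sup>2 * (v x)\<^sup>2 \<le> B\<^sup>2 * D\<^sup>2 * e x" by (intro mult_mono) auto
        then show "2 * A\<^sup>2 \<le> 8 * B\<^sup>2 * D\<^sup>2 * e x" by (simp add: A_def power_mult_distrib)
        have "(\<xi> x)\<^sup>2 \<le> D\<^sup>2" using power_mono[OF \<xi>D[of x], of 2] by simp
        moreover have "(u x)\<^sup>2 \<le> e x" by (simp add: e_def energy_def)
        ultimately have "(\<xi> x)\<^sup>2 * (u x)\<^sup>2 \<le> D\<^sup>2 * e x" by (intro mult_mono) auto
        then show "2 * A'\<^sup>2 \<le> 2 * D\<^sup>2 * e x" by (simp add: A'_def power_mult_distrib)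
      qed
      finally show ?thesis using w(1) by (simp add: N_def distrib_right divide_right_mono)
    qed
    have ck2: "continuous_on UNIV (\<lambda>x. w x * (k x)\<^sup>2)" by (intro continuous_intros cw Tk(1))
    have R_le: "R \<le> N * E * (e s + e t)"
    proof -
      \<comment> \<open>Between the two cut-off regions \<open>\<psi>\<close> and
        \<open>\<xi>\<close> vanish. Only two intervals of unit length remain, where the growth
        bound controls the energy by its value at \<open>s\<close> or \<open>t\<close>.\<close>
      have z0: "integral {s + 1..t - 1} (\<lambda>x. w x * (k x)\<^sup>2) = 0"
      proof -
        have "integral {s + 1..t - 1} (\<lambda>x. w x * (k x)\<^sup>2) = integral {s + 1..t - 1} (\<lambda>x. 0)"
        proof (rule integral_spike[of "{s + 1, t - 1}"])
          fix x assume "x \<in> {s + 1..t - 1} - {s + 1, t - 1}"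
          then have "x \<in> {s + 1<..<t - 1}" by auto
          from inner[OF this] show "0 = w x * (k x)\<^sup>2" by (simp add: k_def)
        qed simp
        then show ?thesis by simp
      qed
      have Ne: "integral {x..y} (\<lambda>x. w x * (k x)\<^sup>2) \<le> N * integral {x..y} e" for x y
      proof -
        have "integral {x..y} (\<lambda>x. w x * (k x)\<^sup>2) \<le> integral {x..y} (\<lambda>x. N * e x)"
          by (intro integral_le int ck2 continuous_intros ce k_le)
        then show ?thesis by simp
      qed
      have "R \<le> N * integral {s..s + 1} e + N * integral {t - 1..t} e"
        unfolding R_def split[OF ck2] z0 using Ne[of s "s + 1"] Ne[of "t - 1" t] by simp
      also have "\<dots> \<le> N * (E * e s) + N * (E * e t)"
        using N ends by (intro add_mono mult_left_mono) auto
      finally show ?thesis by (simp add: algebra_simps)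
    qed
    have u_le: "integral {s..t} (\<lambda>x. (u x)\<^sup>2) \<le> K1 * (e s + e t)"
    proof -
      have cu2: "continuous_on UNIV (\<lambda>x. (u x)\<^sup>2)" by (intro continuous_intros c)
      have cwf: "continuous_on UNIV (\<lambda>x. w x * (f x)\<^sup>2)" by (intro continuous_intros cw cf)
      have "w0 * integral {s + 1..t - 1} (\<lambda>x. (u x)\<^sup>2) = integral {s + 1..t - 1} (\<lambda>x. w0 * (u x)\<^sup>2)" by simp
      also have "\<dots> \<le> integral {s + 1..t - 1} (\<lambda>x. w x * (f x)\<^sup>2)"
      proof (intro integral_le int cwf continuous_intros c)
        fix x assume "x \<in> {s + 1..t - 1}"
        then have "f x = u x" using \<eta>1[of x] by (simp add: f_def)
        then show "w0 * (u x)\<^sup>2 \<le> w x * (f x)\<^sup>2" using w(2)[of x] by (simp add: mult_right_mono)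
      qed
      also have "\<dots> \<le> F"
        unfolding F_def using wpos by (intro integral_subset_le int cwf) (auto simp: less_imp_le)
      also have "\<dots> \<le> 4 * C\<^sup>2 * R" by (rule F_R)
      also have "\<dots> \<le> 4 * C\<^sup>2 * (N * E * (e s + e t))" by (intro mult_left_mono R_le) simp
      finally have "integral {s + 1..t - 1} (\<lambda>x. (u x)\<^sup>2) \<le> 4 * C\<^sup>2 * N * E / w0 * (e s + e t)"
        using w(1) by (simp add: field_simps)
      moreover have ue: "integral {x..y} (\<lambda>x. (u x)\<^sup>2) \<le> integral {x..y} e" for x y
        by (intro integral_le int cu2 ce) (simp add: e_def energy_def)
      moreover have "E * e s \<le> E * (e s + e t)" "E * e t \<le> E * (e s + e t)"
        using E e0 by (auto intro!: mult_left_mono)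
      moreover have "K1 * (e s + e t) = 4 * C\<^sup>2 * N * E / w0 * (e s + e t) + (E * (e s + e t) + E * (e s + e t))"
        by (simp add: K1_def distrib_right[of _ _ "e s + e t"])
      ultimately show ?thesis
        unfolding split[OF cu2] using ends ue[of s "s + 1"] ue[of "t - 1" t] by linarith
    qed
    have v_le: "integral {s..t} (\<lambda>x. (v x)\<^sup>2) \<le> (1 + B * K1) / a0 * (e s + e t)"
    proof -
      have cr: "continuous_on UNIV (\<lambda>x. q x - l * w x)" by (intro continuous_intros cq cw)
      have "a0 * integral {s..t} (\<lambda>x. (v x)\<^sup>2) \<le> e s + e t + B * integral {s..t} (\<lambda>x. (u x)\<^sup>2)"
        unfolding e_def by (rule integral_v_square_le[OF sys Br[OF l] ca cr a0 st])
      also have "\<dots> \<le> e s + e t + B * (K1 * (e s + e t))"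
        using u_le B0 by (intro add_left_mono mult_left_mono)
      also have "\<dots> = (1 + B * K1) * (e s + e t)" by (simp add: algebra_simps)
      finally show ?thesis using a0(1) by (simp add: field_simps)
    qed
    have "integral {s..t} e = integral {s..t} (\<lambda>x. (u x)\<^sup>2) + integral {s..t} (\<lambda>x. (v x)\<^sup>2)"
      unfolding e_def energy_def[abs_def]
      by (intro integral_add integrable_continuous_real continuous_intros c)
    also have "\<dots> \<le> K2 * (e s + e t)"
      using u_le v_le by (simp add: K2_def distrib_right)
    also have "\<dots> \<le> K * (e s + e t)"
      by (intro mult_right_mono) (auto simp: K_def e0)
    finally show ?thesis unfolding e_def .
  qed
  have "K \<ge> 0" using K2 by (simp add: K_def)
  with d(1) main[unfolded a_def] show ?thesis by blast
qed

subsection \<open>Phases and their mean slopes\<close>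

lemma tendsto_at_top_of_approx:
  fixes f :: "real \<Rightarrow> real"
  assumes approx: "\<And>e. e > 0 \<Longrightarrow> \<exists>z T0. \<forall>x\<ge>T0. \<bar>f x - z\<bar> \<le> e"
  shows "\<exists>l. (f \<longlongrightarrow> l) at_top"
proof -
  have "Cauchy (\<lambda>n. f (real n))"
  proof (rule metric_CauchyI)
    fix e :: real assume e: "e > 0"
    obtain z T0 where z: "\<And>x. x \<ge> T0 \<Longrightarrow> \<bar>f x - z\<bar> \<le> e / 3"
      using approx[of "e / 3"] e by auto
    obtain M where M: "real M \<ge> T0" using real_arch_simple by blast
    show "\<exists>M. \<forall>m\<ge>M. \<forall>n\<ge>M. dist (f (real m)) (f (real n)) < e"
    proof (intro exI[of _ M] allI impI)
      fix m n assume "m \<ge> M" "n \<ge> M"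
      then have "real m \<ge> T0" "real n \<ge> T0" using M by linarith+
      then have "\<bar>f (real m) - z\<bar> \<le> e / 3" "\<bar>f (real n) - z\<bar> \<le> e / 3" by (simp_all only: z)
      then show "dist (f (real m)) (f (real n)) < e" using e unfolding dist_real_def by linarith
    qed
  qed
  then obtain l where l: "(\<lambda>n. f (real n)) \<longlonglongrightarrow> l"
    using Cauchy_convergent_iff convergent_def by blast
  have "(f \<longlongrightarrow> l) at_top"
  proof (rule tendstoI)
    fix e :: real assume e: "e > 0"
    obtain z T0 where z: "\<And>x. x \<ge> T0 \<Longrightarrow> \<bar>f x - z\<bar> \<le> e / 3"
      using approx[of "e / 3"] e by auto
    obtain M where M: "real M \<ge> T0" using real_arch_simple by blast
    have lz: "\<bar>l - z\<bar> \<le> e / 3"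
    proof (rule tendsto_upperbound)
      show "(\<lambda>n. \<bar>f (real n) - z\<bar>) \<longlonglongrightarrow> \<bar>l - z\<bar>" by (intro tendsto_intros l)
      show "\<forall>\<^sub>F n in sequentially. \<bar>f (real n) - z\<bar> \<le> e / 3"
        using M by (intro eventually_sequentiallyI[of M] z) simp
    qed simp
    show "\<forall>\<^sub>F x in at_top. dist (f x) l < e"
      using eventually_ge_at_top[of T0]
    proof eventually_elim
      case (elim x)
      with z[of x] lz e show ?case unfolding dist_real_def by linarith
    qed
  qed
  then show ?thesis by blast
qed

lemma abs_sin_diff_int_pi: "\<bar>sin (z - of_int k * pi)\<bar> = \<bar>sin z\<bar>"
proof -
  have s: "sin (of_int k * pi) = 0" by (simp add: mult.commute sin_npi_int)
  have "(cos (of_int k * pi))\<^sup>2 = 1" using sin_cos_squared_add[of "of_int k * pi"] s by simp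
  then have "cos (of_int k * pi) = 1 \<or> cos (of_int k * pi) = - 1" by (simp add: power2_eq_1_iff)
  then have "\<bar>cos (of_int k * pi)\<bar> = 1" by (elim disjE) (simp_all only: abs_one abs_minus_cancel)
  then show ?thesis by (simp add: sin_diff s abs_mult)
qed

lemma abs_sin_abs: "\<bar>sin \<bar>z\<bar>\<bar> = \<bar>sin (z::real)\<bar>"
  by (cases "0 \<le> z") simp_all

text \<open>\<open>h\<close> is the distance to the multiple of \<open>pi\<close> nearest to
  \<open>g 0\<close>. It is at most \<open>pi / 2\<close> at 0 and never equals
  \<open>pi / 2\<close>, where the sine would have modulus 1; by connectedness it stays
  below.\<close>

lemma sin_bounded_imp_near_int_pi:
  fixes g :: "real \<Rightarrow> real"
  assumes g: "continuous_on UNIV g" and s: "\<And>x. \<bar>sin (g x)\<bar> < 1"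
  obtains k :: int where "\<And>x. \<bar>g x - of_int k * pi\<bar> < pi / 2"
proof -
  define k where "k = round (g 0 / pi)"
  define h where "h x = \<bar>g x - of_int k * pi\<bar>" for x
  have ch: "continuous_on S h" for S
    unfolding h_def[abs_def] by (intro continuous_intros continuous_on_subset[OF g]) auto
  have ne: "h x \<noteq> pi / 2" for x
  proof
    assume "h x = pi / 2"
    then have "g x - of_int k * pi = pi / 2 \<or> g x - of_int k * pi = - (pi / 2)"
      unfolding h_def by (auto simp: abs_if split: if_splits)
    then have "\<bar>sin (g x - of_int k * pi)\<bar> = 1"
    proof
      assume "g x - of_int k * pi = pi / 2"
      then show ?thesis by (simp only: sin_pi_half abs_one)
    next
      assume "g x - of_int k * pi = - (pi / 2)"
      then show ?thesis by (simp only: sin_minus sin_pi_half abs_minus_cancel abs_one)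
    qed
    then show False using s[of x] by (simp add: abs_sin_diff_int_pi)
  qed
  have h0: "h 0 \<le> pi / 2"
  proof -
    have "\<bar>of_int k - g 0 / pi\<bar> \<le> 1 / 2" unfolding k_def by (rule of_int_round_abs_le)
    then have "\<bar>of_int k - g 0 / pi\<bar> * pi \<le> 1 / 2 * pi" by (intro mult_right_mono) auto
    moreover have "\<bar>g 0 - of_int k * pi\<bar> = \<bar>of_int k - g 0 / pi\<bar> * pi"
    proof -
      have "g 0 - of_int k * pi = - ((of_int k - g 0 / pi) * pi)" by (simp add: left_diff_distrib)
      then show ?thesis by (simp only: abs_minus_cancel abs_mult abs_of_pos[OF pi_gt_zero])
    qed
    ultimately show ?thesis by (simp only: h_def)
  qed
  have "h x < pi / 2" for x
  proof (rule ccontr)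
    assume "\<not> h x < pi / 2"
    then have hx: "pi / 2 \<le> h x" by simp
    have "connected (h ` UNIV)" by (intro connected_continuous_image ch connected_UNIV)
    then have "pi / 2 \<in> h ` UNIV"
      using connectedD_interval[of "h ` UNIV" "h 0" "h x" "pi / 2"] h0 hx by blast
    then show False using ne by force
  qed
  then show thesis using that[of k] by (simp add: h_def)
qed

lemma sin_le_imp_near_int_pi:
  fixes g :: "real \<Rightarrow> real"
  assumes g: "continuous_on UNIV g" and s: "\<And>x. \<bar>sin (g x)\<bar> \<le> e" and e: "e < 1"
  obtains k :: int where "\<And>x. \<bar>g x - of_int k * pi\<bar> \<le> arcsin e"
proof -
  have "\<bar>sin (g x)\<bar> < 1" for x using s[of x] e by linarith
  then obtain k :: int where k: "\<And>x. \<bar>g x - of_int k * pi\<bar> < pi / 2"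
    using sin_bounded_imp_near_int_pi[OF g] by blast
  have "\<bar>g x - of_int k * pi\<bar> \<le> arcsin e" for x
  proof -
    define y where "y = \<bar>g x - of_int k * pi\<bar>"
    have y: "0 \<le> y" "y < pi / 2" using k[of x] by (auto simp: y_def)
    have "sin y \<le> \<bar>sin (g x - of_int k * pi)\<bar>"
      using abs_ge_self[of "sin y"] by (simp only: y_def abs_sin_abs)
    then have "sin y \<le> e" using s[of x] by (simp add: abs_sin_diff_int_pi)
    moreover have "- 1 \<le> sin y" by simp
    ultimately have "arcsin (sin y) \<le> arcsin e" using e by (intro arcsin_le_arcsin) auto
    moreover have "arcsin (sin y) = y" using y by (intro arcsin_sin) auto
    ultimately show ?thesis by (simp add: y_def)
  qed
  with that show thesis by blast
qed

lemma translation_multiple_bound: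
  fixes \<theta> :: "real \<Rightarrow> real"
  assumes "\<And>x. \<bar>\<theta> (x + s) - \<theta> x - c\<bar> \<le> b"
  shows "\<bar>\<theta> (x + real n * s) - \<theta> x - real n * c\<bar> \<le> real n * b"
proof (induction n)
  case (Suc n)
  have "\<theta> (x + real (Suc n) * s) - \<theta> x - real (Suc n) * c
      = (\<theta> ((x + real n * s) + s) - \<theta> (x + real n * s) - c) + (\<theta> (x + real n * s) - \<theta> x - real n * c)"
    by (simp add: algebra_simps)
  also have "\<bar>\<dots>\<bar> \<le> b + real n * b"
    by (rule order.trans[OF abs_triangle_ineq add_mono[OF assms Suc.IH]])
  finally show ?case by (simp add: algebra_simps)
qed simp

text \<open>Every step of length \<open>s\<close> changes \<open>\<theta>\<close> by the same
  multiple \<open>c\<close> of \<open>pi\<close>, up to an error below 2. Far out the mean slope is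
  therefore within about \<open>2 / s\<close> of \<open>c / s\<close>, and \<open>s\<close> may be
  taken arbitrarily large.\<close>

lemma mean_slope_exists:
  fixes \<theta> :: "real \<Rightarrow> real"
  assumes cont: "continuous_on UNIV \<theta>"
    and rec: "\<And>L. \<exists>s\<ge>L. \<forall>x. \<bar>sin (\<theta> (x + s) - \<theta> x)\<bar> \<le> 1 / 2"
  shows "\<exists>\<rho>. ((\<lambda>x. (\<theta> x - \<theta> 0) / x) \<longlongrightarrow> \<rho>) at_top"
proof (rule tendsto_at_top_of_approx)
  fix e :: real assume e: "e > 0"
  \<comment> \<open>With \<open>s \<ge> 4 / e\<close> an error of 2 per step is at most
    \<open>e / 2\<close> per unit length.\<close>
  obtain s where s: "s \<ge> max 1 (4 / e)" "\<And>x. \<bar>sin (\<theta> (x + s) - \<theta> x)\<bar> \<le> 1 / 2"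
    using rec[of "max 1 (4 / e)"] by blast
  have s1: "s \<ge> 1" "s > 0" "2 \<le> e / 2 * s" using s(1) e by (auto simp: field_simps)
  have cs: "continuous_on UNIV (\<lambda>x. \<theta> (x + s) - \<theta> x)"
    by (intro continuous_on_diff cont continuous_on_compose2[OF cont]) (auto intro: continuous_intros)
  have "\<bar>sin (\<theta> (x + s) - \<theta> x)\<bar> < 1" for x using s(2)[of x] by linarith
  then obtain k :: int where k: "\<And>x. \<bar>\<theta> (x + s) - \<theta> x - of_int k * pi\<bar> < pi / 2"
    using sin_bounded_imp_near_int_pi[OF cs] by blast
  define c where "c = of_int k * pi"
  have k': "\<bar>\<theta> (x + s) - \<theta> x - c\<bar> \<le> 2" for x
    using k[of x] pi_half_less_two unfolding c_def by linarith
  have "bounded ((\<lambda>x. \<theta> x - \<theta> 0) ` {0..s})"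
    by (intro compact_imp_bounded compact_continuous_image continuous_intros continuous_on_subset[OF cont]) auto
  then obtain M where "\<forall>y\<in>(\<lambda>x. \<theta> x - \<theta> 0) ` {0..s}. norm y \<le> M"
    unfolding bounded_iff by blast
  then have M: "\<bar>\<theta> x - \<theta> 0\<bar> \<le> M" if "x \<in> {0..s}" for x
    using that by simp
  have M0: "M \<ge> 0" using M[of 0] s1 by simp
  \<comment> \<open>From here on the incomplete last step and the rounding of \<open>x / s\<close>
    together cost at most \<open>e / 2\<close> per unit length.\<close>
  define T0 where "T0 = max 1 ((M + \<bar>c\<bar>) * 2 / e)"
  have "\<bar>(\<theta> x - \<theta> 0) / x - c / s\<bar> \<le> e" if x: "x \<ge> T0" for x
  proof -
    have x1: "x > 0" "M + \<bar>c\<bar> \<le> e / 2 * x" using x e by (auto simp: T0_def field_simps)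
    define n where "n = nat \<lfloor>x / s\<rfloor>"
    define y where "y = x - real n * s"
    have "real n \<le> x / s" "x / s < real n + 1"
      using x1 s1 by (auto simp: n_def)
    then have n: "real n * s \<le> x" "x \<le> real n * s + s" "\<bar>real n - x / s\<bar> \<le> 1"
      using s1 by (auto simp: field_simps)
    then have y: "y \<in> {0..s}" by (auto simp: y_def)
    have "\<bar>\<theta> (y + real n * s) - \<theta> y - real n * c\<bar> \<le> real n * 2"
      by (rule translation_multiple_bound[where \<theta>=\<theta> and s=s and c=c and b=2, OF k'])
    then have 1: "\<bar>\<theta> x - \<theta> y - real n * c\<bar> \<le> real n * 2" by (simp add: y_def)
    have 2: "\<bar>(real n - x / s) * c\<bar> \<le> \<bar>c\<bar>"
      using mult_right_mono[OF n(3), of "\<bar>c\<bar>"] by (simp add: abs_mult)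
    have 3: "real n * 2 \<le> e / 2 * x"
    proof -
      have "real n * 2 \<le> real n * (e / 2 * s)" using s1(3) by (intro mult_left_mono) auto
      also have "\<dots> = e / 2 * (real n * s)" by simp
      also have "\<dots> \<le> e / 2 * x" using n(1) e by (intro mult_left_mono) auto
      finally show ?thesis .
    qed
    have "\<theta> x - \<theta> 0 - x * (c / s) = (\<theta> x - \<theta> y - real n * c) + (\<theta> y - \<theta> 0) + (real n - x / s) * c"
      by (simp add: algebra_simps)
    then have "\<bar>\<theta> x - \<theta> 0 - x * (c / s)\<bar> \<le> real n * 2 + M + \<bar>c\<bar>"
      using 1 2 M[OF y] by linarith
    also have "\<dots> \<le> e / 2 * x + e / 2 * x" using 3 x1(2) by linarith
    also have "\<dots> = e * x" by simp
    finally have "\<bar>\<theta> x - \<theta> 0 - x * (c / s)\<bar> / x \<le> e" using x1(1) by (simp add: field_simps)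
    moreover have "(\<theta> x - \<theta> 0) / x - c / s = (\<theta> x - \<theta> 0 - x * (c / s)) / x"
      using x1(1) by (simp add: field_simps)
    ultimately show ?thesis using x1(1) by (simp add: abs_divide)
  qed
  then show "\<exists>z T0. \<forall>x\<ge>T0. \<bar>(\<theta> x - \<theta> 0) / x - z\<bar> \<le> e" by blast
qed

text \<open>All steps of length \<open>s\<close> stay within \<open>arcsin e\<close> of one multiple
  \<open>k * pi\<close>, and averaging over many steps preserves this, so \<open>\<rho> * s\<close>
  is within \<open>arcsin e\<close> of \<open>k * pi\<close>. For negative \<open>s\<close> the two
  end points of a step exchange roles.\<close>

lemma abs_sin_mean_slope_le:
  fixes \<theta> :: "real \<Rightarrow> real"
  assumes cont: "continuous_on UNIV \<theta>"
    and lim: "((\<lambda>x. (\<theta> x - \<theta> 0) / x) \<longlongrightarrow> \<rho>) at_top"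
    and sin: "\<And>x. \<bar>sin (\<theta> (x + s) - \<theta> x)\<bar> \<le> e" and e: "e < 1"
  shows "\<bar>sin (\<rho> * s)\<bar> \<le> e"
proof -
  have e0: "0 \<le> e" using sin[of 0] by linarith
  have pos: "\<bar>sin (\<rho> * s)\<bar> \<le> e" if s: "s > 0" and sin: "\<And>x. \<bar>sin (\<theta> (x + s) - \<theta> x)\<bar> \<le> e" for s
  proof -
    have cs: "continuous_on UNIV (\<lambda>x. \<theta> (x + s) - \<theta> x)"
      by (intro continuous_on_diff cont continuous_on_compose2[OF cont]) (auto intro: continuous_intros)
    obtain k :: int where k: "\<And>x. \<bar>\<theta> (x + s) - \<theta> x - of_int k * pi\<bar> \<le> arcsin e"
      using sin_le_imp_near_int_pi[OF cs sin e] by blast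
    \<comment> \<open>\<open>Suc n\<close> keeps the sampling points away from 0, where the slope
      quotient degenerates.\<close>
    have "filterlim (\<lambda>n. real (Suc n) * s) at_top sequentially"
      by (rule filterlim_at_top_mult_tendsto_pos[OF tendsto_const s])
        (rule filterlim_compose[OF filterlim_real_sequentially filterlim_Suc])
    from filterlim_compose[OF lim this]
    have "(\<lambda>n. (\<theta> (real (Suc n) * s) - \<theta> 0) / (real (Suc n) * s)) \<longlonglongrightarrow> \<rho>" .
    then have "(\<lambda>n. \<bar>(\<theta> (real (Suc n) * s) - \<theta> 0) / (real (Suc n) * s) * s - of_int k * pi\<bar>) \<longlonglongrightarrow> \<bar>\<rho> * s - of_int k * pi\<bar>"
      by (intro tendsto_intros)
    moreover have "\<bar>(\<theta> (real (Suc n) * s) - \<theta> 0) / (real (Suc n) * s) * s - of_int k * pi\<bar> \<le> arcsin e" for n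
    proof -
      define N where "N = real (Suc n)"
      have N: "N > 0" by (simp add: N_def)
      have "\<bar>\<theta> (0 + N * s) - \<theta> 0 - N * (of_int k * pi)\<bar> \<le> N * arcsin e"
        unfolding N_def by (rule translation_multiple_bound[where \<theta>=\<theta> and s=s and c="of_int k * pi" and b="arcsin e", OF k])
      then have "\<bar>\<theta> (N * s) - \<theta> 0 - N * (of_int k * pi)\<bar> / N \<le> arcsin e"
        using N by (simp add: field_simps)
      moreover have "(\<theta> (N * s) - \<theta> 0) / (N * s) * s - of_int k * pi = (\<theta> (N * s) - \<theta> 0 - N * (of_int k * pi)) / N"
        using N s by (simp add: field_simps)
      ultimately show ?thesis unfolding N_def[symmetric] using N by (simp add: abs_divide)
    qed
    ultimately have le: "\<bar>\<rho> * s - of_int k * pi\<bar> \<le> arcsin e"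
      by (intro tendsto_upperbound[of "\<lambda>n. \<bar>(\<theta> (real (Suc n) * s) - \<theta> 0) / (real (Suc n) * s) * s - of_int k * pi\<bar>"])
        (auto intro!: always_eventually)
    define y where "y = \<bar>\<rho> * s - of_int k * pi\<bar>"
    have y: "0 \<le> y" "y \<le> arcsin e" using le by (auto simp: y_def)
    have "arcsin e \<le> pi / 2" using e e0 by (intro arcsin_ubound) auto
    then have "sin y \<le> sin (arcsin e)" using y pi_gt_zero by (intro sin_monotone_2pi_le) auto
    also have "\<dots> = e" using e e0 by (intro sin_arcsin) auto
    finally have "sin y \<le> e" .
    moreover have "0 \<le> sin y" using y \<open>arcsin e \<le> pi / 2\<close> pi_gt_zero by (intro sin_ge_zero) auto
    moreover have "\<bar>sin y\<bar> = \<bar>sin (\<rho> * s - of_int k * pi)\<bar>" by (simp only: y_def abs_sin_abs)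
    ultimately show ?thesis by (simp add: abs_sin_diff_int_pi)
  qed
  consider "s > 0" | "s = 0" | "s < 0" by linarith
  then show ?thesis
  proof cases
    case 1
    then show ?thesis using pos[OF 1 sin] by simp
  next
    case 2
    then show ?thesis using e0 by simp
  next
    case 3
    have "\<bar>sin (\<theta> (x + - s) - \<theta> x)\<bar> \<le> e" for x
    proof -
      have "\<bar>sin (\<theta> (x + - s) - \<theta> x)\<bar> = \<bar>sin (- (\<theta> (x + - s) - \<theta> x))\<bar>"
        by (simp only: sin_minus abs_minus_cancel)
      also have "- (\<theta> (x + - s) - \<theta> x) = \<theta> ((x + - s) + s) - \<theta> (x + - s)" by simp
      finally show ?thesis using sin[of "x + - s"] by simp
    qed
    from pos[OF _ this] 3 show ?thesis by simp
  qed
qed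

lemma mean_slope_cong_of_bounded:
  fixes \<theta>1 \<theta>2 :: "real \<Rightarrow> real"
  assumes lim: "((\<lambda>x. (\<theta>1 x - \<theta>1 0) / x) \<longlongrightarrow> \<rho>) at_top"
    and b: "\<And>x. \<bar>\<theta>1 x - \<theta>2 x\<bar> \<le> b"
  shows "((\<lambda>x. (\<theta>2 x - \<theta>2 0) / x) \<longlongrightarrow> \<rho>) at_top"
proof -
  have "((\<lambda>x. ((\<theta>2 x - \<theta>1 x) - (\<theta>2 0 - \<theta>1 0)) / x) \<longlongrightarrow> 0) at_top"
  proof (rule Lim_null_comparison)
    show "\<forall>\<^sub>F x in at_top. norm (((\<theta>2 x - \<theta>1 x) - (\<theta>2 0 - \<theta>1 0)) / x) \<le> 2 * b * inverse x"
      using eventually_gt_at_top[of 0]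
    proof eventually_elim
      case (elim x)
      have "\<bar>(\<theta>2 x - \<theta>1 x) - (\<theta>2 0 - \<theta>1 0)\<bar> \<le> 2 * b" using b[of x] b[of 0] by linarith
      then have "\<bar>(\<theta>2 x - \<theta>1 x) - (\<theta>2 0 - \<theta>1 0)\<bar> / x \<le> 2 * b / x" using elim by (intro divide_right_mono) auto
      then show ?case using elim by (simp add: divide_inverse abs_mult)
    qed
    show "((\<lambda>x. 2 * b * inverse x) \<longlongrightarrow> 0) at_top"
      by (intro tendsto_mult_right_zero tendsto_inverse_0_at_top filterlim_ident)
  qed
  from tendsto_add[OF lim this] have "((\<lambda>x. (\<theta>1 x - \<theta>1 0) / x + ((\<theta>2 x - \<theta>1 x) - (\<theta>2 0 - \<theta>1 0)) / x) \<longlongrightarrow> \<rho>) at_top"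
    by simp
  then show ?thesis by (simp add: add_divide_distrib[symmetric])
qed

section \<open>Phases of solutions\<close>

definition is_phase :: "(real \<Rightarrow> real) \<Rightarrow> (real \<Rightarrow> real) \<Rightarrow> (real \<Rightarrow> real) \<Rightarrow> bool" where
  "is_phase u v \<theta> \<longleftrightarrow> continuous_on UNIV \<theta> \<and>
    (\<forall>x. u x = sqrt (energy u v x) * sin (\<theta> x) \<and> v x = sqrt (energy u v x) * cos (\<theta> x))"

lemma is_phase_iff_is_Arg:
  "is_phase u v \<theta> \<longleftrightarrow> continuous_on UNIV \<theta> \<and> (\<forall>x. is_Arg (Complex (v x) (u x)) (\<theta> x))"
proof -
  have "is_Arg (Complex (v x) (u x)) (\<theta> x) \<longleftrightarrow>
      u x = sqrt (energy u v x) * sin (\<theta> x) \<and> v x = sqrt (energy u v x) * cos (\<theta> x)" for x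
  proof -
    have "norm (Complex (v x) (u x)) = sqrt (energy u v x)" by (simp add: cmod_def energy_def add.commute)
    then show ?thesis
      by (auto simp: is_Arg_def cis_conv_exp[symmetric] complex_eq_iff)
  qed
  then show ?thesis by (simp add: is_phase_def)
qed

text \<open>A continuous function without zeros on the contractible real line has a continuous
  logarithm, whose imaginary part is the phase.\<close>

lemma phase_exists:
  assumes sys: "linear_system a r u v" and pos: "\<And>x. energy u v x > 0"
  shows "\<exists>\<theta>. is_phase u v \<theta>"
proof -
  define z where "z = (\<lambda>x. complex_of_real (v x) + \<i> * complex_of_real (u x))"
  have zC: "z x = Complex (v x) (u x)" for x by (simp add: z_def complex_eq_iff)
  have cz: "continuous_on UNIV z"
    unfolding z_def by (intro continuous_intros linear_system_continuous[OF sys])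
  have z0: "z x \<noteq> 0" for x
    using pos[of x] by (auto simp: zC complex_eq_iff energy_def)
  have "contractible (UNIV :: real set)" by (intro convex_imp_contractible convex_UNIV)
  from continuous_logarithm_on_contractible[OF cz this] z0
  obtain g where g: "continuous_on UNIV g" "\<And>x. z x = exp (g x)" by auto
  have "is_Arg (Complex (v x) (u x)) (Im (g x))" for x
  proof -
    show ?thesis
      unfolding is_Arg_def zC[symmetric] g(2) norm_exp_eq_Re using exp_eq_polar[of "g x"] unfolding cis_conv_exp .
  qed
  moreover have "continuous_on UNIV (\<lambda>x. Im (g x))" by (intro continuous_intros g(1))
  ultimately show ?thesis unfolding is_phase_iff_is_Arg by blast
qed

lemma wronskian_phase:
  assumes "is_phase u1 v1 \<theta>1" "is_phase u2 v2 \<theta>2"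
  shows "u1 x * v2 y - v1 x * u2 y = sqrt (energy u1 v1 x * energy u2 v2 y) * sin (\<theta>1 x - \<theta>2 y)"
proof -
  define A where "A = sqrt (energy u1 v1 x)"
  define C where "C = sqrt (energy u2 v2 y)"
  have h: "u1 x = A * sin (\<theta>1 x)" "v1 x = A * cos (\<theta>1 x)" "u2 y = C * sin (\<theta>2 y)" "v2 y = C * cos (\<theta>2 y)"
    using assms unfolding is_phase_def A_def C_def by blast+
  show ?thesis
    unfolding real_sqrt_mult A_def[symmetric] C_def[symmetric] h sin_diff by (simp add: algebra_simps)
qed

text \<open>The Wronskian is a constant \<open>W\<close>. If \<open>W = 0\<close>, the sine of the
  phase difference vanishes identically; otherwise it has no zeros. In either case the difference is
  confined to an interval of length \<open>pi\<close>, which makes the rotation number independent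
  of the solution.\<close>

lemma phase_difference_bounded:
  assumes s1: "linear_system a r u1 v1" and s2: "linear_system a r u2 v2"
    and ph1: "is_phase u1 v1 \<theta>1" and ph2: "is_phase u2 v2 \<theta>2"
    and pos1: "\<And>x. energy u1 v1 x > 0" and pos2: "\<And>x. energy u2 v2 x > 0"
  shows "\<exists>b. \<forall>x. \<bar>\<theta>1 x - \<theta>2 x\<bar> \<le> b"
proof -
  have c: "continuous_on UNIV (\<lambda>x. \<theta>1 x - \<theta>2 x)"
    using ph1 ph2 by (intro continuous_on_diff) (auto simp: is_phase_def)
  define W where "W = u1 0 * v2 0 - v1 0 * u2 0"
  have W: "sqrt (energy u1 v1 x * energy u2 v2 x) * sin (\<theta>1 x - \<theta>2 x) = W" for x
    using wronskian_phase[OF ph1 ph2, of x x] wronskian_constant[OF s1 s2, of x 0] by (simp add: W_def)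
  have sq: "sqrt (energy u1 v1 x * energy u2 v2 x) > 0" for x using pos1[of x] pos2[of x] by simp
  show ?thesis
  proof (cases "W = 0")
    case True
    have "sin (\<theta>1 x - \<theta>2 x) = 0" for x
      using W[of x] sq[of x] True by (metis less_irrefl mult_eq_0_iff)
    then have "\<bar>sin (\<theta>1 x - \<theta>2 x)\<bar> < 1" for x by simp
    then obtain k :: int where k: "\<And>x. \<bar>\<theta>1 x - \<theta>2 x - of_int k * pi\<bar> < pi / 2"
      using sin_bounded_imp_near_int_pi[OF c] by blast
    have "\<bar>\<theta>1 x - \<theta>2 x\<bar> \<le> pi / 2 + \<bar>of_int k * pi\<bar>" for x using k[of x] by linarith
    then show ?thesis by blast
  next
    case False
    \<comment> \<open>Shifting by \<open>pi / 2\<close> turns a sine without zeros into one of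
      modulus less than 1, to which the confinement result applies.\<close>
    have s: "\<bar>sin (\<theta>1 x - \<theta>2 x + pi / 2)\<bar> < 1" for x
    proof -
      have "sin (\<theta>1 x - \<theta>2 x) \<noteq> 0" using W[of x] False by auto
      then have "(sin (\<theta>1 x - \<theta>2 x))\<^sup>2 > 0" by (rule zero_less_power2[THEN iffD2])
      then have "(cos (\<theta>1 x - \<theta>2 x))\<^sup>2 < 1" using sin_cos_squared_add[of "\<theta>1 x - \<theta>2 x"] by linarith
      then have "\<bar>cos (\<theta>1 x - \<theta>2 x)\<bar> < 1" by (simp add: abs_square_less_1)
      then show ?thesis by (simp add: sin_add)
    qed
    have c': "continuous_on UNIV (\<lambda>x. \<theta>1 x - \<theta>2 x + pi / 2)" by (intro continuous_on_add c continuous_on_const)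
    obtain k :: int where k: "\<And>x. \<bar>\<theta>1 x - \<theta>2 x + pi / 2 - of_int k * pi\<bar> < pi / 2"
      using sin_bounded_imp_near_int_pi[OF c' s] by blast
    have "\<bar>\<theta>1 x - \<theta>2 x\<bar> \<le> pi + \<bar>of_int k * pi\<bar>" for x using k[of x] by linarith
    then show ?thesis by blast
  qed
qed

lemma SL_solution_iff_linear_system:
  assumes p: "\<And>x. p x \<noteq> 0"
  shows "SL_solution p q w l u \<longleftrightarrow> linear_system (\<lambda>x. 1 / p x) (\<lambda>x. q x - l * w x) u (\<lambda>x. p x * deriv u x)"
proof
  assume s: "SL_solution p q w l u"
  define v where "v = (\<lambda>x. p x * deriv u x)"
  have s': "\<And>x. u differentiable at x" "\<And>x. v differentiable at x" "\<And>x. - deriv v x + q x * u x = l * w x * u x"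
    using s unfolding SL_solution_def v_def by blast+
  have "(u has_real_derivative 1 / p x * v x) (at x)" for x
    using s'(1)[of x] p[of x] by (simp add: v_def DERIV_deriv_iff_real_differentiable)
  moreover have "(v has_real_derivative (q x - l * w x) * u x) (at x)" for x
  proof -
    have "deriv v x = (q x - l * w x) * u x" using s'(3)[of x] by (simp add: left_diff_distrib)
    then show ?thesis using s'(2)[of x] DERIV_deriv_iff_real_differentiable[of v x] by simp
  qed
  ultimately show "linear_system (\<lambda>x. 1 / p x) (\<lambda>x. q x - l * w x) u (\<lambda>x. p x * deriv u x)"
    unfolding linear_system_def v_def by blast
next
  assume s: "linear_system (\<lambda>x. 1 / p x) (\<lambda>x. q x - l * w x) u (\<lambda>x. p x * deriv u x)"
  define v where "v = (\<lambda>x. p x * deriv u x)"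
  have d: "(u has_real_derivative 1 / p x * v x) (at x)" "(v has_real_derivative (q x - l * w x) * u x) (at x)" for x
    using linear_systemD[OF s, of x UNIV] by (simp_all add: v_def)
  have "u differentiable at x" "v differentiable at x" "deriv v x = (q x - l * w x) * u x" for x
    using d[of x] by (auto simp: real_differentiable_def intro: DERIV_imp_deriv)
  then show "SL_solution p q w l u"
    unfolding SL_solution_def v_def by (simp add: left_diff_distrib)
qed

lemma linear_system_quasi_deriv:
  assumes p: "\<And>x. p x \<noteq> 0" and s: "linear_system (\<lambda>x. 1 / p x) r u v"
  shows "(\<lambda>x. p x * deriv u x) = v"
proof
  fix x
  have "deriv u x = 1 / p x * v x" by (rule DERIV_imp_deriv[OF linear_systemD(1)[OF s]])
  then show "p x * deriv u x = v x" using p[of x] by simp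
qed

text \<open>The definite description behind \<open>rotation_number\<close> requires existence and
  uniqueness. The limit passes from the given solution to all others through bounded phase
  differences. Uniqueness requires at least one nontrivial solution with a phase branch, and the
  given one serves.\<close>

lemma has_rotation_numberI:
  fixes p q w :: "real \<Rightarrow> real"
  assumes p: "\<And>x. p x \<noteq> 0"
    and Ba: "\<And>x. \<bar>1 / p x\<bar> \<le> B" and Br: "\<And>x. \<bar>q x - l * w x\<bar> \<le> B"
    and sys: "linear_system (\<lambda>x. 1 / p x) (\<lambda>x. q x - l * w x) u v"
    and pos: "\<And>x. energy u v x > 0" and ph: "is_phase u v \<theta>"
    and lim: "((\<lambda>x. (\<theta> x - \<theta> 0) / x) \<longlongrightarrow> \<rho>) at_top"
  shows "rotation_number p q w l = \<rho>"
proof -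
  have has: "has_rotation_number p q w l \<rho>"
    unfolding has_rotation_number_def
  proof (intro allI impI)
    fix \<phi> \<theta>'
    assume A: "SL_solution p q w l \<phi> \<and> (\<exists>x. \<phi> x \<noteq> 0) \<and> phase_branch p \<phi> \<theta>'"
    define v' where "v' = (\<lambda>x. p x * deriv \<phi> x)"
    have sys': "linear_system (\<lambda>x. 1 / p x) (\<lambda>x. q x - l * w x) \<phi> v'"
      using A SL_solution_iff_linear_system[OF p] by (simp add: v'_def)
    obtain y where "\<phi> y \<noteq> 0" using A by blast
    then have "energy \<phi> v' y > 0" by (simp add: energy_def add_pos_nonneg)
    then have pos': "energy \<phi> v' x > 0" for x by (rule energy_pos[OF sys' Ba Br])
    have ph': "is_phase \<phi> v' \<theta>'"
      using A unfolding is_phase_iff_is_Arg phase_branch_def v'_def by blast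
    obtain b where "\<And>x. \<bar>\<theta> x - \<theta>' x\<bar> \<le> b"
      using phase_difference_bounded[OF sys sys' ph ph' pos pos'] by blast
    then show "((\<lambda>x. (\<theta>' x - \<theta>' 0) / x) \<longlongrightarrow> \<rho>) at_top"
      by (rule mean_slope_cong_of_bounded[OF lim])
  qed
  have q: "(\<lambda>x. p x * deriv u x) = v" by (rule linear_system_quasi_deriv[OF p sys])
  have sol: "SL_solution p q w l u"
    using sys unfolding SL_solution_iff_linear_system[OF p] q .
  have nt: "\<exists>x. u x \<noteq> 0"
  proof (rule ccontr)
    assume "\<not> (\<exists>x. u x \<noteq> 0)"
    then have u0: "u = (\<lambda>x. 0)" by auto
    have "v x = 0" for x
      using q by (auto simp: u0)
    then show False using pos[of 0] by (simp add: energy_def u0)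
  qed
  have br: "phase_branch p u \<theta>"
  proof -
    have vx: "v x = p x * deriv u x" for x using fun_cong[OF q, of x] by simp
    show ?thesis using ph unfolding is_phase_iff_is_Arg phase_branch_def vx .
  qed
  show ?thesis
    unfolding rotation_number_def
  proof (rule the_equality[where P="has_rotation_number p q w l", OF has])
    fix \<rho>' assume "has_rotation_number p q w l \<rho>'"
    then have "((\<lambda>x. (\<theta> x - \<theta> 0) / x) \<longlongrightarrow> \<rho>') at_top"
      using sol nt br unfolding has_rotation_number_def by blast
    with lim show "\<rho>' = \<rho>" by (intro tendsto_unique[OF trivial_limit_at_top_linorder])
  qed
qed

subsection \<open>Rotation number in a spectral gap\<close>

text \<open>Without a positive lower bound there are points with
  \<open>p (s n) < 1 / (n + 1)\<close>; moving them to 0 produces, in the limit, a member of the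
  hull that is not positive at 0.\<close>

lemma almost_periodic_pos_lower_bound:
  assumes "almost_periodic_pos p"
  obtains c where "c > 0" "\<And>x. c \<le> p x"
proof -
  have ap: "almost_periodic p" and pos: "\<And>g x. g \<in> ap_hull p \<Longrightarrow> g x > 0"
    using assms by (auto simp: almost_periodic_pos_def)
  have "\<exists>n. \<forall>x. inverse (real (Suc n)) \<le> p x"
  proof (rule ccontr)
    assume "\<not> (\<exists>n. \<forall>x. inverse (real (Suc n)) \<le> p x)"
    then have "\<forall>n. \<exists>x. p x < inverse (real (Suc n))" by (simp add: not_le)
    from choice[OF this] obtain s where s: "\<And>n. p (s n) < inverse (real (Suc n))" by blast
    obtain r g where r: "strict_mono r" and g: "uniform_limit UNIV (\<lambda>n x. p (x + s (r n))) g sequentially"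
      using almost_periodic_subseq[OF ap, of s] by blast
    have "g \<in> ap_hull p"
      unfolding ap_hull_def
    proof (intro CollectI allI impI)
      fix e :: real assume "e > 0"
      then obtain N where "\<forall>n\<ge>N. \<forall>x\<in>UNIV. dist (p (x + s (r n))) (g x) < e"
        using g unfolding uniform_limit_sequentially_iff by blast
      then show "\<exists>t. \<forall>x. dist (p (x + t)) (g x) < e" by blast
    qed
    then have g0: "g 0 > 0" by (rule pos)
    have lim_p: "(\<lambda>n. p (0 + s (r n))) \<longlonglongrightarrow> g 0"
      by (rule tendsto_uniform_limitI[OF g]) simp
    have lim_0: "(\<lambda>n. inverse (real (Suc (r n)))) \<longlonglongrightarrow> 0"
      using LIMSEQ_subseq_LIMSEQ[OF LIMSEQ_inverse_real_of_nat r] by (simp add: o_def)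
    have "p (0 + s (r n)) \<le> inverse (real (Suc (r n)))" for n
      using s[of "r n"] by simp
    then have "g 0 \<le> 0" by (intro LIMSEQ_le[OF lim_p lim_0]) blast
    with g0 show False by simp
  qed
  then obtain n where "\<And>x. inverse (real (Suc n)) \<le> p x" by blast
  moreover have "inverse (real (Suc n)) > 0" by simp
  ultimately show thesis using that by blast
qed

text \<open>Differences of shifts along a convergent subsequence are almost periods. The shifts are
  multiples of \<open>L'\<close>, so two distinct ones are at least \<open>L'\<close> apart.\<close>

lemma large_common_almost_period:
  fixes F :: "(real \<Rightarrow> real) set"
  assumes F: "finite F" "\<And>f. f \<in> F \<Longrightarrow> almost_periodic f" and e: "e > 0"
  shows "\<exists>s\<ge>L. \<forall>f\<in>F. \<forall>x. \<bar>f (x + s) - f x\<bar> < e"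
proof -
  define L' where "L' = max 1 L"
  define s where "s n = real n * L'" for n
  obtain r where r: "strict_mono r"
    and lim: "\<And>f. f \<in> F \<Longrightarrow> \<exists>g. uniform_limit UNIV (\<lambda>n x. f (x + s (r n))) g sequentially"
    using almost_periodic_common_subseq[OF F, of s] by blast
  have "\<forall>f\<in>F. \<exists>N. \<forall>n\<ge>N. \<forall>m\<ge>N. \<forall>x. \<bar>f (x + s (r n)) - f (x + s (r m))\<bar> < e"
  proof
    fix f assume "f \<in> F"
    then obtain g where g: "uniform_limit UNIV (\<lambda>n x. f (x + s (r n))) g sequentially" using lim by blast
    have "e / 2 > 0" using e by simp
    then obtain N where N: "\<And>n x. n \<ge> N \<Longrightarrow> dist (f (x + s (r n))) (g x) < e / 2"
      using g unfolding uniform_limit_sequentially_iff by blast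
    have "\<bar>f (x + s (r n)) - f (x + s (r m))\<bar> < e" if "n \<ge> N" "m \<ge> N" for n m x
      using N[OF that(1), of x] N[OF that(2), of x] unfolding dist_real_def by linarith
    then show "\<exists>N. \<forall>n\<ge>N. \<forall>m\<ge>N. \<forall>x. \<bar>f (x + s (r n)) - f (x + s (r m))\<bar> < e" by blast
  qed
  from bchoice[OF this] obtain N
    where N: "\<And>f n m x. f \<in> F \<Longrightarrow> n \<ge> N f \<Longrightarrow> m \<ge> N f \<Longrightarrow> \<bar>f (x + s (r n)) - f (x + s (r m))\<bar> < e"
    by blast
  define M where "M = Max (insert 0 (N ` F))"
  have M: "N f \<le> M" if "f \<in> F" for f using that F(1) by (simp add: M_def)
  define t where "t = s (r (Suc M)) - s (r M)"
  have "r M < r (Suc M)" using r by (simp add: strict_mono_def)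
  then have "1 * L' \<le> (real (r (Suc M)) - real (r M)) * L'"
    by (intro mult_right_mono) (auto simp: L'_def)
  then have "L' \<le> t" by (simp add: t_def s_def left_diff_distrib)
  then have "L \<le> t" by (simp add: L'_def)
  moreover have "\<bar>f (x + t) - f x\<bar> < e" if f: "f \<in> F" for f x
    using N[OF f, of "Suc M" M "x - s (r M)"] M[OF f] by (simp add: t_def algebra_simps)
  ultimately show ?thesis by blast
qed

text \<open>Dividing the Wronskian bound by the product of the amplitudes leaves the sine, with a
  bound uniform in \<open>x\<close>.\<close>

lemma abs_sin_phase_diff_le:
  assumes s1: "linear_system a1 r1 u1 v1" and s2: "linear_system a2 r2 u2 v2"
    and D1: "\<And>s X. s \<le> X \<Longrightarrow> integral {s..X} (energy u1 v1) \<le> K * energy u1 v1 s"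
    and D2: "\<And>s X. s \<le> X \<Longrightarrow> integral {s..X} (energy u2 v2) \<le> K * energy u2 v2 s"
    and da: "\<And>y. \<bar>a1 y - a2 y\<bar> \<le> d" and dr: "\<And>y. \<bar>r1 y - r2 y\<bar> \<le> d"
    and pos1: "\<And>x. energy u1 v1 x > 0" and pos2: "\<And>x. energy u2 v2 x > 0"
    and ph1: "is_phase u1 v1 \<theta>1" and ph2: "is_phase u2 v2 \<theta>2"
  shows "\<bar>sin (\<theta>1 x - \<theta>2 x)\<bar> \<le> d * K"
proof -
  define S where "S = sqrt (energy u1 v1 x * energy u2 v2 x)"
  have S: "S > 0" using pos1[of x] pos2[of x] by (simp add: S_def)
  have "\<bar>u1 x * v2 x - v1 x * u2 x\<bar> \<le> d * (K + K) / 2 * S"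
    unfolding S_def by (rule decaying_solutions_close[OF s1 s2 D1 D2 da dr pos1 pos2])
  then have "S * \<bar>sin (\<theta>1 x - \<theta>2 x)\<bar> \<le> S * (d * K)"
    using S unfolding wronskian_phase[OF ph1 ph2] S_def[symmetric] abs_mult by (simp add: mult.commute)
  then show ?thesis using S by simp
qed

lemma is_phase_shift:
  assumes "is_phase u v \<theta>"
  shows "is_phase (\<lambda>x. u (x + s)) (\<lambda>x. v (x + s)) (\<lambda>x. \<theta> (x + s))"
proof -
  have "continuous_on UNIV \<theta>" using assms by (simp add: is_phase_def)
  then have "continuous_on UNIV (\<lambda>x. \<theta> (x + s))"
    by (rule continuous_on_compose2) (auto intro: continuous_intros)
  then show ?thesis using assms by (simp add: is_phase_def energy_def)
qed

lemma energy_shift: "energy (\<lambda>x. u (x + s)) (\<lambda>x. v (x + s)) x = energy u v (x + s)"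
  by (simp add: energy_def)

lemma decay_shift:
  assumes D: "\<And>s X. s \<le> X \<Longrightarrow> integral {s..X} (energy u v) \<le> K * energy u v s" and le: "t \<le> X"
  shows "integral {t..X} (energy (\<lambda>x. u (x + s)) (\<lambda>x. v (x + s))) \<le> K * energy (\<lambda>x. u (x + s)) (\<lambda>x. v (x + s)) t"
proof -
  have "energy (\<lambda>x. u (x + s)) (\<lambda>x. v (x + s)) = energy u v \<circ> (+) s"
    by (simp add: fun_eq_iff energy_def add.commute)
  then have "integral {t..X} (energy (\<lambda>x. u (x + s)) (\<lambda>x. v (x + s))) = integral {t + s..X + s} (energy u v)"
    using integral_shift_Icc_real[of t X "energy u v" s] by simp
  with D[of "t + s" "X + s"] le show ?thesis by (simp add: energy_shift)
qed

text \<open>The rotation number in a gap is the mean slope of the phase of the solution decaying at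
  \<open>+\<infinity>\<close>, which inherits the almost periods of the coefficients.\<close>

lemma gap_rotation_number:
  fixes p q w :: "real \<Rightarrow> real"
  assumes cp: "continuous_on UNIV p" and cq: "continuous_on UNIV q" and cw: "continuous_on UNIV w"
    and p: "\<And>x. p x \<noteq> 0"
    and Ba: "\<And>x. \<bar>1 / p x\<bar> \<le> B" and Br: "\<And>x. \<bar>q x - l * w x\<bar> \<le> B"
    and K: "\<And>u v s t. linear_system (\<lambda>x. 1 / p x) (\<lambda>x. q x - l * w x) u v \<Longrightarrow> s \<le> t \<Longrightarrow>
      integral {s..t} (energy u v) \<le> K * (energy u v s + energy u v t)"
    and rec: "\<And>d L. d > 0 \<Longrightarrow> \<exists>s\<ge>L. \<forall>x. \<bar>1 / p (x + s) - 1 / p x\<bar> \<le> d \<and>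
      \<bar>(q (x + s) - l * w (x + s)) - (q x - l * w x)\<bar> \<le> d"
  shows "\<exists>u v \<theta>. linear_system (\<lambda>x. 1 / p x) (\<lambda>x. q x - l * w x) u v \<and>
      (\<forall>x. energy u v x > 0) \<and> (\<forall>s X. s \<le> X \<longrightarrow> integral {s..X} (energy u v) \<le> K * energy u v s) \<and>
      is_phase u v \<theta> \<and> ((\<lambda>x. (\<theta> x - \<theta> 0) / x) \<longlongrightarrow> rotation_number p q w l) at_top \<and>
      (\<forall>s d. (\<forall>x. \<bar>1 / p (x + s) - 1 / p x\<bar> \<le> d) \<longrightarrow>
        (\<forall>x. \<bar>(q (x + s) - l * w (x + s)) - (q x - l * w x)\<bar> \<le> d) \<longrightarrow> d * K < 1 \<longrightarrow>
        \<bar>sin (rotation_number p q w l * s)\<bar> \<le> d * K)"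
proof -
  define a where "a = (\<lambda>x. 1 / p x)"
  define r where "r = (\<lambda>x. q x - l * w x)"
  have ca: "continuous_on UNIV a" unfolding a_def by (intro continuous_intros cp) (use p in simp)
  have cr: "continuous_on UNIV r" unfolding r_def by (intro continuous_intros cq cw)
  have Ba': "\<bar>a x\<bar> \<le> B" and Br': "\<bar>r x\<bar> \<le> B" for x using Ba Br by (simp_all add: a_def r_def)
  obtain u v where sys: "linear_system a r u v" and e0: "energy u v 0 = 1"
    and decay: "\<And>s X. s \<le> X \<Longrightarrow> integral {s..X} (energy u v) \<le> K * energy u v s"
    using decaying_solution_exists[OF ca cr Ba' Br' K[folded a_def r_def]] by blast
  have pos: "energy u v x > 0" for x
    by (rule energy_pos[OF sys Ba' Br', of 0]) (simp add: e0)
  obtain \<theta> where ph: "is_phase u v \<theta>" using phase_exists[OF sys pos] by blast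
  have c\<theta>: "continuous_on UNIV \<theta>" using ph by (simp add: is_phase_def)
  have K0: "K \<ge> 0"
    using decay[of 0 0] by (simp add: e0)
  \<comment> \<open>The translated solution decays for the translated coefficients with the same
    \<open>K\<close>, so it can be compared with the solution itself.\<close>
  have close: "\<bar>sin (\<theta> (x + s) - \<theta> x)\<bar> \<le> d * K"
    if "\<And>x. \<bar>a (x + s) - a x\<bar> \<le> d" "\<And>x. \<bar>r (x + s) - r x\<bar> \<le> d" for s d x
  proof -
    have D': "integral {t..X} (energy (\<lambda>x. u (x + s)) (\<lambda>x. v (x + s))) \<le> K * energy (\<lambda>x. u (x + s)) (\<lambda>x. v (x + s)) t"
      if "t \<le> X" for t X
      by (rule decay_shift[OF decay that])
    have pos': "energy (\<lambda>x. u (x + s)) (\<lambda>x. v (x + s)) x > 0" for x unfolding energy_shift by (rule pos)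
    show ?thesis
      by (rule abs_sin_phase_diff_le[where ?\<theta>1.0="\<lambda>x. \<theta> (x + s)" and ?\<theta>2.0=\<theta> and x=x and d=d and K=K,
            OF linear_system_shift[OF sys, of s] sys D' decay that(1) that(2) pos' pos is_phase_shift[OF ph] ph])
  qed
  have "\<exists>s\<ge>L. \<forall>x. \<bar>sin (\<theta> (x + s) - \<theta> x)\<bar> \<le> 1 / 2" for L
  proof -
    \<comment> \<open>Makes \<open>d * K \<le> 1 / 2\<close>; adding 1 to \<open>K\<close> covers
      the case \<open>K = 0\<close>.\<close>
    define d where "d = 1 / (2 * (K + 1))"
    have d: "d > 0" using K0 by (simp add: d_def)
    have "d * K \<le> d * (K + 1)" using d by (intro mult_left_mono) auto
    also have "d * (K + 1) = 1 / 2" using K0 by (simp add: d_def)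
    finally have dK: "d * K \<le> 1 / 2" .
    obtain s where s: "s \<ge> L" "\<And>x. \<bar>a (x + s) - a x\<bar> \<le> d" "\<And>x. \<bar>r (x + s) - r x\<bar> \<le> d"
      using rec[OF d, of L] unfolding a_def r_def by blast
    have "\<bar>sin (\<theta> (x + s) - \<theta> x)\<bar> \<le> 1 / 2" for x
      using close[OF s(2,3), of x] dK by linarith
    with s(1) show ?thesis by blast
  qed
  from mean_slope_exists[OF c\<theta> this] obtain \<rho> where lim: "((\<lambda>x. (\<theta> x - \<theta> 0) / x) \<longlongrightarrow> \<rho>) at_top" by blast
  have \<rho>: "rotation_number p q w l = \<rho>"
    by (rule has_rotation_numberI[OF p Ba Br sys[unfolded a_def r_def] pos ph lim])
  have sin: "\<bar>sin (\<rho> * s)\<bar> \<le> d * K"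
    if "\<forall>x. \<bar>1 / p (x + s) - 1 / p x\<bar> \<le> d"
      "\<forall>x. \<bar>(q (x + s) - l * w (x + s)) - (q x - l * w x)\<bar> \<le> d" "d * K < 1" for s d
  proof -
    have "\<bar>sin (\<theta> (x + s) - \<theta> x)\<bar> \<le> d * K" for x
      using that(1,2) by (intro close) (simp_all add: a_def r_def)
    from abs_sin_mean_slope_le[OF c\<theta> lim this that(3)] show ?thesis .
  qed
  show ?thesis
    unfolding \<rho>
    by (rule exI[of _ u], rule exI[of _ v], rule exI[of _ \<theta>], intro conjI allI impI)
      (use sys[unfolded a_def r_def] pos decay ph lim sin in blast)+
qed

text \<open>The approximation argument works with the group generated by the individual frequencies,
  whereas the joint module is generated by three groups. A number outside the latter is thereby
  outside the former.\<close>

lemma group_closure_UN_subset_joint: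
  "group_closure (\<Union>f\<in>{\<lambda>x. complex_of_real (p x), \<lambda>x. complex_of_real (q x), \<lambda>x. complex_of_real (w x)}.
      {l. bohr_coeff f l \<noteq> 0}) \<subseteq> joint_frequency_module p q w"
proof
  fix x
  assume "x \<in> group_closure (\<Union>f\<in>{\<lambda>x. complex_of_real (p x), \<lambda>x. complex_of_real (q x), \<lambda>x. complex_of_real (w x)}.
      {l. bohr_coeff f l \<noteq> 0})"
  then show "x \<in> joint_frequency_module p q w"
    unfolding joint_frequency_module_def
  proof (induction rule: group_closure.induct)
    case (base s)
    have "s \<in> insert 0 (frequency_module (\<lambda>x. complex_of_real (p x)) \<union> frequency_module (\<lambda>x. complex_of_real (q x)) \<union>
        frequency_module (\<lambda>x. complex_of_real (w x)))"
      using base unfolding frequency_module_def by (auto intro: group_closure.base)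
    then show ?case by (rule group_closure.base)
  qed (rule group_closure.diff)
qed

theorem theorem1p3:
  fixes p q w :: "real \<Rightarrow> real" and J :: "real set"
  assumes "almost_periodic_pos p" and "almost_periodic q" and "almost_periodic_pos w"
    and "open J" and "is_interval J"
    and "\<And>l. l \<in> J \<Longrightarrow> complex_of_real l \<notin> SL_spectrum p q w"
  shows "rotation_number p q w constant_on J \<and>
         (\<forall>l\<in>J. 2 * rotation_number p q w l \<in> joint_frequency_module p q w)"
proof -
  have ap: "almost_periodic p" "almost_periodic q" "almost_periodic w"
    using assms(1-3) by (auto simp: almost_periodic_pos_def)
  have cont: "continuous_on UNIV p" "continuous_on UNIV q" "continuous_on UNIV w"
    using ap by (auto dest: almost_periodic_continuous)
  obtain p0 where p0: "p0 > 0" "\<And>x. p0 \<le> p x" using almost_periodic_pos_lower_bound[OF assms(1)] by blast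
  obtain w0 where w0: "w0 > 0" "\<And>x. w0 \<le> w x" using almost_periodic_pos_lower_bound[OF assms(3)] by blast
  obtain p1 where p1: "p1 > 0" "\<And>x. norm (p x) \<le> p1" using almost_periodic_bounded[OF ap(1)] by blast
  obtain Q where Q: "Q > 0" "\<And>x. norm (q x) \<le> Q" using almost_periodic_bounded[OF ap(2)] by blast
  obtain w1 where w1: "w1 > 0" "\<And>x. norm (w x) \<le> w1" using almost_periodic_bounded[OF ap(3)] by blast
  have p1': "p x \<le> p1" and w1': "w x \<le> w1" and Q': "\<bar>q x\<bar> \<le> Q" for x
    using p1(2)[of x] w1(2)[of x] Q(2)[of x] by simp_all
  have ppos: "p x > 0" and wpos: "w x > 0" for x using p0(1) p0(2)[of x] w0(1) w0(2)[of x] by linarith+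
  have pne: "p x \<noteq> 0" for x using ppos[of x] by simp
  \<comment> \<open>A tolerance for \<open>p\<close>, \<open>q\<close> and \<open>w\<close> that
    keeps \<open>1 / p\<close> and \<open>q - l * w\<close> within \<open>d\<close>: the first entry
    accounts for inverting \<open>p \<ge> p0\<close>, the second for the size of the spectral
    parameter.\<close>
  define T where "T l d = min (d * p0\<^sup>2) (d / (1 + \<bar>l\<bar>))" for l d :: real
  have Tpos: "T l d > 0" if "d > 0" for l d using that p0(1) by (simp add: T_def)
  have da: "\<bar>1 / p (x + s) - 1 / p x\<bar> \<le> d"
    if "\<bar>p (x + s) - p x\<bar> < T l d" for l d s x
  proof -
    have eq: "1 / p (x + s) - 1 / p x = (p x - p (x + s)) / (p (x + s) * p x)"
      using pne by (simp add: field_simps)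
    have pp: "p0\<^sup>2 \<le> p (x + s) * p x"
      unfolding power2_eq_square using p0 by (intro mult_mono) (auto intro: order_trans less_imp_le)
    have "\<bar>p x - p (x + s)\<bar> \<le> d * p0\<^sup>2" using that by (simp add: T_def abs_minus_commute)
    have "0 < p (x + s) * p x" using ppos by simp
    have "0 \<le> d"
    proof -
      have "0 < d * p0\<^sup>2" using that abs_ge_zero[of "p (x + s) - p x"] by (simp add: T_def del: abs_ge_zero)
      then show ?thesis using p0(1) by (simp add: zero_less_mult_iff)
    qed
    then have "d * p0\<^sup>2 \<le> d * (p (x + s) * p x)" using pp by (intro mult_left_mono)
    with \<open>\<bar>p x - p (x + s)\<bar> \<le> d * p0\<^sup>2\<close> have "\<bar>p x - p (x + s)\<bar> \<le> d * (p (x + s) * p x)" by linarith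
    then have "\<bar>p x - p (x + s)\<bar> / (p (x + s) * p x) \<le> d"
      using \<open>0 < p (x + s) * p x\<close> by (simp only: pos_divide_le_eq)
    then show ?thesis unfolding eq abs_divide abs_of_pos[OF \<open>0 < p (x + s) * p x\<close>] .
  qed
  have dr: "\<bar>(q (x + s) - l * w (x + s)) - (q x - l * w x)\<bar> \<le> d"
    if "\<bar>q (x + s) - q x\<bar> < T l d" "\<bar>w (x + s) - w x\<bar> < T l d" for l d s x
  proof -
    have "(q (x + s) - l * w (x + s)) - (q x - l * w x) = (q (x + s) - q x) - l * (w (x + s) - w x)"
      by (simp add: algebra_simps)
    also have "\<bar>\<dots>\<bar> \<le> \<bar>q (x + s) - q x\<bar> + \<bar>l\<bar> * \<bar>w (x + s) - w x\<bar>"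
      using abs_triangle_ineq4[of "q (x + s) - q x" "l * (w (x + s) - w x)"] by (simp add: abs_mult)
    also have "\<dots> \<le> T l d + \<bar>l\<bar> * T l d" using that by (intro add_mono mult_left_mono) auto
    also have "\<dots> = (1 + \<bar>l\<bar>) * T l d" by (simp add: distrib_right)
    also have "\<dots> \<le> (1 + \<bar>l\<bar>) * (d / (1 + \<bar>l\<bar>))" by (intro mult_left_mono) (auto simp: T_def)
    also have "\<dots> = d" by (simp add: add_nonneg_eq_0_iff)
    finally show ?thesis .
  qed
  have rec: "\<exists>s\<ge>L. \<forall>x. \<bar>1 / p (x + s) - 1 / p x\<bar> \<le> d \<and>
      \<bar>(q (x + s) - l * w (x + s)) - (q x - l * w x)\<bar> \<le> d" if d0: "d > 0" for l d L
  proof -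
    have "\<exists>s\<ge>L. \<forall>f\<in>{p, q, w}. \<forall>x. \<bar>f (x + s) - f x\<bar> < T l d"
      by (rule large_common_almost_period) (use ap Tpos[OF d0] in auto)
    then obtain s where "s \<ge> L" and s: "\<And>x. \<bar>p (x + s) - p x\<bar> < T l d"
      "\<And>x. \<bar>q (x + s) - q x\<bar> < T l d" "\<And>x. \<bar>w (x + s) - w x\<bar> < T l d"
      by blast
    then show ?thesis using da[OF s(1)] dr[OF s(2,3)] by blast
  qed
  have loc: "\<exists>e>0. \<exists>K\<ge>0. \<forall>l. \<bar>l - l0\<bar> < e \<longrightarrow> (\<forall>u v s t. linear_system (\<lambda>x. 1 / p x) (\<lambda>x. q x - l * w x) u v \<longrightarrow>
      s \<le> t \<longrightarrow> integral {s..t} (energy u v) \<le> K * (energy u v s + energy u v t))" if l0: "l0 \<in> J" for l0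
    by (rule resolvent_imp_energy_bound[OF cont p0 p1' Q' w0 w1' assms(6)[OF l0]])
  have gap: "\<exists>u v \<theta>. linear_system (\<lambda>x. 1 / p x) (\<lambda>x. q x - l * w x) u v \<and>
      (\<forall>x. energy u v x > 0) \<and> (\<forall>s X. s \<le> X \<longrightarrow> integral {s..X} (energy u v) \<le> K * energy u v s) \<and>
      is_phase u v \<theta> \<and> ((\<lambda>x. (\<theta> x - \<theta> 0) / x) \<longlongrightarrow> rotation_number p q w l) at_top \<and>
      (\<forall>s d. (\<forall>x. \<bar>1 / p (x + s) - 1 / p x\<bar> \<le> d) \<longrightarrow>
        (\<forall>x. \<bar>(q (x + s) - l * w (x + s)) - (q x - l * w x)\<bar> \<le> d) \<longrightarrow> d * K < 1 \<longrightarrow>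
        \<bar>sin (rotation_number p q w l * s)\<bar> \<le> d * K)"
    if K: "\<forall>u v s t. linear_system (\<lambda>x. 1 / p x) (\<lambda>x. q x - l * w x) u v \<longrightarrow>
      s \<le> t \<longrightarrow> integral {s..t} (energy u v) \<le> K * (energy u v s + energy u v t)" for l K
  proof -
    define B where "B = max (1 / p0) (Q + \<bar>l\<bar> * w1)"
    have Ba: "\<bar>1 / p x\<bar> \<le> B" for x
    proof -
      have "1 / p x \<le> 1 / p0" using p0 ppos[of x] by (intro divide_left_mono mult_pos_pos) auto
      then show ?thesis using ppos[of x] by (simp add: B_def)
    qed
    have Br: "\<bar>q x - l * w x\<bar> \<le> B" for x
    proof -
      have "\<bar>l * w x\<bar> \<le> \<bar>l\<bar> * w1" using w1(2)[of x] by (simp add: abs_mult mult_left_mono)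
      then have "\<bar>q x - l * w x\<bar> \<le> Q + \<bar>l\<bar> * w1" using Q'[of x] by linarith
      then show ?thesis by (simp add: B_def)
    qed
    have K': "integral {s..t} (energy u v) \<le> K * (energy u v s + energy u v t)"
      if "linear_system (\<lambda>x. 1 / p x) (\<lambda>x. q x - l * w x) u v" "s \<le> t" for u v s t
      using K that by blast
    show ?thesis
      by (rule gap_rotation_number[OF cont pne Ba Br K' rec])
  qed
  have "rotation_number p q w constant_on J"
  proof (rule locally_constant_imp_constant)
    show "connected J" using assms(5) by (rule is_interval_connected)
    fix l0 assume l0: "l0 \<in> J"
    obtain e K where e: "e > 0" and K: "K \<ge> 0" and bound: "\<And>l. \<bar>l - l0\<bar> < e \<Longrightarrow>
        (\<forall>u v s t. linear_system (\<lambda>x. 1 / p x) (\<lambda>x. q x - l * w x) u v \<longrightarrow>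
          s \<le> t \<longrightarrow> integral {s..t} (energy u v) \<le> K * (energy u v s + energy u v t))"
      using loc[OF l0] by blast
    \<comment> \<open>Changing the spectral parameter from \<open>l0\<close> to \<open>l\<close>
      moves \<open>q - l0 * w\<close> by at most \<open>w1 * |l - l0|\<close>. This radius keeps the
      sine of the phase difference at most \<open>1 / 2\<close>, so the two phases stay at bounded
      distance and share their mean slope.\<close>
    define d where "d = min e (1 / (2 * (w1 * K + 1)))"
    have wK: "w1 * K + 1 > 0" using w1(1) K by (intro add_nonneg_pos) auto
    have d: "d > 0" using e wK by (simp add: d_def)
    have same: "rotation_number p q w l = rotation_number p q w l0" if l: "\<bar>l - l0\<bar> < d" for l
    proof -
      have le: "\<bar>l - l0\<bar> < e" "\<bar>l0 - l0\<bar> < e" using l e by (auto simp: d_def)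
      obtain u v \<theta> where 1: "linear_system (\<lambda>x. 1 / p x) (\<lambda>x. q x - l * w x) u v"
        "\<And>x. energy u v x > 0" "\<And>s X. s \<le> X \<Longrightarrow> integral {s..X} (energy u v) \<le> K * energy u v s"
        "is_phase u v \<theta>" "((\<lambda>x. (\<theta> x - \<theta> 0) / x) \<longlongrightarrow> rotation_number p q w l) at_top"
        using gap[OF bound[OF le(1)]] by blast
      obtain u' v' \<theta>' where 2: "linear_system (\<lambda>x. 1 / p x) (\<lambda>x. q x - l0 * w x) u' v'"
        "\<And>x. energy u' v' x > 0" "\<And>s X. s \<le> X \<Longrightarrow> integral {s..X} (energy u' v') \<le> K * energy u' v' s"
        "is_phase u' v' \<theta>'" "((\<lambda>x. (\<theta>' x - \<theta>' 0) / x) \<longlongrightarrow> rotation_number p q w l0) at_top"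
        using gap[OF bound[OF le(2)]] by blast
      define h where "h = w1 * \<bar>l - l0\<bar>"
      have s: "\<bar>sin (\<theta> x - \<theta>' x)\<bar> < 1" for x
      proof -
        have "\<bar>sin (\<theta> x - \<theta>' x)\<bar> \<le> h * K"
        proof (rule abs_sin_phase_diff_le[OF 1(1) 2(1) 1(3) 2(3) _ _ 1(2) 2(2) 1(4) 2(4)])
          show "\<bar>1 / p y - 1 / p y\<bar> \<le> h" for y using w1(1) by (simp add: h_def)
          show "\<bar>(q y - l * w y) - (q y - l0 * w y)\<bar> \<le> h" for y
          proof -
            have "(q y - l * w y) - (q y - l0 * w y) = - (w y * (l - l0))" by (simp add: algebra_simps)
            then have "\<bar>(q y - l * w y) - (q y - l0 * w y)\<bar> = \<bar>w y\<bar> * \<bar>l - l0\<bar>"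
              by (simp only: abs_minus_cancel abs_mult)
            also have "\<dots> \<le> h" unfolding h_def using w1(2)[of y] by (intro mult_right_mono) auto
            finally show ?thesis .
          qed
        qed
        also have "h * K = (w1 * K) * \<bar>l - l0\<bar>" by (simp add: h_def)
        also have "\<dots> \<le> (w1 * K + 1) * \<bar>l - l0\<bar>" by (intro mult_right_mono) auto
        also have "\<dots> \<le> (w1 * K + 1) * (1 / (2 * (w1 * K + 1)))"
          using l wK by (intro mult_left_mono) (auto simp: d_def)
        also have "\<dots> = 1 / 2" using wK by simp
        finally show ?thesis by simp
      qed
      have c: "continuous_on UNIV (\<lambda>x. \<theta> x - \<theta>' x)"
        using 1(4) 2(4) by (intro continuous_on_diff) (auto simp: is_phase_def)
      obtain k :: int where k: "\<And>x. \<bar>\<theta> x - \<theta>' x - of_int k * pi\<bar> < pi / 2"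
        using sin_bounded_imp_near_int_pi[OF c s] by blast
      have "\<bar>\<theta> x - \<theta>' x\<bar> \<le> pi / 2 + \<bar>of_int k * pi\<bar>" for x using k[of x] by linarith
      from mean_slope_cong_of_bounded[OF 1(5) this] 2(5)
      show ?thesis by (intro tendsto_unique[OF trivial_limit_at_top_linorder])
    qed
    show "\<exists>U. openin (top_of_set J) U \<and> l0 \<in> U \<and> (\<forall>l\<in>U. rotation_number p q w l = rotation_number p q w l0)"
    proof (intro exI[of _ "J \<inter> ball l0 d"] conjI ballI)
      show "openin (top_of_set J) (J \<inter> ball l0 d)" by (intro openin_open_Int open_ball)
      show "l0 \<in> J \<inter> ball l0 d" using l0 d by simp
      fix l assume "l \<in> J \<inter> ball l0 d"
      then have "\<bar>l - l0\<bar> < d" by (simp add: dist_real_def abs_minus_commute)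
      then show "rotation_number p q w l = rotation_number p q w l0" by (rule same)
    qed
  qed
  moreover have "2 * rotation_number p q w l \<in> joint_frequency_module p q w" if l: "l \<in> J" for l
  proof (rule ccontr)
    assume notin: "2 * rotation_number p q w l \<notin> joint_frequency_module p q w"
    define \<rho> where "\<rho> = rotation_number p q w l"
    obtain e K where e: "e > 0" and K: "K \<ge> 0" and near: "\<forall>l'. \<bar>l' - l\<bar> < e \<longrightarrow>
        (\<forall>u v s t. linear_system (\<lambda>x. 1 / p x) (\<lambda>x. q x - l' * w x) u v \<longrightarrow>
          s \<le> t \<longrightarrow> integral {s..t} (energy u v) \<le> K * (energy u v s + energy u v t))"
      using loc[OF l] by blast
    have bound: "\<forall>u v s t. linear_system (\<lambda>x. 1 / p x) (\<lambda>x. q x - l * w x) u v \<longrightarrow>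
          s \<le> t \<longrightarrow> integral {s..t} (energy u v) \<le> K * (energy u v s + energy u v t)"
      using near[THEN spec, of l] e by simp
    have \<rho>: "\<bar>sin (\<rho> * s)\<bar> \<le> d * K"
      if "\<And>x. \<bar>1 / p (x + s) - 1 / p x\<bar> \<le> d" "\<And>x. \<bar>(q (x + s) - l * w (x + s)) - (q x - l * w x)\<bar> \<le> d" "d * K < 1"
      for s d
      using gap[OF bound] that unfolding \<rho>_def by blast
    \<comment> \<open>Leads to \<open>|sin (\<rho> * t)| \<le> 1 / 3\<close>, hence
      \<open>cos (2 * \<rho> * t) \<ge> 7 / 9\<close>, which is incompatible with the bound
      \<open>1 / 2\<close> for an almost period chosen against \<open>2 * \<rho>\<close>.\<close>
    define d where "d = 1 / (3 * (K + 1))"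
    have d: "d > 0" using K by (simp add: d_def)
    have "d * K \<le> d * (K + 1)" using d by (intro mult_left_mono) auto
    also have "d * (K + 1) = 1 / 3" using K by (simp add: d_def)
    finally have dK: "d * K \<le> 1 / 3" .
    define F where "F = {\<lambda>x. complex_of_real (p x), \<lambda>x. complex_of_real (q x), \<lambda>x. complex_of_real (w x)}"
    have F: "finite F" "\<And>f. f \<in> F \<Longrightarrow> almost_periodic f"
      using ap by (auto simp: F_def intro: almost_periodic_of_real)
    have "2 * \<rho> \<notin> group_closure (\<Union>f\<in>F. {l. bohr_coeff f l \<noteq> 0})"
      using notin group_closure_UN_subset_joint[of p q w] unfolding F_def \<rho>_def by blast
    from common_almost_period_off_module[OF F this Tpos[OF d]]
    obtain t where t: "\<And>f x. f \<in> F \<Longrightarrow> norm (f (x + t) - f x) < T l d" and ct: "cos (2 * \<rho> * t) \<le> 1 / 2"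
      by blast
    have pt: "\<bar>p (x + t) - p x\<bar> < T l d" and qt: "\<bar>q (x + t) - q x\<bar> < T l d" and wt: "\<bar>w (x + t) - w x\<bar> < T l d" for x
      using t[of "\<lambda>x. complex_of_real (p x)" x] t[of "\<lambda>x. complex_of_real (q x)" x] t[of "\<lambda>x. complex_of_real (w x)" x]
      by (simp_all add: F_def flip: of_real_diff)
    have "\<bar>sin (\<rho> * t)\<bar> \<le> d * K"
      using dK by (intro \<rho> da[OF pt] dr[OF qt wt]) auto
    then have "\<bar>sin (\<rho> * t)\<bar>\<^sup>2 \<le> (1 / 3)\<^sup>2" using dK by (intro power_mono) auto
    then have "cos (2 * (\<rho> * t)) \<ge> 1 - 2 / 9"
      unfolding cos_double_sin by (simp add: power_divide)
    with ct show False by (simp add: mult.assoc)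
  qed
  ultimately show ?thesis by blast
qed

end
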